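(* Let $G$ be either (i) a symmetric subgroup of $\mathrm{GL}_m(\mathbb{C})\times\mathrm{GL}_n(\mathbb{C})$ with $T_m(\mathbb{C})\times T_n(\mathbb{C})\le G$, acting on $\mathbb{C}^{m\times n}$ by $(X,Y)\cdot A=XAY^{-1}$, or (ii) a symmetric subgroup of $\mathrm{GL}_m(\mathbb{C})$ with $T_m(\mathbb{C})\le G$, acting by $X\cdot A=XA$ (in this case write $Y=I_n$ below). Let $A\in\mathbb{C}^{m\times n}$ be of full rank, define $\widetilde\kappa_F(X,Y)=\|XAY^{-1}\|_F\,\|YA^\dagger X^{-1}\|_F$ and $\kappa_F^\star=\inf_{(X,Y)\in G}\widetilde\kappa_F(X,Y)$, and let $C(K(X,Y))=\log\widetilde\kappa_F(X,Y)$. Consider the gradient descent iteration $(X_0,Y_0)=(I_m,I_n)$, $(X_{k+1},Y_{k+1})=(e^{-\eta H_k}X_k,e^{-\eta H_k'}Y_k)$ with $(H_k,H_k')=\nabla C(K(X_k,Y_k))$ and step size $\eta=1/8$. There is an absolute constant $c>0$ such that for every $0<\varepsilon<1/2$ and every integer $T\ge c\,\max(m^3,n^3)\,\log(\kappa_F(A)/\kappa_F^\star)/\varepsilon^2$, one has $\log\widetilde\kappa_F(X_T,Y_T)-\log\kappa_F^\star<\varepsilon$, where $\kappa_F(A)=\|A\|_F\|A^\dagger\|_F$.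
   Context: $T_m(\mathbb{C})$ denotes the group of invertible diagonal $m\times m$ matrices. A subgroup is symmetric if it is Zariski closed and closed under conjugate transposition (componentwise). $K=G\cap(\mathrm{U}_m\times\mathrm{U}_n)$ (resp. $G\cap\mathrm{U}_m$); $\mathrm{Lie}(G)=\{(H_1,H_2):(e^{tH_1},e^{tH_2})\in G\ \forall t\}$; $i\mathrm{Lie}(K)$ is the set of Hermitian pairs in $\mathrm{Lie}(G)$. The gradient $\nabla f(Kg)\in i\mathrm{Lie}(K)$ of smooth $f$ on $G/K$ is defined by $\langle\nabla f(Kg),H\rangle=\frac{d}{dt}|_{t=0}f(Ke^{tH}g)$ for all $H\in i\mathrm{Lie}(K)$, with $\langle(H_1,H_2),(H_3,H_4)\rangle=\mathrm{Re}(\mathrm{tr}(H_1^*H_3)+\mathrm{tr}(H_2^*H_4))$ and $e^{tH}(X,Y)=(e^{tH_1}X,e^{tH_2}Y)$. $^\dagger$ is the Moore–Penrose pseudoinverse. ($\widetilde\kappa_F(X,Y)=\kappa_F(XAY^{-1})$ when $A$ is invertible, or in case (ii) when $\mathrm{rank}A=m$.) *)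

theory Defs
  imports "HOL-Analysis.Analysis" "Jordan_Normal_Form.Matrix" "Jordan_Normal_Form.DL_Rank"
begin

definition ctrans :: "complex mat \<Rightarrow> complex mat" where
  "ctrans A = mat (dim_col A) (dim_row A) (\<lambda>(i,j). cnj (A $$ (j,i)))"

definition hermitian :: "complex mat \<Rightarrow> bool" where
  "hermitian H \<longleftrightarrow> square_mat H \<and> ctrans H = H"

definition mtrace :: "complex mat \<Rightarrow> complex" where
  "mtrace A = (\<Sum>i<dim_row A. A $$ (i,i))"

definition minv :: "complex mat \<Rightarrow> complex mat" where
  "minv X = (THE Y. Y \<in> carrier_mat (dim_row X) (dim_row X) \<and>
                    X * Y = 1\<^sub>m (dim_row X) \<and> Y * X = 1\<^sub>m (dim_row X))"

definition pinv :: "complex mat \<Rightarrow> complex mat" where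
  "pinv A = (THE B. B \<in> carrier_mat (dim_col A) (dim_row A) \<and>
                    A * B * A = A \<and> B * A * B = B \<and>
                    ctrans (A * B) = A * B \<and> ctrans (B * A) = B * A)"

definition frob :: "complex mat \<Rightarrow> real" where
  "frob A = sqrt (\<Sum>i<dim_row A. \<Sum>j<dim_col A. (cmod (A $$ (i,j)))^2)"

definition mexp :: "complex mat \<Rightarrow> complex mat" where
  "mexp H = mat (dim_row H) (dim_col H)
              (\<lambda>(i,j). \<Sum>k. (H ^\<^sub>m k) $$ (i,j) / of_nat (fact k))"

inductive_set polyfun :: "(('v \<Rightarrow> complex) \<Rightarrow> complex) set" where
  pf_const: "(\<lambda>x. c) \<in> polyfun"
| pf_var: "(\<lambda>x. x v) \<in> polyfun"
| pf_add: "p \<in> polyfun \<Longrightarrow> q \<in> polyfun \<Longrightarrow> (\<lambda>x. p x + q x) \<in> polyfun"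
| pf_mult: "p \<in> polyfun \<Longrightarrow> q \<in> polyfun \<Longrightarrow> (\<lambda>x. p x * q x) \<in> polyfun"

definition zariski_closed_in :: "('a \<Rightarrow> 'v \<Rightarrow> complex) \<Rightarrow> 'a set \<Rightarrow> 'a set \<Rightarrow> bool" where
  "zariski_closed_in coords U S \<longleftrightarrow>
     (\<exists>P \<subseteq> polyfun. S = {x \<in> U. \<forall>p\<in>P. p (coords x) = 0})"

definition mat_coords :: "complex mat \<Rightarrow> nat \<times> nat \<Rightarrow> complex" where
  "mat_coords X = (\<lambda>(i,j). if i < dim_row X \<and> j < dim_col X then X $$ (i,j) else 0)"

definition pair_coords :: "complex mat \<times> complex mat \<Rightarrow> bool \<times> nat \<times> nat \<Rightarrow> complex" where
  "pair_coords XY = (\<lambda>(b,ij). if b then mat_coords (snd XY) ij else mat_coords (fst XY) ij)"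

definition GL :: "nat \<Rightarrow> complex mat set" where
  "GL m = {X \<in> carrier_mat m m. invertible_mat X}"

definition GL2 :: "nat \<Rightarrow> nat \<Rightarrow> (complex mat \<times> complex mat) set" where
  "GL2 m n = GL m \<times> GL n"

definition diag_torus :: "nat \<Rightarrow> complex mat set" where
  "diag_torus m = {X \<in> carrier_mat m m. (\<forall>i<m. \<forall>j<m. i \<noteq> j \<longrightarrow> X $$ (i,j) = 0) \<and>
                                         (\<forall>i<m. X $$ (i,i) \<noteq> 0)}"

definition symmetric_subgroup1 :: "nat \<Rightarrow> complex mat set \<Rightarrow> bool" where
  "symmetric_subgroup1 m G \<longleftrightarrow>
     G \<subseteq> GL m \<and> 1\<^sub>m m \<in> G \<and> (\<forall>X\<in>G. \<forall>Y\<in>G. X * Y \<in> G) \<and> (\<forall>X\<in>G. minv X \<in> G) \<and>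
     zariski_closed_in mat_coords (GL m) G \<and> (\<forall>X\<in>G. ctrans X \<in> G)"

definition symmetric_subgroup2 :: "nat \<Rightarrow> nat \<Rightarrow> (complex mat \<times> complex mat) set \<Rightarrow> bool" where
  "symmetric_subgroup2 m n G \<longleftrightarrow>
     G \<subseteq> GL2 m n \<and> (1\<^sub>m m, 1\<^sub>m n) \<in> G \<and>
     (\<forall>(X,Y)\<in>G. \<forall>(X',Y')\<in>G. (X * X', Y * Y') \<in> G) \<and>
     (\<forall>(X,Y)\<in>G. (minv X, minv Y) \<in> G) \<and>
     zariski_closed_in pair_coords (GL2 m n) G \<and>
     (\<forall>(X,Y)\<in>G. (ctrans X, ctrans Y) \<in> G)"

text \<open>All of the following is for a set G of pairs; case (ii) is handled by the embedding
  X \<mapsto> (X, I_n), whose Lie algebra is {(H,0)}.\<close>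

definition LieG :: "nat \<Rightarrow> nat \<Rightarrow> (complex mat \<times> complex mat) set \<Rightarrow> (complex mat \<times> complex mat) set" where
  "LieG m n G = {(H1,H2). H1 \<in> carrier_mat m m \<and> H2 \<in> carrier_mat n n \<and>
       (\<forall>t::real. (mexp (of_real t \<cdot>\<^sub>m H1), mexp (of_real t \<cdot>\<^sub>m H2)) \<in> G)}"

definition iLieK :: "nat \<Rightarrow> nat \<Rightarrow> (complex mat \<times> complex mat) set \<Rightarrow> (complex mat \<times> complex mat) set" where
  "iLieK m n G = {(H1,H2) \<in> LieG m n G. hermitian H1 \<and> hermitian H2}"

definition pair_inner :: "complex mat \<times> complex mat \<Rightarrow> complex mat \<times> complex mat \<Rightarrow> real" where
  "pair_inner H H' = Re (mtrace (ctrans (fst H) * fst H') + mtrace (ctrans (snd H) * snd H'))"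

definition gradient :: "nat \<Rightarrow> nat \<Rightarrow> (complex mat \<times> complex mat) set \<Rightarrow>
    (complex mat \<times> complex mat \<Rightarrow> real) \<Rightarrow> complex mat \<times> complex mat \<Rightarrow> complex mat \<times> complex mat" where
  "gradient m n G f XY = (THE H. H \<in> iLieK m n G \<and>
      (\<forall>H' \<in> iLieK m n G.
         ((\<lambda>t::real. f (mexp (of_real t \<cdot>\<^sub>m fst H') * fst XY, mexp (of_real t \<cdot>\<^sub>m snd H') * snd XY))
            has_real_derivative pair_inner H H') (at 0)))"

definition kappa_tilde :: "complex mat \<Rightarrow> complex mat \<times> complex mat \<Rightarrow> real" where
  "kappa_tilde A XY = frob (fst XY * A * minv (snd XY)) * frob (snd XY * pinv A * minv (fst XY))"

definition kappaF :: "complex mat \<Rightarrow> real" where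
  "kappaF A = frob A * frob (pinv A)"

definition kappa_star :: "(complex mat \<times> complex mat) set \<Rightarrow> complex mat \<Rightarrow> real" where
  "kappa_star G A = Inf (kappa_tilde A ` G)"

definition costC :: "complex mat \<Rightarrow> complex mat \<times> complex mat \<Rightarrow> real" where
  "costC A XY = ln (kappa_tilde A XY)"

fun gd_seq :: "nat \<Rightarrow> nat \<Rightarrow> (complex mat \<times> complex mat) set \<Rightarrow> complex mat \<Rightarrow> real \<Rightarrow> nat
    \<Rightarrow> complex mat \<times> complex mat" where
  "gd_seq m n G A \<eta> 0 = (1\<^sub>m m, 1\<^sub>m n)"
| "gd_seq m n G A \<eta> (Suc k) =
     (let XY = gd_seq m n G A \<eta> k; H = gradient m n G (costC A) XY in
       (mexp (of_real (-\<eta>) \<cdot>\<^sub>m fst H) * fst XY, mexp (of_real (-\<eta>) \<cdot>\<^sub>m snd H) * snd XY))"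

definition embed1 :: "nat \<Rightarrow> complex mat set \<Rightarrow> (complex mat \<times> complex mat) set" where
  "embed1 n G = (\<lambda>X. (X, 1\<^sub>m n)) ` G"

end

theory Submission
  imports Defs "Jordan_Normal_Form.Schur_Decomposition" "Jordan_Normal_Form.Spectral_Radius"
begin

text \<open>
  Along a geodesic \<open>t \<mapsto> e\<^bsup>tH\<^esup>(X, Y)\<close> with \<open>H = (U diag(l) U\<^sup>*, V diag(r) V\<^sup>*)\<close>, each of the two
  squared norms in \<open>\<kappa>\<close> is, up to a constant factor, a mean of the exponentials
  \<open>e\<^bsup>\<plusminus>2t(l\<^sub>i - r\<^sub>j)\<^esup>\<close>. A second-order bound on these means shows that a
  step with \<open>\<eta> = 1/8\<close> decreases the cost by at least \<open>\<parallel>\<nabla>C\<parallel>\<^sup>2 / 192\<close>.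

  Conversely, a small gradient certifies near-optimality. By the polar decomposition, every point of
  \<open>G\<close> is reached from the current one along such a geodesic, up to unitary factors. For the
  finitely many numbers \<open>l\<^sub>i\<close>, \<open>r\<^sub>j\<close> there is a potential \<open>p\<close>, bounded by their number, with
  \<open>e\<^bsup>2(a - b)\<^esup> \<ge> 1 + p(a) - p(b)\<close>. Averaging this inequality bounds the cost at the end point from below
  by the derivative of the cost in the direction \<open>(U diag(p(l)) U\<^sup>*, V diag(p(r)) V\<^sup>*)\<close>, whose norm is
  \<open>O((m + n)\<^bsup>3/2\<^esup>)\<close> however long the geodesic is.
  This direction is tangent to \<open>G\<close>: as \<open>G\<close> contains the torus, the
  Hermitian part of its Lie algebra consists of all Hermitian matrices that are block diagonal
  for some partition of the indices, so that it is closed under functional calculus.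
\<close>

subsection \<open>Conjugate transposes, unitary matrices and the Frobenius norm\<close>

text \<open>The infimum over \<open>G\<close> need not be attained: for the two tori and
  \<open>A = [[1,1],[0,1]]\<close> it is approached only as the corner entry is scaled to 0. So the
  usual convexity estimate, gap at most gradient norm times distance to a minimiser, gives nothing.
  What helps is that an exponent \<open>a - b\<close> enters only through \<open>exp\<close>, which
  for a very negative exponent is merely nonnegative: a potential that rises by at most one per
  distinct exponent already certifies the lower bound, however far apart the exponents are. Such a
  potential acts on eigenvalues nonlinearly, so a linear space of directions is not enough; closure
  under arbitrary real functions is what calls for the structure of the Lie algebra. That structure
  in turn needs sums (a limit inside \<open>G\<close>) and conjugation by unitary elements
  (exponentials at imaginary time), and both rest on Zariski closedness. The step size 1/8 is
  matched by the fact that the squared gradient norm never exceeds 8, which keeps every exponent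
  occurring in one step within [-1, 1].\<close>

lemma ctrans_dim [simp]: "dim_row (ctrans A) = dim_col A" "dim_col (ctrans A) = dim_row A"
  by (simp_all add: ctrans_def)

lemma ctrans_carrier [simp]: "A \<in> carrier_mat m n \<Longrightarrow> ctrans A \<in> carrier_mat n m"
  by (rule carrier_matI) simp_all

lemma ctrans_index [simp]:
  "i < dim_col A \<Longrightarrow> j < dim_row A \<Longrightarrow> ctrans A $$ (i, j) = cnj (A $$ (j, i))"
  by (simp add: ctrans_def)

lemma ctrans_ctrans [simp]: "ctrans (ctrans A) = A"
  by (rule eq_matI) auto

lemma index_mult_mat_sum:
  assumes "A \<in> carrier_mat m k" "B \<in> carrier_mat k n" "i < m" "j < n"
  shows "(A * B) $$ (i, j) = (\<Sum>a<k. A $$ (i, a) * B $$ (a, j))"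
  using assms by (auto simp: scalar_prod_def atLeast0LessThan intro!: sum.cong)

lemma ctrans_mult:
  assumes "A \<in> carrier_mat m k" "B \<in> carrier_mat k n"
  shows "ctrans (A * B) = ctrans B * ctrans A"
proof (rule eq_matI)
  fix i j assume "i < dim_row (ctrans B * ctrans A)" "j < dim_col (ctrans B * ctrans A)"
  then have ij: "i < n" "j < m" using assms by auto
  have "ctrans (A * B) $$ (i, j) = cnj (\<Sum>a<k. A $$ (j, a) * B $$ (a, i))"
    using ij assms index_mult_mat_sum[OF assms ij(2,1)] by auto
  also have "\<dots> = (\<Sum>a<k. ctrans B $$ (i, a) * ctrans A $$ (a, j))"
    using ij assms by (auto simp: mult.commute intro!: sum.cong)
  also have "\<dots> = (ctrans B * ctrans A) $$ (i, j)"
    using ij assms by (subst index_mult_mat_sum[of _ n k _ m]) auto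
  finally show "ctrans (A * B) $$ (i, j) = (ctrans B * ctrans A) $$ (i, j)" .
qed (use assms in auto)

lemma ctrans_one [simp]: "ctrans (1\<^sub>m n) = 1\<^sub>m n"
  by (rule eq_matI) auto

lemma ctrans_minus:
  assumes "A \<in> carrier_mat m n" "B \<in> carrier_mat m n"
  shows "ctrans (A - B) = ctrans A - ctrans B"
  using assms by (intro eq_matI) auto

lemma ctrans_add:
  assumes "A \<in> carrier_mat m n" "B \<in> carrier_mat m n"
  shows "ctrans (A + B) = ctrans A + ctrans B"
  using assms by (intro eq_matI) auto

text \<open>The simplifier cannot guess the inner dimension of a product, so it is fixed here.\<close>

lemmas mult_square = assoc_mult_mat[of _ n n _ n _ n] mult_carrier_mat[of _ n n _ n] for n

lemmas mult_rect =
  assoc_mult_mat[of _ m m _ m _ n] assoc_mult_mat[of _ m m _ n _ m]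
  assoc_mult_mat[of _ m m _ n _ n] assoc_mult_mat[of _ m n _ m _ m]
  assoc_mult_mat[of _ m n _ m _ n] assoc_mult_mat[of _ m n _ n _ m]
  assoc_mult_mat[of _ m n _ n _ n] assoc_mult_mat[of _ n m _ m _ m]
  assoc_mult_mat[of _ n m _ m _ n] assoc_mult_mat[of _ n m _ n _ m]
  assoc_mult_mat[of _ n m _ n _ n] assoc_mult_mat[of _ n n _ m _ m]
  assoc_mult_mat[of _ n n _ m _ n] assoc_mult_mat[of _ n n _ n _ m]
  mult_carrier_mat[of _ m m _ n] mult_carrier_mat[of _ m n _ m]
  mult_carrier_mat[of _ m n _ n] mult_carrier_mat[of _ n m _ m]
  mult_carrier_mat[of _ n m _ n] mult_carrier_mat[of _ n n _ m]
  for m n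

definition unitary :: "nat \<Rightarrow> complex mat \<Rightarrow> bool" where
  "unitary n U \<longleftrightarrow> U \<in> carrier_mat n n \<and> ctrans U * U = 1\<^sub>m n \<and> U * ctrans U = 1\<^sub>m n"

lemma unitaryD:
  assumes "unitary n U"
  shows "U \<in> carrier_mat n n" "ctrans U \<in> carrier_mat n n"
    "ctrans U * U = 1\<^sub>m n" "U * ctrans U = 1\<^sub>m n"
  using assms by (auto simp: unitary_def)

lemma unitary_one: "unitary n (1\<^sub>m n)"
  by (simp add: unitary_def)

lemma unitaryI:
  assumes "U \<in> carrier_mat n n" "ctrans U * U = 1\<^sub>m n"
  shows "unitary n U"
  using assms mat_mult_left_right_inverse[of "ctrans U" n U] by (simp add: unitary_def)

lemma unitary_ctrans: "unitary n U \<Longrightarrow> unitary n (ctrans U)"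
  by (auto simp: unitary_def)

lemma unitary_mult:
  assumes "unitary n U" "unitary n V"
  shows "unitary n (U * V)"
proof (rule unitaryI)
  note U = unitaryD[OF assms(1)] and V = unitaryD[OF assms(2)]
  show "U * V \<in> carrier_mat n n" using U V by auto
  have "ctrans (U * V) * (U * V) = (ctrans V * ctrans U) * (U * V)"
    using U V by (simp add: ctrans_mult)
  also have "\<dots> = ctrans V * ((ctrans U * U) * V)"
    using U(1,2) V(1,2) by (simp add: mult_square[where n = n])
  also have "\<dots> = 1\<^sub>m n" unfolding U(3) using V by auto
  finally show "ctrans (U * V) * (U * V) = 1\<^sub>m n" .
qed

lemma unitary_ortho:
  assumes "unitary n U" "i < n" "j < n"
  shows "(\<Sum>a<n. cnj (U $$ (a, i)) * U $$ (a, j)) = (if i = j then 1 else 0)"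
proof -
  note U = unitaryD[OF assms(1)]
  have "(ctrans U * U) $$ (i, j) = (\<Sum>a<n. ctrans U $$ (i, a) * U $$ (a, j))"
    using U(1,2) assms by (intro index_mult_mat_sum) auto
  also have "\<dots> = (\<Sum>a<n. cnj (U $$ (a, i)) * U $$ (a, j))"
    using U(1) assms(2,3) by (intro sum.cong refl) simp
  finally show ?thesis unfolding U(3) index_one_mat(1)[OF assms(2,3)] by (rule sym)
qed

lemma unitary_ortho':
  assumes "unitary n U" "i < n" "j < n"
  shows "(\<Sum>a<n. U $$ (i, a) * cnj (U $$ (j, a))) = (if i = j then 1 else 0)"
proof -
  note U = unitaryD[OF assms(1)]
  have "(U * ctrans U) $$ (i, j) = (\<Sum>a<n. U $$ (i, a) * ctrans U $$ (a, j))"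
    using U(1,2) assms by (intro index_mult_mat_sum) auto
  also have "\<dots> = (\<Sum>a<n. U $$ (i, a) * cnj (U $$ (j, a)))"
    using U(1) assms(2,3) by (intro sum.cong refl) simp
  finally show ?thesis unfolding U(4) index_one_mat(1)[OF assms(2,3)] by (rule sym)
qed

section \<open>The squared Frobenius norm\<close>

definition fsq :: "complex mat \<Rightarrow> real" where
  "fsq A = (\<Sum>i<dim_row A. \<Sum>j<dim_col A. (cmod (A $$ (i, j)))\<^sup>2)"

lemma frob_eq: "frob A = sqrt (fsq A)"
  by (simp add: frob_def fsq_def)

lemma fsq_nonneg [simp]: "0 \<le> fsq A"
  by (auto simp: fsq_def intro!: sum_nonneg)

lemma frob_nonneg [simp]: "0 \<le> frob A"
  by (simp add: frob_eq)

lemma frob_sq: "(frob A)\<^sup>2 = fsq A"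
  by (simp add: frob_eq)

lemma fsq_eq_0:
  assumes "A \<in> carrier_mat m n" "fsq A = 0"
  shows "A = 0\<^sub>m m n"
proof (rule eq_matI)
  fix i j assume "i < dim_row (0\<^sub>m m n)" "j < dim_col (0\<^sub>m m n)"
  then have ij: "i < m" "j < n" by auto
  have "(\<Sum>j<dim_col A. (cmod (A $$ (i, j)))\<^sup>2) = 0"
    using assms ij by (auto simp: fsq_def sum_nonneg_eq_0_iff sum_nonneg)
  then have "A $$ (i, j) = 0" using assms ij by (auto simp: sum_nonneg_eq_0_iff)
  then show "A $$ (i, j) = 0\<^sub>m m n $$ (i, j)" using ij by simp
qed (use assms in auto)

lemma fsq_pos:
  assumes "A \<in> carrier_mat m n" "A \<noteq> 0\<^sub>m m n"
  shows "fsq A > 0"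
  using fsq_eq_0[OF assms(1)] assms(2) fsq_nonneg[of A] by linarith

lemma fsq_ctrans [simp]: "fsq (ctrans A) = fsq A"
proof -
  have "fsq (ctrans A) = (\<Sum>i<dim_col A. \<Sum>j<dim_row A. (cmod (A $$ (j, i)))\<^sup>2)"
    by (auto simp: fsq_def intro!: sum.cong)
  also have "\<dots> = fsq A" unfolding fsq_def by (rule sum.swap)
  finally show ?thesis .
qed

lemma fsq_trace: "complex_of_real (fsq A) = mtrace (ctrans A * A)"
proof -
  have "mtrace (ctrans A * A) = (\<Sum>i<dim_col A. \<Sum>a<dim_row A. cnj (A $$ (a, i)) * A $$ (a, i))"
    unfolding mtrace_def
    by (auto simp: index_mult_mat_sum[of "ctrans A" "dim_col A" "dim_row A" A "dim_col A"]
        simp del: index_mult_mat(1) intro!: sum.cong)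
  also have "\<dots> = (\<Sum>i<dim_col A. \<Sum>a<dim_row A. complex_of_real ((cmod (A $$ (a, i)))\<^sup>2))"
    by (intro sum.cong refl) (simp only: complex_norm_square mult.commute)
  also have "\<dots> = complex_of_real (\<Sum>i<dim_col A. \<Sum>a<dim_row A. (cmod (A $$ (a, i)))\<^sup>2)"
    by simp
  also have "(\<Sum>i<dim_col A. \<Sum>a<dim_row A. (cmod (A $$ (a, i)))\<^sup>2) = fsq A"
    unfolding fsq_def by (rule sum.swap)
  finally show ?thesis by simp
qed

lemma fsq_gram_cong:
  "ctrans A * A = ctrans B * B \<Longrightarrow> fsq A = fsq B"
  using fsq_trace[of A] fsq_trace[of B] by (metis of_real_eq_iff)

lemma fsq_unitary_left:
  assumes "unitary m U" "A \<in> carrier_mat m n"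
  shows "fsq (U * A) = fsq A"
proof (rule fsq_gram_cong)
  note U = unitaryD[OF assms(1)]
  have "ctrans (U * A) * (U * A) = (ctrans A * ctrans U) * (U * A)"
    using U assms by (simp add: ctrans_mult)
  also have "\<dots> = ctrans A * ((ctrans U * U) * A)"
    using U(1,2) assms(2) by (simp add: mult_rect[where m = m and n = n] mult_square[where n = m])
  also have "\<dots> = ctrans A * A" unfolding U(3) using assms by auto
  finally show "ctrans (U * A) * (U * A) = ctrans A * A" .
qed

lemma fsq_unitary_right:
  assumes "unitary n U" "A \<in> carrier_mat m n"
  shows "fsq (A * U) = fsq A"
proof -
  have "fsq (A * U) = fsq (ctrans U * ctrans A)"
    using assms unitaryD(1)[OF assms(1)] by (metis ctrans_mult fsq_ctrans)
  also have "\<dots> = fsq A"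
    using fsq_unitary_left[OF unitary_ctrans[OF assms(1)], of "ctrans A" m] assms(2) by simp
  finally show ?thesis .
qed

lemma frob_L2_set:
  assumes "A \<in> carrier_mat m n"
  shows "frob A = L2_set (\<lambda>p. cmod (A $$ p)) ({..<m} \<times> {..<n})"
  using assms by (simp add: frob_def L2_set_def sum.cartesian_product case_prod_unfold)

lemma frob_triangle:
  assumes "A \<in> carrier_mat m n" "B \<in> carrier_mat m n"
  shows "frob (A + B) \<le> frob A + frob B"
proof -
  have AB: "A + B \<in> carrier_mat m n" using assms by simp
  have "frob (A + B) \<le> L2_set (\<lambda>p. cmod (A $$ p) + cmod (B $$ p)) ({..<m} \<times> {..<n})"
    unfolding frob_L2_set[OF AB]
    by (rule L2_set_mono) (use assms in \<open>auto simp: norm_triangle_ineq\<close>)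
  also have "\<dots> \<le> frob A + frob B"
    unfolding frob_L2_set[OF assms(1)] frob_L2_set[OF assms(2)] by (rule L2_set_triangle_ineq)
  finally show ?thesis .
qed

lemma frob_mult:
  assumes "A \<in> carrier_mat m k" "B \<in> carrier_mat k n"
  shows "frob (A * B) \<le> frob A * frob B"
proof -
  have "fsq (A * B) = (\<Sum>i<m. \<Sum>j<n. (cmod ((A * B) $$ (i, j)))\<^sup>2)"
    using assms by (simp add: fsq_def)
  also have "\<dots> \<le> (\<Sum>i<m. \<Sum>j<n. (\<Sum>a<k. (cmod (A $$ (i, a)))\<^sup>2) * (\<Sum>a<k. (cmod (B $$ (a, j)))\<^sup>2))"
  proof (intro sum_mono)
    fix i j assume ij: "i \<in> {..<m}" "j \<in> {..<n}"
    then have "cmod ((A * B) $$ (i, j)) = cmod (\<Sum>a<k. A $$ (i, a) * B $$ (a, j))"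
      using assms by (subst index_mult_mat_sum) auto
    also have "\<dots> \<le> (\<Sum>a<k. cmod (A $$ (i, a)) * cmod (B $$ (a, j)))"
      by (rule sum_norm_le) (simp add: norm_mult)
    finally have "(cmod ((A * B) $$ (i, j)))\<^sup>2 \<le> (\<Sum>a<k. cmod (A $$ (i, a)) * cmod (B $$ (a, j)))\<^sup>2"
      by (rule power_mono) simp
    also have "\<dots> \<le> (\<Sum>a<k. (cmod (A $$ (i, a)))\<^sup>2) * (\<Sum>a<k. (cmod (B $$ (a, j)))\<^sup>2)"
      by (rule Cauchy_Schwarz_ineq_sum)
    finally show "(cmod ((A * B) $$ (i, j)))\<^sup>2 \<le> \<dots>" .
  qed
  also have "\<dots> = (\<Sum>i<m. \<Sum>a<k. (cmod (A $$ (i, a)))\<^sup>2) * (\<Sum>j<n. \<Sum>a<k. (cmod (B $$ (a, j)))\<^sup>2)"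
    by (simp add: sum_product)
  also have "(\<Sum>j<n. \<Sum>a<k. (cmod (B $$ (a, j)))\<^sup>2) = fsq B"
    using assms unfolding fsq_def by (subst sum.swap) simp
  also have "(\<Sum>i<m. \<Sum>a<k. (cmod (A $$ (i, a)))\<^sup>2) = fsq A"
    using assms by (simp add: fsq_def)
  finally show ?thesis unfolding frob_eq by (metis real_sqrt_le_mono real_sqrt_mult)
qed

lemma frob_entry:
  assumes "A \<in> carrier_mat m n" "i < m" "j < n"
  shows "cmod (A $$ (i, j)) \<le> frob A"
proof -
  have "L2_set (\<lambda>p. cmod (A $$ p)) {(i, j)} \<le> L2_set (\<lambda>p. cmod (A $$ p)) ({..<m} \<times> {..<n})"
    unfolding L2_set_def using assms by (intro real_sqrt_le_mono sum_mono2) auto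
  then show ?thesis unfolding frob_L2_set[OF assms(1)] by (simp add: L2_set_def)
qed

subsection \<open>Functions of a Hermitian matrix\<close>

text \<open>The matrix \<open>U diag(d) U'\<close> with \<open>U' = ctrans U\<close>, given
  entrywise so that power series, derivatives and limits in \<open>d\<close> become finite sums of
  scalar ones; \<open>udiag_eq\<close> recovers the product form.\<close>

definition udiag :: "nat \<Rightarrow> complex mat \<Rightarrow> (nat \<Rightarrow> complex) \<Rightarrow> complex mat" where
  "udiag n U d = mat n n (\<lambda>(i, j). \<Sum>a<n. U $$ (i, a) * d a * cnj (U $$ (j, a)))"

abbreviation hdiag :: "nat \<Rightarrow> complex mat \<Rightarrow> (nat \<Rightarrow> real) \<Rightarrow> complex mat" where
  "hdiag n U l \<equiv> udiag n U (\<lambda>a. complex_of_real (l a))"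

text \<open>The exponential of \<open>z\<close> times \<open>hdiag n U l\<close>. The parameter
  \<open>z\<close> is complex in order to cover geodesics (real \<open>z\<close>) and unitary group
  elements (imaginary \<open>z\<close>) alike.\<close>

abbreviation ediag :: "nat \<Rightarrow> complex mat \<Rightarrow> complex \<Rightarrow> (nat \<Rightarrow> real) \<Rightarrow> complex mat" where
  "ediag n U z l \<equiv> udiag n U (\<lambda>a. exp (z * complex_of_real (l a)))"

lemma udiag_carrier [simp]: "udiag n U d \<in> carrier_mat n n"
  by (simp add: udiag_def)

lemma udiag_dim [simp]: "dim_row (udiag n U d) = n" "dim_col (udiag n U d) = n"
  by (simp_all add: udiag_def)

lemma udiag_index [simp]:
  "i < n \<Longrightarrow> j < n \<Longrightarrow> udiag n U d $$ (i, j) = (\<Sum>a<n. U $$ (i, a) * d a * cnj (U $$ (j, a)))"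
  by (simp add: udiag_def)

lemma udiag_cong: "(\<And>a. a < n \<Longrightarrow> d a = e a) \<Longrightarrow> udiag n U d = udiag n U e"
  unfolding udiag_def by (intro cong_mat refl) (auto intro!: sum.cong)

lemma mat_diag_carrier [simp]: "mat_diag n d \<in> carrier_mat n n"
  by (simp add: mat_diag_def)

lemma mat_diag_dims [simp]: "dim_row (mat_diag n d) = n" "dim_col (mat_diag n d) = n"
  by (simp_all add: mat_diag_def)

lemma udiag_eq:
  assumes "U \<in> carrier_mat n n"
  shows "udiag n U d = U * mat_diag n d * ctrans U"
proof (rule eq_matI)
  fix i j assume "i < dim_row (U * mat_diag n d * ctrans U)" "j < dim_col (U * mat_diag n d * ctrans U)"
  then have ij: "i < n" "j < n" using assms by auto
  have "(U * mat_diag n d * ctrans U) $$ (i, j) = (\<Sum>a<n. (U * mat_diag n d) $$ (i, a) * ctrans U $$ (a, j))"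
    using assms ij by (intro index_mult_mat_sum) auto
  also have "\<dots> = (\<Sum>a<n. U $$ (i, a) * d a * cnj (U $$ (j, a)))"
    using assms ij by (auto simp: mat_diag_mult_right[OF assms] intro!: sum.cong)
  finally show "udiag n U d $$ (i, j) = (U * mat_diag n d * ctrans U) $$ (i, j)"
    using ij by simp
qed (use assms in auto)

lemma udiag_ctrans: "ctrans (udiag n U d) = udiag n U (\<lambda>a. cnj (d a))"
  by (rule eq_matI) (auto simp: mult_ac intro!: sum.cong)

lemma udiag_mult:
  assumes "unitary n U"
  shows "udiag n U d * udiag n U e = udiag n U (\<lambda>a. d a * e a)"
proof -
  note U = unitaryD[OF assms]
  have "udiag n U d * udiag n U e = (U * mat_diag n d * ctrans U) * (U * mat_diag n e * ctrans U)"
    using U by (simp add: udiag_eq)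
  also have "\<dots> = U * mat_diag n d * (ctrans U * U) * mat_diag n e * ctrans U"
    using U(1,2) by (simp add: mult_square[where n = n])
  also have "\<dots> = U * mat_diag n d * mat_diag n e * ctrans U"
    unfolding U(3) using U(1) by (simp only: right_mult_one_mat[of _ n n] mult_square[where n = n] mat_diag_carrier)
  also have "\<dots> = U * (mat_diag n d * mat_diag n e) * ctrans U"
    using U(1) by (simp only: mult_square[where n = n] mat_diag_carrier)
  also have "\<dots> = udiag n U (\<lambda>a. d a * e a)"
    using U by (simp add: udiag_eq)
  finally show ?thesis .
qed

lemma udiag_one:
  assumes "unitary n U"
  shows "udiag n U (\<lambda>_. 1) = 1\<^sub>m n"
  using unitary_ortho'[OF assms] by (intro eq_matI) auto

lemma udiag_smult: "c \<cdot>\<^sub>m udiag n U d = udiag n U (\<lambda>a. c * d a)"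
  by (rule eq_matI) (auto simp: sum_distrib_left mult_ac intro!: sum.cong)

lemma udiag_add: "udiag n U d + udiag n U e = udiag n U (\<lambda>a. d a + e a)"
  by (rule eq_matI) (auto simp: sum.distrib algebra_simps)

lemma udiag_minus: "udiag n U d - udiag n U e = udiag n U (\<lambda>a. d a - e a)"
  by (rule eq_matI) (auto simp: sum_subtractf algebra_simps)

lemma udiag_one_mat: "udiag n (1\<^sub>m n) d = mat_diag n d"
  by (simp add: udiag_eq left_mult_one_mat[of _ n n] right_mult_one_mat[of _ n n])

lemma udiag_conj:
  assumes "U \<in> carrier_mat n n" "W \<in> carrier_mat n n"
  shows "W * udiag n U d * ctrans W = udiag n (W * U) d"
  using assms
  by (simp add: udiag_eq ctrans_mult mult_square[where n = n])

lemma udiag_pow: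
  assumes "unitary n U"
  shows "udiag n U d ^\<^sub>m k = udiag n U (\<lambda>a. d a ^ k)"
  by (induction k) (simp_all add: udiag_one[OF assms] udiag_mult[OF assms] mult.commute)

lemma mexp_udiag:
  assumes "unitary n U"
  shows "mexp (udiag n U d) = udiag n U (\<lambda>a. exp (d a))"
proof (rule eq_matI)
  fix i j assume "i < dim_row (udiag n U (\<lambda>a. exp (d a)))" "j < dim_col (udiag n U (\<lambda>a. exp (d a)))"
  then have ij: "i < n" "j < n" by auto
  have "mexp (udiag n U d) $$ (i, j) = (\<Sum>k. (\<Sum>a<n. U $$ (i, a) * d a ^ k * cnj (U $$ (j, a))) / of_nat (fact k))"
    using ij by (simp add: mexp_def udiag_pow[OF assms])
  also have "\<dots> = (\<Sum>k. \<Sum>a<n. U $$ (i, a) * (d a ^ k /\<^sub>R fact k) * cnj (U $$ (j, a)))"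
    by (simp add: sum_divide_distrib scaleR_conv_of_real field_simps)
  also have "\<dots> = (\<Sum>a<n. \<Sum>k. U $$ (i, a) * (d a ^ k /\<^sub>R fact k) * cnj (U $$ (j, a)))"
    by (intro suminf_sum summable_mult2 summable_mult summable_exp_generic)
  also have "\<dots> = (\<Sum>a<n. U $$ (i, a) * exp (d a) * cnj (U $$ (j, a)))"
  proof (intro sum.cong refl)
    fix a
    have "(\<lambda>k. U $$ (i, a) * (d a ^ k /\<^sub>R fact k) * cnj (U $$ (j, a))) sums
          (U $$ (i, a) * exp (d a) * cnj (U $$ (j, a)))"
      by (intro sums_mult2 sums_mult exp_converges)
    then show "(\<Sum>k. U $$ (i, a) * (d a ^ k /\<^sub>R fact k) * cnj (U $$ (j, a))) =
        U $$ (i, a) * exp (d a) * cnj (U $$ (j, a))"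
      by (rule sums_unique[symmetric])
  qed
  finally show "mexp (udiag n U d) $$ (i, j) = udiag n U (\<lambda>a. exp (d a)) $$ (i, j)"
    using ij by simp
qed (auto simp: mexp_def)

lemma mexp_smult_udiag:
  assumes "unitary n U"
  shows "mexp (c \<cdot>\<^sub>m udiag n U d) = udiag n U (\<lambda>a. exp (c * d a))"
  by (simp add: udiag_smult mexp_udiag[OF assms])

lemma fsq_udiag_left:
  assumes "unitary m U" "B \<in> carrier_mat m n"
  shows "fsq (udiag m U d * B) = (\<Sum>i<m. \<Sum>j<n. (cmod (d i))\<^sup>2 * (cmod ((ctrans U * B) $$ (i, j)))\<^sup>2)"
proof -
  note U = unitaryD[OF assms(1)]
  have "fsq (udiag m U d * B) = fsq (U * (mat_diag m d * (ctrans U * B)))"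
    using U assms by (simp add: udiag_eq mult_rect[where m = m and n = n] mult_square[where n = m])
  also have "\<dots> = fsq (mat_diag m d * (ctrans U * B))"
    using U assms(2)
    by (intro fsq_unitary_left[OF assms(1), where n = n])
      (simp add: mult_rect[where m = m and n = n])
  also have "\<dots> = (\<Sum>i<m. \<Sum>j<n. (cmod (d i))\<^sup>2 * (cmod ((ctrans U * B) $$ (i, j)))\<^sup>2)"
    using U(1,2) assms(2) mat_diag_mult_left[OF mult_carrier_mat[OF U(2) assms(2)], of d]
    by (auto simp: fsq_def norm_mult power_mult_distrib simp del: index_mult_mat(1) intro!: sum.cong)
  finally show ?thesis .
qed

text \<open>The outer unitary factors drop out, and in the eigenbases the diagonal factors scale
  each entry separately. The weights on the right depend on \<open>B\<close> and the bases only, so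
  moving along a geodesic changes nothing but the coefficients.\<close>

lemma fsq_udiag_both:
  assumes "unitary m U" "unitary n V" "B \<in> carrier_mat m n"
  shows "fsq (udiag m U d * B * udiag n V e) =
    (\<Sum>i<m. \<Sum>j<n. (cmod (d i) * cmod (e j))\<^sup>2 * (cmod ((ctrans U * B * V) $$ (i, j)))\<^sup>2)"
proof -
  note U = unitaryD[OF assms(1)] and V = unitaryD[OF assms(2)]
  have "fsq (udiag m U d * B * udiag n V e) = fsq (U * (mat_diag m d * (ctrans U * B * V) * mat_diag n e) * ctrans V)"
    using U V assms(3)
    by (simp add: udiag_eq mult_rect[where m = m and n = n] mult_square[where n = m] mult_square[where n = n])
  also have "\<dots> = fsq (mat_diag m d * (ctrans U * B * V) * mat_diag n e)"
  proof -
    have C: "mat_diag m d * (ctrans U * B * V) * mat_diag n e \<in> carrier_mat m n"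
      using U V assms(3) by (simp add: mult_rect[where m = m and n = n])
    then have D: "U * (mat_diag m d * (ctrans U * B * V) * mat_diag n e) \<in> carrier_mat m n"
      using U by (simp add: mult_rect[where m = m and n = n])
    show ?thesis
      unfolding fsq_unitary_right[OF unitary_ctrans[OF assms(2)] D] fsq_unitary_left[OF assms(1) C] ..
  qed
  also have "\<dots> = (\<Sum>i<m. \<Sum>j<n. (cmod (d i) * cmod (e j))\<^sup>2 * (cmod ((ctrans U * B * V) $$ (i, j)))\<^sup>2)"
  proof -
    define C where "C = ctrans U * B * V"
    have C: "C \<in> carrier_mat m n" unfolding C_def by (meson U V assms(3) mult_carrier_mat)
    have "mat_diag m d * C * mat_diag n e = mat m n (\<lambda>(i, j). d i * C $$ (i, j) * e j)"
      using C by (subst mat_diag_mult_right[of _ m n]) (auto simp: mat_diag_mult_left[OF C])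
    then show ?thesis unfolding C_def[symmetric]
      by (auto simp: fsq_def norm_mult power_mult_distrib mult_ac intro!: sum.cong)
  qed
  finally show ?thesis .
qed

section \<open>The spectral theorem for Hermitian matrices\<close>

lemma gram_schmidt_unitary:
  fixes v :: "complex vec"
  assumes v: "v \<in> carrier_vec n" and v0: "v \<noteq> 0\<^sub>v n"
  obtains W c where "unitary n W" "\<And>i. i < n \<Longrightarrow> W $$ (i, 0) = c * v $ i"
proof -
  interpret cof_vec_space n "TYPE(complex)" .
  define ws where "ws = gram_schmidt n (basis_completion v)"
  from basis_completion[OF v v0]
  have b: "distinct (basis_completion v)" "\<not> lin_dep (set (basis_completion v))"
    "set (basis_completion v) \<subseteq> carrier_vec n" "hd (basis_completion v) = v"
    "length (basis_completion v) = n" by auto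
  have n: "n \<noteq> 0" using v v0 by auto
  from b(4,5) n obtain vs where bv: "basis_completion v = v # vs"
    by (cases "basis_completion v") auto
  from gram_schmidt_result[OF b(3,1,2) ws_def]
  have ws: "set ws \<subseteq> carrier_vec n" "corthogonal ws" "length ws = n"
    using b(5) by auto
  have hdws: "hd ws = v"
    using gram_schmidt_hd[OF v, of vs] unfolding ws_def bv .
  have ws_c: "ws ! j \<in> carrier_vec n" if "j < n" for j
    using ws that by auto
  define q where "q j = (\<Sum>a<n. (cmod (ws ! j $ a))\<^sup>2)" for j
  have ip: "ws ! j \<bullet>c ws ! i = (\<Sum>a<n. ws ! j $ a * cnj (ws ! i $ a))" if "i < n" "j < n" for i j
    using ws_c[OF that(1)] ws_c[OF that(2)] by (simp add: scalar_prod_def atLeast0LessThan)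
  have q_eq: "complex_of_real (q j) = (\<Sum>a<n. ws ! j $ a * cnj (ws ! j $ a))" for j
    unfolding q_def of_real_sum complex_norm_square ..
  have q_pos: "q j > 0" if "j < n" for j
  proof -
    have "ws ! j \<bullet>c ws ! j \<noteq> 0" using corthogonalD[OF ws(2)] ws(3) that by auto
    then have "complex_of_real (q j) \<noteq> 0" using ip[OF that that] q_eq by simp
    moreover have "q j \<ge> 0" unfolding q_def by (intro sum_nonneg) simp
    ultimately show ?thesis by simp
  qed
  \<comment> \<open>The Gram-Schmidt vectors are orthogonal but not normalised; \<open>q j\<close>
    is the squared length of the one with index \<open>j\<close>. Normalising leaves the first
    column a multiple of \<open>v\<close>, whence the factor \<open>c\<close>.\<close>
  define W where "W = mat n n (\<lambda>(i, j). ws ! j $ i / complex_of_real (sqrt (q j)))"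
  have W: "W \<in> carrier_mat n n" by (simp add: W_def)
  have "unitary n W"
  proof (rule unitaryI[OF W], rule eq_matI)
    fix i j assume "i < dim_row (1\<^sub>m n)" "j < dim_col (1\<^sub>m n)"
    then have ij: "i < n" "j < n" by auto
    have "(ctrans W * W) $$ (i, j) = (\<Sum>a<n. ctrans W $$ (i, a) * W $$ (a, j))"
      by (rule index_mult_mat_sum[OF ctrans_carrier[OF W] W ij])
    also have "\<dots> = (\<Sum>a<n. ws ! j $ a * cnj (ws ! i $ a) / (sqrt (q i) * sqrt (q j)))"
      using ij W by (intro sum.cong) (auto simp: W_def)
    also have "\<dots> = (ws ! j \<bullet>c ws ! i) / (sqrt (q i) * sqrt (q j))"
      unfolding ip[OF ij] by (simp add: sum_divide_distrib)
    also have "\<dots> = 1\<^sub>m n $$ (i, j)"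
    proof (cases "i = j")
      case True
      have "ws ! j \<bullet>c ws ! j = complex_of_real (q j)" unfolding ip[OF ij(2,2)] q_eq ..
      moreover have "complex_of_real (sqrt (q j)) * complex_of_real (sqrt (q j)) = q j"
        using q_pos[OF ij(2)] by (simp flip: of_real_mult)
      ultimately show ?thesis using True ij q_pos[OF ij(2)] by simp
    next
      case False
      then have "ws ! j \<bullet>c ws ! i = 0" using corthogonalD[OF ws(2)] ws(3) ij by auto
      then show ?thesis using False ij by simp
    qed
    finally show "(ctrans W * W) $$ (i, j) = 1\<^sub>m n $$ (i, j)" .
  qed (use W in auto)
  moreover have "W $$ (i, 0) = 1 / sqrt (q 0) * v $ i" if "i < n" for i
  proof -
    have "ws ! 0 = v" using hdws n ws(3) by (cases ws) auto
    then show ?thesis using that n by (simp add: W_def)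
  qed
  ultimately show ?thesis using that by blast
qed

lemma complex_mat_eigenvector:
  fixes A :: "complex mat"
  assumes "A \<in> carrier_mat n n" "n > 0"
  obtains e v where "v \<in> carrier_vec n" "v \<noteq> 0\<^sub>v n" "A *\<^sub>v v = e \<cdot>\<^sub>v v"
  using spectrum_non_empty[OF assms] assms
  by (auto simp: spectrum_def eigenvalue_def eigenvector_def)

text \<open>Deflation: in an orthonormal basis that starts with an eigenvector, the first column of
  the matrix is \<open>(e, 0, ..., 0)\<close>, and Hermitian symmetry clears the first row as well.
  The remaining block is Hermitian of size \<open>k\<close>.\<close>

lemma hermitian_unitary_diagonalisation:
  assumes "A \<in> carrier_mat n n" "ctrans A = A"
  shows "\<exists>U d. unitary n U \<and> A = udiag n U d"
  using assms
proof (induction n arbitrary: A)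
  case 0
  have "A = udiag 0 (1\<^sub>m 0) (\<lambda>_. 0)" using 0 by (intro eq_matI) auto
  then show ?case using unitary_one by blast
next
  case (Suc k)
  let ?n = "Suc k"
  note A = Suc.prems(1)
  obtain e v where v: "v \<in> carrier_vec ?n" "v \<noteq> 0\<^sub>v ?n" "A *\<^sub>v v = e \<cdot>\<^sub>v v"
    using complex_mat_eigenvector[OF A] by blast
  obtain W c where W: "unitary ?n W" and Wc: "\<And>i. i < ?n \<Longrightarrow> W $$ (i, 0) = c * v $ i"
    using gram_schmidt_unitary[OF v(1,2)] by blast
  note WD = unitaryD[OF W]
  define B where "B = ctrans W * A * W"
  have B: "B \<in> carrier_mat ?n ?n" unfolding B_def by (meson WD A mult_carrier_mat)
  have AW: "A * W \<in> carrier_mat ?n ?n" by (meson WD A mult_carrier_mat)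
  have B': "B = ctrans W * (A * W)"
    unfolding B_def using WD A by (simp add: assoc_mult_mat[of _ ?n ?n _ ?n _ ?n])
  have BH: "ctrans B = B"
  proof -
    have "ctrans B = ctrans (A * W) * W"
      unfolding B' using ctrans_mult[OF WD(2) AW] by simp
    also have "\<dots> = B" using ctrans_mult[OF A WD(1)] Suc.prems(2) by (simp add: B_def)
    finally show ?thesis .
  qed
  have col0: "B $$ (i, 0) = (if i = 0 then e else 0)" if i: "i < ?n" for i
  proof -
    have "(A * W) $$ (a, 0) = e * W $$ (a, 0)" if a: "a < ?n" for a
    proof -
      have "(A * W) $$ (a, 0) = (\<Sum>b<?n. A $$ (a, b) * W $$ (b, 0))"
        by (rule index_mult_mat_sum[OF A WD(1) a]) simp
      also have "\<dots> = c * (\<Sum>b<?n. A $$ (a, b) * v $ b)"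
        unfolding sum_distrib_left by (intro sum.cong refl) (use Wc in simp)
      also have "(\<Sum>b<?n. A $$ (a, b) * v $ b) = (A *\<^sub>v v) $ a"
        using A v(1) a by (auto simp: scalar_prod_def atLeast0LessThan intro!: sum.cong)
      also have "\<dots> = e * v $ a" unfolding v(3) using v(1) a by simp
      finally show ?thesis using Wc[OF a] by simp
    qed
    note AW0 = this
    have "B $$ (i, 0) = (\<Sum>a<?n. ctrans W $$ (i, a) * (A * W) $$ (a, 0))"
      unfolding B' by (rule index_mult_mat_sum[OF WD(2) AW i]) simp
    also have "\<dots> = e * (\<Sum>a<?n. cnj (W $$ (a, i)) * W $$ (a, 0))"
      unfolding sum_distrib_left by (intro sum.cong refl) (use AW0 WD(1) i in simp)
    also have "\<dots> = (if i = 0 then e else 0)"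
      unfolding unitary_ortho[OF W i zero_less_Suc] by simp
    finally show ?thesis .
  qed
  have row0: "B $$ (0, j) = 0" if "0 < j" "j < ?n" for j
  proof -
    have "B $$ (0, j) = cnj (B $$ (j, 0))" using that B by (subst BH[symmetric]) simp
    then show ?thesis using col0[OF that(2)] that by simp
  qed
  define C where "C = mat k k (\<lambda>(i, j). B $$ (Suc i, Suc j))"
  have C: "C \<in> carrier_mat k k" by (simp add: C_def)
  have "ctrans C = C"
  proof (rule eq_matI)
    fix i j assume "i < dim_row C" "j < dim_col C"
    then have ij: "i < k" "j < k" by (auto simp: C_def)
    have "B $$ (Suc i, Suc j) = cnj (B $$ (Suc j, Suc i))" using ij B by (subst BH[symmetric]) simp
    then show "ctrans C $$ (i, j) = C $$ (i, j)" using ij by (simp add: C_def)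
  qed (simp_all add: C_def)
  from Suc.IH[OF C this] obtain V d where V: "unitary k V" and Cd: "C = udiag k V d" by blast
  note VD = unitaryD[OF V]
  \<comment> \<open>The block matrix diag(1, V), which leaves the eigenvector found above in
    place.\<close>
  define V' where "V' = mat ?n ?n (\<lambda>(i, j). case (i, j) of (0, 0) \<Rightarrow> 1 | (Suc i, Suc j) \<Rightarrow> V $$ (i, j) | _ \<Rightarrow> 0)"
  have V': "V' \<in> carrier_mat ?n ?n" by (simp add: V'_def)
  have VU: "unitary ?n V'"
  proof (rule unitaryI[OF V'], rule eq_matI)
    fix i j assume "i < dim_row (1\<^sub>m ?n)" "j < dim_col (1\<^sub>m ?n)"
    then have ij: "i < ?n" "j < ?n" by auto
    have "(ctrans V' * V') $$ (i, j) = (\<Sum>a<?n. ctrans V' $$ (i, a) * V' $$ (a, j))"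
      by (rule index_mult_mat_sum[OF ctrans_carrier[OF V'] V' ij])
    also have "\<dots> = (\<Sum>a<?n. cnj (V' $$ (a, i)) * V' $$ (a, j))"
      using V' ij by (intro sum.cong refl) simp
    also have "\<dots> = 1\<^sub>m ?n $$ (i, j)"
      unfolding sum.lessThan_Suc_shift using ij unitary_ortho[OF V]
      by (cases i; cases j) (simp_all add: V'_def)
    finally show "(ctrans V' * V') $$ (i, j) = 1\<^sub>m ?n $$ (i, j)" .
  qed (use V' in auto)
  have "B = udiag ?n V' (case_nat e d)"
  proof (rule eq_matI)
    fix i j assume "i < dim_row (udiag ?n V' (case_nat e d))" "j < dim_col (udiag ?n V' (case_nat e d))"
    then have ij: "i < ?n" "j < ?n" by auto
    have *: "udiag ?n V' (case_nat e d) $$ (i, j) =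
       V' $$ (i, 0) * e * cnj (V' $$ (j, 0)) + (\<Sum>a<k. V' $$ (i, Suc a) * d a * cnj (V' $$ (j, Suc a)))"
      using ij by (simp add: sum.lessThan_Suc_shift del: sum.lessThan_Suc)
    show "B $$ (i, j) = udiag ?n V' (case_nat e d) $$ (i, j)"
    proof (cases i)
      case 0
      then show ?thesis using ij col0[of 0] row0[of j] unfolding *
        by (cases j) (simp_all add: V'_def)
    next
      case (Suc i')
      show ?thesis
      proof (cases j)
        case 0
        then show ?thesis using ij col0[of i] Suc unfolding * by (simp add: V'_def)
      next
        case (Suc j')
        have "B $$ (i, j) = C $$ (i', j')" using ij Suc \<open>i = Suc i'\<close> by (simp add: C_def)
        also have "\<dots> = (\<Sum>a<k. V $$ (i', a) * d a * cnj (V $$ (j', a)))"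
          unfolding Cd using ij Suc \<open>i = Suc i'\<close> by simp
        finally show ?thesis using ij Suc \<open>i = Suc i'\<close> unfolding * by (simp add: V'_def)
      qed
    qed
  qed (use B in auto)
  moreover have "A = W * B * ctrans W"
  proof -
    have "W * B * ctrans W = W * (ctrans W * (A * W)) * ctrans W" by (simp add: B')
    also have "\<dots> = (W * ctrans W) * A * (W * ctrans W)"
      using WD(1,2) A
      by (simp add: assoc_mult_mat[of _ ?n ?n _ ?n _ ?n] mult_carrier_mat[of _ ?n ?n _ ?n])
    also have "\<dots> = A" unfolding WD(4)
      using A by (simp add: left_mult_one_mat[of _ ?n ?n] right_mult_one_mat[of _ ?n ?n])
    finally show ?thesis ..
  qed
  ultimately have "A = udiag ?n (W * V') (case_nat e d)"
    using udiag_conj[OF V' WD(1)] by simp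
  then show ?case using unitary_mult[OF W VU] by blast
qed

lemma udiag_conj_diag:
  assumes "unitary n U"
  shows "ctrans U * udiag n U d * U = mat_diag n d"
proof -
  note U = unitaryD[OF assms]
  have "ctrans U * udiag n U d * U = (ctrans U * U) * mat_diag n d * (ctrans U * U)"
    using U(1,2) by (simp add: udiag_eq mult_square[where n = n])
  also have "\<dots> = mat_diag n d" unfolding U(3)
    by (simp add: left_mult_one_mat[of _ n n] right_mult_one_mat[of _ n n])
  finally show ?thesis .
qed

lemma udiag_inj:
  assumes "unitary n U" "udiag n U d = udiag n U e" "a < n"
  shows "d a = e a"
proof -
  have "mat_diag n d $$ (a, a) = mat_diag n e $$ (a, a)"
    using udiag_conj_diag[OF assms(1)] assms(2) by metis
  then show ?thesis using assms(3) by (simp add: mat_diag_def)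
qed

text \<open>Conjugate transposition conjugates the eigenvalues and keeps the eigenbasis; since
  eigenvalues are determined by the matrix once the basis is fixed, they are real.\<close>

theorem hermitian_spectral:
  assumes "A \<in> carrier_mat n n" "ctrans A = A"
  obtains U l where "unitary n U" "A = hdiag n U l"
proof -
  obtain U d where U: "unitary n U" "A = udiag n U d"
    using hermitian_unitary_diagonalisation[OF assms] by blast
  have "d a = complex_of_real (Re (d a))" if "a < n" for a
  proof -
    have "udiag n U (\<lambda>a. cnj (d a)) = udiag n U d" using assms(2) U(2) by (simp add: udiag_ctrans)
    from udiag_inj[OF U(1) this that] show ?thesis by (metis complex_cnj_cancel_iff complex_eq_iff complex_cnj complex.sel Im_complex_of_real Re_complex_of_real cnj.simps(2) equal_neg_zero)
  qed
  then have "A = hdiag n U (\<lambda>a. Re (d a))"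
    unfolding U(2) by (rule udiag_cong)
  then show ?thesis by (rule that[OF U(1)])
qed

subsection \<open>Inverses and the pseudoinverse\<close>

lemma minv_eqI:
  assumes "X \<in> carrier_mat n n" "Y \<in> carrier_mat n n" "X * Y = 1\<^sub>m n" "Y * X = 1\<^sub>m n"
  shows "minv X = Y"
  unfolding minv_def
proof (rule the_equality)
  show "Y \<in> carrier_mat (dim_row X) (dim_row X) \<and> X * Y = 1\<^sub>m (dim_row X) \<and> Y * X = 1\<^sub>m (dim_row X)"
    using assms by auto
  fix Z assume "Z \<in> carrier_mat (dim_row X) (dim_row X) \<and> X * Z = 1\<^sub>m (dim_row X) \<and> Z * X = 1\<^sub>m (dim_row X)"
  then have Z: "Z \<in> carrier_mat n n" "X * Z = 1\<^sub>m n" "Z * X = 1\<^sub>m n" using assms(1) by auto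
  have "Z = Z * (X * Y)" using Z(1) assms(3) by simp
  also have "\<dots> = (Z * X) * Y" using Z(1) assms(1,2) by (simp add: mult_square[where n = n])
  also have "\<dots> = Y" unfolding Z(3) using assms(2) by simp
  finally show "Z = Y" .
qed

lemma GL_minv:
  assumes "X \<in> GL n"
  shows "X \<in> carrier_mat n n" "minv X \<in> carrier_mat n n" "X * minv X = 1\<^sub>m n" "minv X * X = 1\<^sub>m n"
proof -
  show X: "X \<in> carrier_mat n n" using assms by (simp add: GL_def)
  obtain B where B: "X * B = 1\<^sub>m n" "B * X = 1\<^sub>m (dim_row B)"
    using assms X by (auto simp: GL_def invertible_mat_def inverts_mat_def)
  have "dim_row B = n" using arg_cong[OF B(2), of dim_col] X by simp
  moreover have "dim_col B = n" using arg_cong[OF B(1), of dim_col] by simp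
  ultimately have Bc: "B \<in> carrier_mat n n" "B * X = 1\<^sub>m n" using B(2) by auto
  from minv_eqI[OF X Bc(1) B(1) Bc(2)] have "minv X = B" .
  then show "minv X \<in> carrier_mat n n" "X * minv X = 1\<^sub>m n" "minv X * X = 1\<^sub>m n"
    using B(1) Bc by simp_all
qed

lemma GL_I:
  assumes "X \<in> carrier_mat n n" "Y \<in> carrier_mat n n" "X * Y = 1\<^sub>m n" "Y * X = 1\<^sub>m n"
  shows "X \<in> GL n"
  using assms by (auto simp: GL_def invertible_mat_def inverts_mat_def)

lemma GL_one: "1\<^sub>m n \<in> GL n"
  by (rule GL_I[where Y = "1\<^sub>m n"]) auto

lemma minv_one [simp]: "minv (1\<^sub>m n) = 1\<^sub>m n"
  by (rule minv_eqI) auto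

lemma inverse_pair_mult:
  fixes X :: "complex mat"
  assumes "X \<in> carrier_mat n n" "X' \<in> carrier_mat n n" "Y \<in> carrier_mat n n" "Y' \<in> carrier_mat n n"
    "X * X' = 1\<^sub>m n" "Y * Y' = 1\<^sub>m n"
  shows "X * Y * (Y' * X') = 1\<^sub>m n"
proof -
  have "X * Y * (Y' * X') = X * ((Y * Y') * X')"
    using assms(1-4) by (simp add: mult_square[where n = n])
  also have "\<dots> = 1\<^sub>m n" unfolding assms(6) using assms by simp
  finally show ?thesis .
qed

lemma GL_mult:
  assumes "X \<in> GL n" "Y \<in> GL n"
  shows "X * Y \<in> GL n" "minv (X * Y) = minv Y * minv X"
proof -
  note X = GL_minv[OF assms(1)] and Y = GL_minv[OF assms(2)]
  have c: "X * Y \<in> carrier_mat n n" "minv Y * minv X \<in> carrier_mat n n" using X Y by auto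
  have 1: "X * Y * (minv Y * minv X) = 1\<^sub>m n" using X Y by (intro inverse_pair_mult)
  have 2: "minv Y * minv X * (X * Y) = 1\<^sub>m n" using X Y by (intro inverse_pair_mult)
  show "X * Y \<in> GL n" by (rule GL_I[OF c 1 2])
  show "minv (X * Y) = minv Y * minv X" by (rule minv_eqI[OF c 1 2])
qed

lemma udiag_inverse:
  assumes "unitary n U" "\<And>a. a < n \<Longrightarrow> d a \<noteq> 0"
  shows "udiag n U d \<in> GL n" "minv (udiag n U d) = udiag n U (\<lambda>a. inverse (d a))"
proof -
  have "udiag n U (\<lambda>a. d a * inverse (d a)) = udiag n U (\<lambda>_. 1)"
    by (rule udiag_cong) (use assms(2) in simp)
  then have 1: "udiag n U d * udiag n U (\<lambda>a. inverse (d a)) = 1\<^sub>m n"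
    using assms(1) by (simp add: udiag_mult udiag_one)
  then have 2: "udiag n U (\<lambda>a. inverse (d a)) * udiag n U d = 1\<^sub>m n"
    using assms(1) by (simp add: udiag_mult mult.commute)
  show "udiag n U d \<in> GL n" by (rule GL_I[OF _ _ 1 2]) simp_all
  show "minv (udiag n U d) = udiag n U (\<lambda>a. inverse (d a))" by (rule minv_eqI[OF _ _ 1 2]) simp_all
qed

text \<open>\<open>A * B\<close> and \<open>A * C\<close> are Hermitian projections with the range
  of \<open>A\<close>, hence equal; likewise \<open>B * A = C * A\<close>. Then
  \<open>B = B A B = C A B = C A C = C\<close>.\<close>

lemma pinv_unique:
  assumes A: "A \<in> carrier_mat m n" and B: "B \<in> carrier_mat n m" and C: "C \<in> carrier_mat n m"
    and AB: "A * B * A = A" "B * A * B = B" "ctrans (A * B) = A * B" "ctrans (B * A) = B * A"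
    and AC: "A * C * A = A" "C * A * C = C" "ctrans (A * C) = A * C" "ctrans (C * A) = C * A"
  shows "B = C"
proof -
  have c: "A * B \<in> carrier_mat m m" "A * C \<in> carrier_mat m m" "B * A \<in> carrier_mat n n" "C * A \<in> carrier_mat n n"
    using A B C by auto
  have 1: "A * B = A * C"
  proof -
    have "A * B = (A * C * A) * B" unfolding AC(1) ..
    also have "\<dots> = (A * C) * (A * B)" using A B c by (simp add: mult_rect[where m = m and n = n])
    finally have *: "A * B = (A * C) * (A * B)" .
    have "A * B = ctrans (A * B)" using AB(3) by simp
    also have "\<dots> = ctrans (A * B) * ctrans (A * C)"
      using arg_cong[OF *, of ctrans] ctrans_mult[OF c(2,1)] by simp
    also have "\<dots> = (A * B) * (A * C)" using AB AC by simp
    also have "\<dots> = (A * B * A) * C" using A C c by (simp add: mult_rect[where m = m and n = n])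
    finally show ?thesis unfolding AB(1) .
  qed
  have 2: "B * A = C * A"
  proof -
    have "B * A = B * (A * C * A)" unfolding AC(1) ..
    also have "\<dots> = (B * A) * (C * A)"
      using A B C c by (simp add: mult_rect[where m = m and n = n])
    finally have *: "B * A = (B * A) * (C * A)" .
    have "B * A = ctrans (B * A)" using AB(4) by simp
    also have "\<dots> = ctrans (C * A) * ctrans (B * A)"
      using arg_cong[OF *, of ctrans] ctrans_mult[OF c(3,4)] by simp
    also have "\<dots> = (C * A) * (B * A)" using AB AC by simp
    also have "\<dots> = C * (A * B * A)"
      using A B C c by (simp add: mult_rect[where m = m and n = n])
    finally show ?thesis unfolding AB(1) .
  qed
  have "B = B * A * B" using AB(2) by simp
  also have "\<dots> = C * A * B" unfolding 2 ..
  also have "\<dots> = C * (A * B)" using A B C by (simp add: mult_rect[where m = m and n = n])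
  also have "\<dots> = C * (A * C)" unfolding 1 ..
  also have "\<dots> = C * A * C" using A C by (simp add: mult_rect[where m = m and n = n])
  also have "\<dots> = C" by (rule AC(2))
  finally show ?thesis .
qed

text \<open>The squared norm of \<open>A * Z\<close> is the trace of
  \<open>ctrans Z * (ctrans A * A * Z)\<close>.\<close>

lemma mult_eq_0_of_gram:
  fixes A Z :: "complex mat"
  assumes "A \<in> carrier_mat m n" "Z \<in> carrier_mat n k" "ctrans A * A * Z = 0\<^sub>m n k"
  shows "A * Z = 0\<^sub>m m k"
proof (rule fsq_eq_0)
  show AZ: "A * Z \<in> carrier_mat m k" using assms by simp
  have "ctrans (A * Z) * (A * Z) = ctrans Z * (ctrans A * A * Z)"
    using assms(1,2) by (simp add: ctrans_mult assoc_mult_mat[of _ k n _ m _ k] assoc_mult_mat[of _ n m _ n _ k])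
  also have "\<dots> = 0\<^sub>m k k" unfolding assms(3) using assms(2) by simp
  finally have "complex_of_real (fsq (A * Z)) = mtrace (0\<^sub>m k k)" by (simp add: fsq_trace)
  then show "fsq (A * Z) = 0" by (simp add: mtrace_def)
qed

text \<open>If \<open>A\<^sup>*A = U diag(d) U\<^sup>*\<close>, then the pseudoinverse is \<open>U diag(d\<^sup>+) U\<^sup>* A\<^sup>*\<close>
  with \<open>d\<^sup>+ = inverse d\<close> (and \<open>inverse 0 = 0\<close>).\<close>

lemma pinv_exists:
  assumes A: "A \<in> carrier_mat m n"
  obtains B where "B \<in> carrier_mat n m" "A * B * A = A" "B * A * B = B"
    "ctrans (A * B) = A * B" "ctrans (B * A) = B * A"
proof -
  have cA: "ctrans A \<in> carrier_mat n m" using A by simp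
  have G: "ctrans A * A \<in> carrier_mat n n" by (rule mult_carrier_mat[OF cA A])
  have "ctrans (ctrans A * A) = ctrans A * A" using ctrans_mult[OF cA A] by simp
  then obtain U d where U: "unitary n U" and Gd: "ctrans A * A = hdiag n U d"
    using hermitian_spectral[OF G] by metis
  define P where "P = udiag n U (\<lambda>a. inverse (complex_of_real (d a)))"
  have P: "P \<in> carrier_mat n n" by (simp add: P_def)
  have PH: "ctrans P = P" by (simp add: P_def udiag_ctrans)
  define Q where "Q = udiag n U (\<lambda>a. if d a = 0 then 0 else 1)"
  have Q: "Q \<in> carrier_mat n n" by (simp add: Q_def)
  have PG: "P * (ctrans A * A) = Q"
    unfolding P_def Gd Q_def udiag_mult[OF U] by (rule udiag_cong) auto
  have GQ: "(ctrans A * A) * Q = ctrans A * A"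
    unfolding Gd Q_def udiag_mult[OF U] by (rule udiag_cong) auto
  have QP: "Q * P = P"
    unfolding P_def Q_def udiag_mult[OF U] by (rule udiag_cong) auto
  have QH: "ctrans Q = Q"
    unfolding Q_def udiag_ctrans by (rule udiag_cong) auto
  \<comment> \<open>\<open>Q\<close> projects onto the span of the eigenvectors with nonzero
    eigenvalue. Its complement is annihilated by \<open>ctrans A * A\<close>, hence by
    \<open>A\<close> itself.\<close>
  have AQ: "A * Q = A"
  proof -
    have "ctrans A * A * (1\<^sub>m n - Q) = 0\<^sub>m n n"
      unfolding mult_minus_distrib_mat[OF G one_carrier_mat Q] GQ right_mult_one_mat[OF G]
      using G by (intro eq_matI) (auto simp del: index_mult_mat(1))
    from mult_eq_0_of_gram[OF A minus_carrier_mat[OF Q] this]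
    have "A * (1\<^sub>m n - Q) = 0\<^sub>m m n" .
    then have "A - A * Q = 0\<^sub>m m n"
      using mult_minus_distrib_mat[OF A one_carrier_mat Q] right_mult_one_mat[OF A] by simp
    have AQc: "A * Q \<in> carrier_mat m n" using A Q by simp
    show ?thesis
    proof (rule eq_matI)
      fix i j assume "i < dim_row A" "j < dim_col A"
      then show "(A * Q) $$ (i, j) = A $$ (i, j)"
        using arg_cong[OF \<open>A - A * Q = 0\<^sub>m m n\<close>, of "\<lambda>M. M $$ (i, j)"] A Q
        by (simp del: index_mult_mat(1))
    qed (use A Q in auto)
  qed
  define B where "B = P * ctrans A"
  have B: "B \<in> carrier_mat n m" using P cA by (simp add: B_def)
  have BA: "B * A = Q"
    unfolding B_def PG[symmetric] using P A cA by (simp add: mult_rect[where m = m and n = n])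
  have AB: "A * B = A * P * ctrans A"
    unfolding B_def using P A cA by (simp add: mult_rect[where m = m and n = n])
  have "A * B * A = A * (B * A)" using A B by (simp add: mult_rect[where m = m and n = n])
  then have 1: "A * B * A = A" using BA AQ by simp
  have "B * A * B = Q * P * ctrans A"
    unfolding BA unfolding B_def using P Q cA by (simp add: mult_rect[where m = m and n = n])
  then have 2: "B * A * B = B" by (simp add: QP B_def)
  have AP: "A * P \<in> carrier_mat m n" using A P by simp
  have "ctrans (A * B) = A * (P * ctrans A)"
    unfolding AB using ctrans_mult[OF AP cA] ctrans_mult[OF A P] PH by simp
  then have 3: "ctrans (A * B) = A * B" by (simp add: B_def)
  show ?thesis by (rule that[OF B 1 2 3]) (simp add: BA QH)
qed

lemma pinv:
  assumes A: "A \<in> carrier_mat m n"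
  shows "pinv A \<in> carrier_mat n m" "A * pinv A * A = A"
proof -
  obtain B where B: "B \<in> carrier_mat n m" "A * B * A = A" "B * A * B = B"
    "ctrans (A * B) = A * B" "ctrans (B * A) = B * A"
    using pinv_exists[OF A] by metis
  have dims: "dim_row A = m" "dim_col A = n" using A by auto
  have "pinv A = B" unfolding pinv_def dims
  proof (rule the_equality)
    fix C assume "C \<in> carrier_mat n m \<and> A * C * A = A \<and> C * A * C = C \<and>
      ctrans (A * C) = A * C \<and> ctrans (C * A) = C * A"
    then show "C = B" using pinv_unique[OF A _ B(1) _ _ _ _ B(2-5)] by blast
  qed (use B in simp)
  then show "pinv A \<in> carrier_mat n m" "A * pinv A * A = A" using B by simp_all
qed

subsection \<open>Exponential polynomials and Zariski closed subgroups\<close>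

text \<open>Real frequencies are essential: they order the terms by growth, so that vanishing at all
  natural numbers forces the function to be zero. The function
  \<open>exp (2 * pi * i * z) - 1\<close> shows that complex frequencies would break this.\<close>

inductive_set exppoly :: "(complex \<Rightarrow> complex) set" where
  exp: "(\<lambda>z. c * exp (z * complex_of_real s)) \<in> exppoly"
| add: "f \<in> exppoly \<Longrightarrow> g \<in> exppoly \<Longrightarrow> (\<lambda>z. f z + g z) \<in> exppoly"

lemma exppoly_const: "(\<lambda>z. c) \<in> exppoly"
  using exppoly.exp[of c 0] by simp

lemma exppoly_mult:
  assumes "f \<in> exppoly" "g \<in> exppoly"
  shows "(\<lambda>z. f z * g z) \<in> exppoly"
  using assms
proof (induction f rule: exppoly.induct)
  case (exp c s)
  from exp.prems show ?case
  proof (induction g rule: exppoly.induct)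
    case (exp d t)
    have "(\<lambda>z. c * d * exp (z * complex_of_real (s + t))) \<in> exppoly" by (rule exppoly.exp)
    then show ?case by (simp add: exp_add algebra_simps)
  next
    case (add f g)
    then show ?case using exppoly.add[OF add.IH] by (simp add: algebra_simps)
  qed
next
  case (add f h)
  then show ?case using exppoly.add[OF add.IH] by (simp add: algebra_simps)
qed

lemma exppoly_sum:
  "finite I \<Longrightarrow> (\<And>i. i \<in> I \<Longrightarrow> f i \<in> exppoly) \<Longrightarrow> (\<lambda>z. \<Sum>i\<in>I. f i z) \<in> exppoly"
  by (induction I rule: finite_induct) (auto intro: exppoly_const exppoly.add)

text \<open>Terms with equal exponents are merged, because comparing growth rates requires distinct
  exponents.\<close>

lemma exppoly_normal_form:
  assumes "f \<in> exppoly"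
  obtains S c where "finite S" "\<And>z. f z = (\<Sum>s\<in>S. c s * exp (z * complex_of_real s))"
  using assms
proof (induction f arbitrary: thesis rule: exppoly.induct)
  case (exp c s)
  show ?case by (rule exp[of "{s}" "\<lambda>_. c"]) auto
next
  case (add f g)
  obtain S c where S: "finite S" "\<And>z. f z = (\<Sum>s\<in>S. c s * exp (z * complex_of_real s))"
    using add.IH(1) by blast
  obtain T d where T: "finite T" "\<And>z. g z = (\<Sum>s\<in>T. d s * exp (z * complex_of_real s))"
    using add.IH(2) by blast
  define e where "e s = (if s \<in> S then c s else 0) + (if s \<in> T then d s else 0)" for s
  have 1: "(\<Sum>s\<in>S. c s * exp (z * complex_of_real s)) =
      (\<Sum>s\<in>S \<union> T. (if s \<in> S then c s else 0) * exp (z * complex_of_real s))" for z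
    using S(1) T(1) by (intro sum.mono_neutral_cong_left) auto
  have 2: "(\<Sum>s\<in>T. d s * exp (z * complex_of_real s)) =
      (\<Sum>s\<in>S \<union> T. (if s \<in> T then d s else 0) * exp (z * complex_of_real s))" for z
    using S(1) T(1) by (intro sum.mono_neutral_cong_left) auto
  show ?case
  proof (rule add.prems[of "S \<union> T" e])
    show "finite (S \<union> T)" using S T by simp
    show "f z + g z = (\<Sum>s\<in>S \<union> T. e s * exp (z * complex_of_real s))" for z
      unfolding S(2) T(2) 1 2 e_def sum.distrib[symmetric] by (simp add: algebra_simps)
  qed
qed

text \<open>The term with the largest exponent dominates.\<close>

lemma exp_sum_eq_0:
  fixes c :: "real \<Rightarrow> complex"
  assumes "finite S" "\<And>k::nat. (\<Sum>s\<in>S. c s * exp (of_nat k * complex_of_real s)) = 0"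
  shows "\<forall>s\<in>S. c s = 0"
  using assms
proof (induction S rule: finite_linorder_max_induct)
  case empty
  then show ?case by simp
next
  case (insert b S)
  have b: "b \<notin> S" using insert.hyps by auto
  have "(\<lambda>k. c b + (\<Sum>s\<in>S. c s * exp (complex_of_real (s - b)) ^ k)) \<longlonglongrightarrow> c b + (\<Sum>s\<in>S. c s * 0)"
  proof (intro tendsto_add tendsto_const tendsto_sum tendsto_mult LIMSEQ_power_zero)
    fix s assume "s \<in> S"
    then have "exp (s - b) < 1" using insert.hyps by simp
    then show "norm (exp (complex_of_real (s - b))) < 1" by (simp add: norm_exp_eq_Re)
  qed
  moreover have "c b + (\<Sum>s\<in>S. c s * exp (complex_of_real (s - b)) ^ k) = 0" for k
  proof -
    have "c b + (\<Sum>s\<in>S. c s * exp (complex_of_real (s - b)) ^ k) =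
       exp (- (of_nat k * complex_of_real b)) * (\<Sum>s\<in>insert b S. c s * exp (of_nat k * complex_of_real s))"
      using insert.hyps b
      by (auto simp: sum_distrib_left distrib_left exp_of_nat_mult[symmetric] exp_minus
          exp_diff right_diff_distrib field_simps intro!: sum.cong)
    then show ?thesis unfolding insert.prems by simp
  qed
  ultimately have "c b = 0" by (simp add: LIMSEQ_const_iff)
  moreover from this have "\<And>k::nat. (\<Sum>s\<in>S. c s * exp (of_nat k * complex_of_real s)) = 0"
    using insert.prems insert.hyps b by simp
  ultimately show ?case using insert.IH by blast
qed

lemma exppoly_eq_0:
  assumes "f \<in> exppoly" "\<And>k::nat. f (of_nat k) = 0"
  shows "f z = 0"
proof -
  obtain S c where S: "finite S" "\<And>z. f z = (\<Sum>s\<in>S. c s * exp (z * complex_of_real s))"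
    using exppoly_normal_form[OF assms(1)] by blast
  have "\<forall>s\<in>S. c s = 0" by (rule exp_sum_eq_0[OF S(1)]) (use assms(2) S(2) in metis)
  then show ?thesis unfolding S(2) by simp
qed

lemma polyfun_exppoly:
  assumes "p \<in> polyfun" "\<And>v. (\<lambda>z. x z v) \<in> exppoly"
  shows "(\<lambda>z. p (x z)) \<in> exppoly"
  using assms(1)
  by induction (auto intro: exppoly_const exppoly.add exppoly_mult assms(2))

lemma polyfun_tendsto:
  assumes "p \<in> polyfun" "\<And>v. ((\<lambda>k. x k v) \<longlongrightarrow> y v) F"
  shows "((\<lambda>k. p (x k)) \<longlongrightarrow> p y) F"
  using assms(1) by induction (auto intro!: tendsto_intros assms(2))

section \<open>Closed subgroups and their one-parameter groups\<close>

lemma symmetric_subgroup2D: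
  assumes "symmetric_subgroup2 m n G"
  shows "(X, Y) \<in> G \<Longrightarrow> X \<in> GL m \<and> Y \<in> GL n"
    "(1\<^sub>m m, 1\<^sub>m n) \<in> G"
    "(X, Y) \<in> G \<Longrightarrow> (X', Y') \<in> G \<Longrightarrow> (X * X', Y * Y') \<in> G"
    "(X, Y) \<in> G \<Longrightarrow> (minv X, minv Y) \<in> G"
    "(X, Y) \<in> G \<Longrightarrow> (ctrans X, ctrans Y) \<in> G"
    "zariski_closed_in pair_coords (GL2 m n) G"
proof -
  have S: "G \<subseteq> GL m \<times> GL n" "(1\<^sub>m m, 1\<^sub>m n) \<in> G" "zariski_closed_in pair_coords (GL2 m n) G"
    "\<forall>(X, Y)\<in>G. \<forall>(X', Y')\<in>G. (X * X', Y * Y') \<in> G"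
    "\<forall>(X, Y)\<in>G. (minv X, minv Y) \<in> G"
    "\<forall>(X, Y)\<in>G. (ctrans X, ctrans Y) \<in> G"
    using assms unfolding symmetric_subgroup2_def GL2_def by - (elim conjE; assumption)+
  show "(X, Y) \<in> G \<Longrightarrow> X \<in> GL m \<and> Y \<in> GL n" using S(1) by blast
  show "(1\<^sub>m m, 1\<^sub>m n) \<in> G" "zariski_closed_in pair_coords (GL2 m n) G" by (rule S)+
  show "(X * X', Y * Y') \<in> G" if "(X, Y) \<in> G" "(X', Y') \<in> G"
    using bspec[OF S(4) that(1)] that(2) by blast
  show "(X, Y) \<in> G \<Longrightarrow> (minv X, minv Y) \<in> G" using S(5) by blast
  show "(X, Y) \<in> G \<Longrightarrow> (ctrans X, ctrans Y) \<in> G" using S(6) by blast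
qed

lemma symmetric_subgroup2_pow:
  assumes G: "symmetric_subgroup2 m n G" and XY: "(X, Y) \<in> G"
  shows "(X ^\<^sub>m k, Y ^\<^sub>m k) \<in> G"
proof (induction k)
  case 0
  have "dim_row X = m" "dim_row Y = n" using symmetric_subgroup2D(1)[OF G XY] GL_minv(1) by blast+
  then show ?case using symmetric_subgroup2D(2)[OF G] by simp
next
  case (Suc k)
  then show ?case using symmetric_subgroup2D(3)[OF G _ XY] by simp
qed

lemma mat_coords_exppoly:
  "(\<lambda>z. mat_coords (ediag n U z l) v) \<in> exppoly"
proof (cases v)
  case (Pair i j)
  have "(\<lambda>z. \<Sum>a<n. U $$ (i, a) * exp (z * complex_of_real (l a)) * cnj (U $$ (j, a))) \<in> exppoly"
    by (intro exppoly_sum exppoly_mult exppoly_const) (use exppoly.exp[of 1] in auto)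
  then show ?thesis
    using exppoly_const[of 0] by (cases "i < n \<and> j < n") (auto simp: Pair mat_coords_def)
qed

text \<open>A polynomial equation of \<open>G\<close>, restricted to a one-parameter group, is an exponential polynomial.\<close>

lemma symmetric_subgroup2_exp:
  fixes l r :: "nat \<Rightarrow> real"
  assumes G: "symmetric_subgroup2 m n G" and U: "unitary m U" and V: "unitary n V"
    and nat: "\<And>k::nat. (ediag m U (of_nat k) l,
                     ediag n V (of_nat k) r) \<in> G"
  shows "(ediag m U z l,
          ediag n V z r) \<in> G"
proof -
  define g where "g z = (ediag m U z l,
          ediag n V z r)" for z
  obtain P where P: "P \<subseteq> polyfun" "G = {x \<in> GL2 m n. \<forall>p\<in>P. p (pair_coords x) = 0}"
    using symmetric_subgroup2D(6)[OF G] unfolding zariski_closed_in_def by blast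
  have co: "(\<lambda>z. pair_coords (g z) v) \<in> exppoly" for v
    by (cases v; cases "fst v") (simp_all add: g_def pair_coords_def mat_coords_exppoly)
  have "p (pair_coords (g z)) = 0" if "p \<in> P" for p
  proof (rule exppoly_eq_0[where f = "\<lambda>z. p (pair_coords (g z))"])
    show "(\<lambda>z. p (pair_coords (g z))) \<in> exppoly"
      by (rule polyfun_exppoly[where x = "\<lambda>z. pair_coords (g z)" and p = p, OF _ co]) (use P(1) that in blast)
    show "p (pair_coords (g (of_nat k))) = 0" for k
      using nat[of k] that unfolding P(2) g_def by blast
  qed
  moreover have "g z \<in> GL2 m n"
    unfolding g_def GL2_def using udiag_inverse(1)[OF U] udiag_inverse(1)[OF V] by simp
  ultimately have "g z \<in> G" unfolding P(2) by blast
  then show ?thesis by (simp add: g_def)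
qed

text \<open>Polynomials are continuous, so \<open>G\<close> is closed for entrywise convergence. The
  limit has to be invertible because \<open>G\<close> is cut out by its equations inside the general
  linear groups only.\<close>

lemma symmetric_subgroup2_limit:
  assumes G: "symmetric_subgroup2 m n G" and XY: "X \<in> GL m" "Y \<in> GL n"
    and XYs: "\<And>k::nat. (Xs k, Ys k) \<in> G"
    and X: "\<And>i j. i < m \<Longrightarrow> j < m \<Longrightarrow> (\<lambda>k. Xs k $$ (i, j)) \<longlonglongrightarrow> X $$ (i, j)"
    and Y: "\<And>i j. i < n \<Longrightarrow> j < n \<Longrightarrow> (\<lambda>k. Ys k $$ (i, j)) \<longlonglongrightarrow> Y $$ (i, j)"
  shows "(X, Y) \<in> G"
proof -
  obtain P where P: "P \<subseteq> polyfun" "G = {x \<in> GL2 m n. \<forall>p\<in>P. p (pair_coords x) = 0}"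
    using symmetric_subgroup2D(6)[OF G] unfolding zariski_closed_in_def by blast
  have c: "X \<in> carrier_mat m m" "Y \<in> carrier_mat n n"
    "\<And>k. Xs k \<in> carrier_mat m m" "\<And>k. Ys k \<in> carrier_mat n n"
    using XY XYs symmetric_subgroup2D(1)[OF G] GL_minv(1) by blast+
  have lim: "(\<lambda>k. pair_coords (Xs k, Ys k) v) \<longlonglongrightarrow> pair_coords (X, Y) v" for v
  proof -
    obtain b i j where v: "v = (b, i, j)" by (cases v) auto
    show ?thesis
      using X[of i j] Y[of i j] c(1,2) carrier_matD[OF c(3)] carrier_matD[OF c(4)]
      by (auto simp: v pair_coords_def mat_coords_def)
  qed
  have "p (pair_coords (X, Y)) = 0" if "p \<in> P" for p
  proof -
    have "(\<lambda>k. p (pair_coords (Xs k, Ys k))) \<longlonglongrightarrow> p (pair_coords (X, Y))"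
      by (rule polyfun_tendsto[where x = "\<lambda>k. pair_coords (Xs k, Ys k)" and p = p, OF _ lim]) (use P(1) that in blast)
    moreover have "p (pair_coords (Xs k, Ys k)) = 0" for k using XYs[of k] that P by blast
    ultimately show ?thesis by (simp add: LIMSEQ_const_iff)
  qed
  then show ?thesis using XY unfolding P(2) GL2_def by simp
qed

lemma iLieK_udiag_iff:
  fixes l r :: "nat \<Rightarrow> real"
  assumes U: "unitary m U" and V: "unitary n V"
  shows "(hdiag m U l, hdiag n V r) \<in> iLieK m n G \<longleftrightarrow>
    (\<forall>t::real. (ediag m U (complex_of_real t) l, ediag n V (complex_of_real t) r) \<in> G)"
  using U V by (auto simp: iLieK_def LieG_def hermitian_def udiag_ctrans mexp_smult_udiag)

lemma iLieK_carrier: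
  assumes "(H1, H2) \<in> iLieK m n G"
  shows "H1 \<in> carrier_mat m m" "H2 \<in> carrier_mat n n" "ctrans H1 = H1" "ctrans H2 = H2"
  using assms by (auto simp: iLieK_def LieG_def hermitian_def)

lemma iLieK_spectral:
  assumes "(H1, H2) \<in> iLieK m n G"
  obtains U l V r where "unitary m U" "unitary n V"
    "H1 = hdiag m U l" "H2 = hdiag n V r"
proof -
  note c = iLieK_carrier[OF assms]
  obtain U l where U: "unitary m U" "H1 = hdiag m U l"
    using hermitian_spectral[OF c(1,3)] by metis
  obtain V r where V: "unitary n V" "H2 = hdiag n V r"
    using hermitian_spectral[OF c(2,4)] by metis
  show ?thesis by (rule that[OF U(1) V(1) U(2) V(2)])
qed

text \<open>The definition of the Lie algebra gives real times, in particular natural ones, and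
  these determine all complex times. At imaginary times the exponentials are unitary, which is how
  unitary elements of \<open>G\<close> are produced from Hermitian directions.\<close>

lemma iLieK_exp_complex:
  fixes l r :: "nat \<Rightarrow> real"
  assumes G: "symmetric_subgroup2 m n G" and U: "unitary m U" and V: "unitary n V"
    and H: "(hdiag m U l, hdiag n V r) \<in> iLieK m n G"
  shows "(ediag m U z l,
          ediag n V z r) \<in> G"
proof (rule symmetric_subgroup2_exp[OF G U V])
  show "(ediag m U (of_nat k) l,
         ediag n V (of_nat k) r) \<in> G" for k
    using H[unfolded iLieK_udiag_iff[OF U V], rule_format, of "real k"] by simp
qed

lemma iLieK_scale:
  assumes "(H1, H2) \<in> iLieK m n G"
  shows "(complex_of_real c \<cdot>\<^sub>m H1, complex_of_real c \<cdot>\<^sub>m H2) \<in> iLieK m n G"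
proof -
  obtain U l V r where UV: "unitary m U" "unitary n V"
    "H1 = hdiag m U l" "H2 = hdiag n V r"
    by (rule iLieK_spectral[OF assms])
  have "(udiag m U (\<lambda>a. exp (complex_of_real t * complex_of_real (c * l a))), udiag n V (\<lambda>a. exp (complex_of_real t * complex_of_real (c * r a)))) \<in> G" for t
    using assms[unfolded UV(3,4) iLieK_udiag_iff[OF UV(1,2)], rule_format, of "t * c"]
    by (simp add: mult.assoc)
  then show ?thesis
    using iLieK_udiag_iff[OF UV(1,2), of "\<lambda>a. c * l a" "\<lambda>a. c * r a" G]
    by (simp add: UV(3,4) udiag_smult)
qed

lemma iLieK_conj:
  assumes G: "symmetric_subgroup2 m n G" and K: "unitary m K1" "unitary n K2" "(K1, K2) \<in> G"
    and H: "(H1, H2) \<in> iLieK m n G"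
  shows "(K1 * H1 * ctrans K1, K2 * H2 * ctrans K2) \<in> iLieK m n G"
proof -
  obtain U l V r where UV: "unitary m U" "unitary n V"
    "H1 = hdiag m U l" "H2 = hdiag n V r"
    by (rule iLieK_spectral[OF H])
  note c = unitaryD(1)[OF UV(1)] unitaryD(1)[OF K(1)] unitaryD(1)[OF UV(2)] unitaryD(1)[OF K(2)]
  have "(ediag m (K1 * U) (complex_of_real t) l, ediag n (K2 * V) (complex_of_real t) r) \<in> G" for t
  proof -
    have "(ediag m U (complex_of_real t) l, ediag n V (complex_of_real t) r) \<in> G"
      using H unfolding UV(3,4) iLieK_udiag_iff[OF UV(1,2)] by blast
    from symmetric_subgroup2D(3)[OF G symmetric_subgroup2D(3)[OF G K(3) this]
        symmetric_subgroup2D(5)[OF G K(3)]]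
    show ?thesis unfolding udiag_conj[OF c(1,2)] udiag_conj[OF c(3,4)] .
  qed
  then show ?thesis
    unfolding UV(3,4) udiag_conj[OF c(1,2)] udiag_conj[OF c(3,4)]
      iLieK_udiag_iff[OF unitary_mult[OF K(1) UV(1)] unitary_mult[OF K(2) UV(2)]] by blast
qed

subsection \<open>The Lie product formula for Hermitian matrices\<close>

lemma minus_mat_telescope:
  fixes A :: "complex mat"
  assumes "A \<in> carrier_mat m n" "B \<in> carrier_mat m n" "C \<in> carrier_mat m n"
  shows "A - C = (A - B) + (B - C)"
  using assms by (intro eq_matI) auto

text \<open>Telescoping: \<open>A^(j+1) - B^(j+1) = A^j (A - B) + (A^j - B^j) B\<close>. The
  multiplier bounds \<open>left\<close> and \<open>right\<close> stand in for the operator norm;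
  with Frobenius norms of the factors, even the identity would contribute \<open>sqrt n\<close> for
  each power and the bound would blow up with \<open>j\<close>.\<close>

lemma frob_pow_diff:
  assumes A: "A \<in> carrier_mat n n" and B: "B \<in> carrier_mat n n" and C: "C \<ge> 1"
    and left: "\<And>Z. Z \<in> carrier_mat n n \<Longrightarrow> frob (A * Z) \<le> C * frob Z"
    and right: "\<And>Z. Z \<in> carrier_mat n n \<Longrightarrow> frob (Z * B) \<le> C * frob Z"
  shows "frob (A ^\<^sub>m j - B ^\<^sub>m j) \<le> real j * C ^ j * frob (A - B)"
proof (induction j)
  case 0
  have "A ^\<^sub>m 0 - B ^\<^sub>m 0 = 0\<^sub>m n n" using A B by simp
  then show ?case by (simp add: frob_eq fsq_def)
next
  case (Suc j)
  have pw: "A ^\<^sub>m j \<in> carrier_mat n n" "B ^\<^sub>m j \<in> carrier_mat n n" using A B by simp_all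
  have D: "A - B \<in> carrier_mat n n" "A ^\<^sub>m j - B ^\<^sub>m j \<in> carrier_mat n n"
    by (rule minus_carrier_mat[OF B], rule minus_carrier_mat[OF pw(2)])
  have left_pow: "frob (A ^\<^sub>m i * Z) \<le> C ^ i * frob Z" if "Z \<in> carrier_mat n n" for i Z
    using that
  proof (induction i arbitrary: Z)
    case 0
    then show ?case using A by simp
  next
    case (Suc i)
    have AZ: "A * Z \<in> carrier_mat n n" using A Suc.prems by simp
    have "frob (A ^\<^sub>m Suc i * Z) = frob (A ^\<^sub>m i * (A * Z))"
      using A Suc.prems by (simp add: mult_square[where n = n])
    also have "\<dots> \<le> C ^ i * frob (A * Z)" by (rule Suc.IH[OF AZ])
    also have "\<dots> \<le> C ^ i * (C * frob Z)" using C left[OF Suc.prems] by (intro mult_left_mono) auto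
    finally show ?case by (simp add: mult_ac)
  qed
  have AB: "A ^\<^sub>m j * A \<in> carrier_mat n n" "A ^\<^sub>m j * B \<in> carrier_mat n n" "B ^\<^sub>m j * B \<in> carrier_mat n n"
    by (rule mult_carrier_mat[OF pw(1) A], rule mult_carrier_mat[OF pw(1) B], rule mult_carrier_mat[OF pw(2) B])
  have "A ^\<^sub>m Suc j - B ^\<^sub>m Suc j = A ^\<^sub>m j * (A - B) + (A ^\<^sub>m j - B ^\<^sub>m j) * B"
    unfolding mult_minus_distrib_mat[OF pw(1) A B] minus_mult_distrib_mat[OF pw B]
    using minus_mat_telescope[OF AB] by simp
  then have "frob (A ^\<^sub>m Suc j - B ^\<^sub>m Suc j) \<le> frob (A ^\<^sub>m j * (A - B)) + frob ((A ^\<^sub>m j - B ^\<^sub>m j) * B)"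
    using frob_triangle[OF mult_carrier_mat[OF pw(1) D(1)] mult_carrier_mat[OF D(2) B]] by simp
  also have "\<dots> \<le> C ^ j * frob (A - B) + C * (real j * C ^ j * frob (A - B))"
    by (rule add_mono[OF left_pow[OF D(1)] order_trans[OF right[OF D(2)] mult_left_mono[OF Suc.IH]]])
      (use C in simp)
  also have "\<dots> \<le> C ^ Suc j * frob (A - B) + C * (real j * C ^ j * frob (A - B))"
    using C by (intro add_right_mono mult_right_mono) (auto intro: power_increasing)
  also have "\<dots> = real (Suc j) * C ^ Suc j * frob (A - B)" by (simp add: algebra_simps)
  finally show ?case .
qed

lemma frob_udiag_le:
  assumes "unitary n U" "Z \<in> carrier_mat n n" "\<And>a. a < n \<Longrightarrow> cmod (d a) \<le> C" "0 \<le> C"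
  shows "frob (udiag n U d * Z) \<le> C * frob Z" "frob (Z * udiag n U d) \<le> C * frob Z"
proof -
  have left: "frob (udiag n U d * Z) \<le> C * frob Z"
    if "Z \<in> carrier_mat n n" "\<And>a. a < n \<Longrightarrow> cmod (d a) \<le> C" for Z d
  proof -
    note U = unitaryD(1)[OF assms(1)]
    have "fsq (udiag n U d * Z) \<le> (\<Sum>i<n. \<Sum>j<n. C\<^sup>2 * (cmod ((ctrans U * Z) $$ (i, j)))\<^sup>2)"
      unfolding fsq_udiag_left[OF assms(1) that(1)]
      by (intro sum_mono mult_right_mono power_mono that(2)) auto
    also have "\<dots> = C\<^sup>2 * fsq (ctrans U * Z)"
      using U that(1) by (simp add: fsq_def sum_distrib_left del: index_mult_mat(1))
    also have "\<dots> = C\<^sup>2 * fsq Z" using fsq_unitary_left[OF unitary_ctrans[OF assms(1)] that(1)] by simp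
    finally have "sqrt (fsq (udiag n U d * Z)) \<le> sqrt (C\<^sup>2 * fsq Z)" by (rule real_sqrt_le_mono)
    then show ?thesis using assms(4) by (simp add: frob_eq real_sqrt_mult)
  qed
  show "frob (udiag n U d * Z) \<le> C * frob Z" by (rule left[OF assms(2,3)])
  have "frob (Z * udiag n U d) = frob (ctrans (Z * udiag n U d))" by (simp add: frob_eq)
  also have "ctrans (Z * udiag n U d) = udiag n U (\<lambda>a. cnj (d a)) * ctrans Z"
    using ctrans_mult[OF assms(2) udiag_carrier] by (simp add: udiag_ctrans)
  also have "frob \<dots> \<le> C * frob (ctrans Z)" by (rule left) (use assms(2,3) in auto)
  finally show "frob (Z * udiag n U d) \<le> C * frob Z" by (simp add: frob_eq)
qed

lemma udiag_exp_deriv: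
  assumes "i < n" "j < n"
  shows "((\<lambda>s. udiag n U (\<lambda>a. exp (s * d a)) $$ (i, j)) has_field_derivative udiag n U d $$ (i, j)) (at 0)"
  using assms by (auto intro!: derivative_eq_intros sum.cong)

text \<open>With \<open>h = 1/(k+1)\<close>, the product of the two exponentials at time
  \<open>h\<close> and the exponential of the sum at time \<open>h\<close> agree to first order, so
  their difference \<open>M k\<close> is o(h). Taking powers magnifies it by at most
  \<open>k + 1\<close> times a constant. The purpose is additivity of the Hermitian part of the Lie
  algebra.\<close>

lemma lie_product_formula:
  fixes l r w :: "nat \<Rightarrow> real"
  assumes U: "unitary n U" and V: "unitary n V" and W: "unitary n W"
    and sum: "hdiag n U l + hdiag n V r =
              hdiag n W w"
    and ij: "i < n" "j < n"
  shows "(\<lambda>k. ((ediag n U (inverse (of_nat (Suc k))) l *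
                ediag n V (inverse (of_nat (Suc k))) r) ^\<^sub>m Suc k) $$ (i, j))
          \<longlonglongrightarrow> udiag n W (\<lambda>a. exp (complex_of_real (w a))) $$ (i, j)"
proof -
  define E where "E s = ediag n U s l" for s :: complex
  define F where "F s = ediag n V s r" for s :: complex
  define e where "e s = ediag n W s w" for s :: complex
  define h where "h k = (inverse (of_nat (Suc k)) :: complex)" for k
  have c: "E s \<in> carrier_mat n n" "F s \<in> carrier_mat n n" "e s \<in> carrier_mat n n"
    "E s * F s \<in> carrier_mat n n" for s
    by (simp_all add: E_def F_def e_def mult_square[where n = n])
  have zero: "E 0 = 1\<^sub>m n" "F 0 = 1\<^sub>m n" "e 0 = 1\<^sub>m n"
    using udiag_one U V W by (simp_all add: E_def F_def e_def)
  \<comment> \<open>A common bound for all eigenvalues involved, so that multiplying by any of the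
    three exponentials at time \<open>1/(k+1)\<close> increases the Frobenius norm at most by the
    factor \<open>exp (L / (k+1))\<close>.\<close>
  define L where "L = Max ((\<lambda>a. max \<bar>l a\<bar> (max \<bar>r a\<bar> \<bar>w a\<bar>)) ` {..<n})"
  have L: "\<bar>l a\<bar> \<le> L \<and> \<bar>r a\<bar> \<le> L \<and> \<bar>w a\<bar> \<le> L" if "a < n" for a
  proof -
    have "max \<bar>l a\<bar> (max \<bar>r a\<bar> \<bar>w a\<bar>) \<le> L" unfolding L_def by (rule Max_ge) (use that in auto)
    then show ?thesis by auto
  qed
  have L0: "L \<ge> 0" using L[OF ij(1)] by linarith
  have h_real: "h k = complex_of_real (1 / real (Suc k))" for k
    by (simp add: h_def field_simps del: of_nat_Suc)
  have bound: "cmod (exp (h k * complex_of_real x)) \<le> exp (L / real (Suc k))" if "\<bar>x\<bar> \<le> L" for x k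
    using that by (simp add: h_real norm_exp_eq_Re divide_right_mono abs_le_iff)
  define M where "M k = E (h k) * F (h k) - e (h k)" for k
  have M: "M k \<in> carrier_mat n n" for k
    unfolding M_def by (rule minus_carrier_mat[OF c(3)])
  have entry: "(\<lambda>k. of_nat (Suc k) * M k $$ (i, j)) \<longlonglongrightarrow> 0" if "i < n" "j < n" for i j
  proof -
    \<comment> \<open>An entry of \<open>M k\<close> as a function of the step length. It vanishes
      at 0, and so does its derivative, by the hypothesis \<open>sum\<close>.\<close>
    define f where "f s = (\<Sum>a<n. E s $$ (i, a) * F s $$ (a, j)) - e s $$ (i, j)" for s
    have f0: "f 0 = 0" unfolding f_def zero using that by (simp add: if_distrib cong: if_cong)
    have dE: "((\<lambda>s. E s $$ (i, a)) has_field_derivative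
        hdiag n U l $$ (i, a)) (at 0)" if "a < n" for a
      unfolding E_def by (rule udiag_exp_deriv[OF \<open>i < n\<close> that])
    have dF: "((\<lambda>s. F s $$ (a, j)) has_field_derivative
        hdiag n V r $$ (a, j)) (at 0)" if "a < n" for a
      unfolding F_def by (rule udiag_exp_deriv[OF that \<open>j < n\<close>])
    have de: "((\<lambda>s. e s $$ (i, j)) has_field_derivative
        hdiag n W w $$ (i, j)) (at 0)"
      unfolding e_def by (rule udiag_exp_deriv[OF that])
    have "(f has_field_derivative
        (\<Sum>a<n. hdiag n U l $$ (i, a) * F 0 $$ (a, j) +
           hdiag n V r $$ (a, j) * E 0 $$ (i, a)) -
         hdiag n W w $$ (i, j)) (at 0)"
      unfolding f_def by (rule DERIV_diff[OF DERIV_sum[OF DERIV_mult[OF dE dF]] de]) simp_all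
    also have "(\<Sum>a<n. hdiag n U l $$ (i, a) * F 0 $$ (a, j) +
           hdiag n V r $$ (a, j) * E 0 $$ (i, a)) =
        hdiag n U l $$ (i, j) + hdiag n V r $$ (i, j)"
      unfolding zero sum.distrib using that by (simp add: if_distrib cong: if_cong del: udiag_index)
    also have "\<dots> - hdiag n W w $$ (i, j) = 0"
      unfolding sum[symmetric] using that by (simp del: udiag_index)
    finally have "(\<lambda>s. (f (0 + s) - f 0) / s) \<midarrow>0\<rightarrow> 0" by (simp add: DERIV_def)
    then have lim: "(\<lambda>s. f s / s) \<midarrow>0\<rightarrow> 0" using f0 by simp
    have "h \<longlonglongrightarrow> 0" unfolding h_def by (rule LIMSEQ_Suc[OF lim_inverse_n])
    then have "filterlim h (at 0) sequentially"
      by (rule filterlim_atI) (simp add: h_def del: of_nat_Suc)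
    then have "(\<lambda>k. f (h k) / h k) \<longlonglongrightarrow> 0" by (rule filterlim_compose[OF lim])
    moreover have "M k $$ (i, j) = f (h k)" for k
      unfolding M_def f_def using that carrier_matD[OF c(3)[of "h k"]]
      by (subst index_minus_mat(1)) (auto simp: index_mult_mat_sum[OF c(1,2)] simp del: index_mult_mat(1))
    ultimately show ?thesis by (simp add: h_def field_simps)
  qed
  have frobM: "(\<lambda>k. real (Suc k) * frob (M k)) \<longlonglongrightarrow> 0"
  proof -
    have "real (Suc k) * frob (M k) = sqrt (\<Sum>i<n. \<Sum>j<n. (cmod (of_nat (Suc k) * M k $$ (i, j)))\<^sup>2)" for k
    proof -
      have "(\<Sum>i<n. \<Sum>j<n. (cmod (of_nat (Suc k) * M k $$ (i, j)))\<^sup>2) = (real (Suc k))\<^sup>2 * fsq (M k)"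
        using M[of k] by (simp add: fsq_def norm_mult power_mult_distrib sum_distrib_left del: of_nat_Suc)
      then show ?thesis by (simp add: frob_eq real_sqrt_mult del: of_nat_Suc)
    qed
    moreover have "(\<lambda>k. sqrt (\<Sum>i<n. \<Sum>j<n. (cmod (of_nat (Suc k) * M k $$ (i, j)))\<^sup>2)) \<longlonglongrightarrow>
      sqrt (\<Sum>i<n. \<Sum>j<n. (cmod 0)\<^sup>2)"
      by (intro tendsto_intros entry) auto
    ultimately show ?thesis by simp
  qed
  have main: "frob ((E (h k) * F (h k)) ^\<^sub>m Suc k - e 1) \<le> exp (2 * L) * (real (Suc k) * frob (M k))" for k
  proof -
    \<comment> \<open>Twice \<open>L\<close> since the product has two exponential factors. The
      power of order \<open>Suc k\<close> of this constant is \<open>exp (2 * L)\<close>,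
      independent of \<open>k\<close>.\<close>
    define C where "C = exp (2 * L / real (Suc k))"
    have C1: "exp (L / real (Suc k)) * exp (L / real (Suc k)) = C"
      by (simp add: C_def exp_add[symmetric])
    have C2: "C \<ge> 1" "exp (L / real (Suc k)) \<le> C" using L0 by (simp_all add: C_def divide_right_mono)
    have CS: "C ^ Suc k = exp (2 * L)" unfolding C_def exp_of_nat_mult[symmetric] by simp
    have pw: "exp (h k * x) ^ Suc k = exp (1 * x)" for x :: complex
    proof -
      have "of_nat (Suc k) * (h k * x) = x" unfolding h_def by (simp add: field_simps del: of_nat_Suc)
      then show ?thesis unfolding exp_of_nat_mult[symmetric] by (simp only: mult_1)
    qed
    have ek: "e (h k) ^\<^sub>m Suc k = e 1"
      unfolding e_def udiag_pow[OF W] by (rule udiag_cong) (rule pw)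
    have "frob ((E (h k) * F (h k)) ^\<^sub>m Suc k - e (h k) ^\<^sub>m Suc k) \<le> real (Suc k) * C ^ Suc k * frob (E (h k) * F (h k) - e (h k))"
    proof (rule frob_pow_diff[OF c(4,3) C2(1)])
      fix Z :: "complex mat" assume Z: "Z \<in> carrier_mat n n"
      have FZ: "F (h k) * Z \<in> carrier_mat n n" by (rule mult_carrier_mat[OF c(2) Z])
      have "frob (E (h k) * F (h k) * Z) = frob (E (h k) * (F (h k) * Z))"
        using c Z by (simp add: mult_square[where n = n])
      also have "\<dots> \<le> exp (L / real (Suc k)) * frob (F (h k) * Z)"
        unfolding E_def by (rule frob_udiag_le(1)[OF U FZ bound]) (use L in auto)
      also have "\<dots> \<le> exp (L / real (Suc k)) * (exp (L / real (Suc k)) * frob Z)"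
        unfolding F_def by (rule mult_left_mono[OF frob_udiag_le(1)[OF V Z bound]]) (use L in auto)
      also have "\<dots> = C * frob Z" by (simp add: C1[symmetric])
      finally show "frob (E (h k) * F (h k) * Z) \<le> C * frob Z" .
      have "frob (Z * e (h k)) \<le> exp (L / real (Suc k)) * frob Z"
        unfolding e_def by (rule frob_udiag_le(2)[OF W Z bound]) (use L in auto)
      also have "\<dots> \<le> C * frob Z" by (rule mult_right_mono[OF C2(2)]) simp
      finally show "frob (Z * e (h k)) \<le> C * frob Z" .
    qed
    then show ?thesis unfolding ek CS M_def by (simp add: mult_ac)
  qed
  have "(\<lambda>k. ((E (h k) * F (h k)) ^\<^sub>m Suc k) $$ (i, j) - e 1 $$ (i, j)) \<longlonglongrightarrow> 0"
  proof (rule Lim_null_comparison)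
    show "(\<lambda>k. exp (2 * L) * (real (Suc k) * frob (M k))) \<longlonglongrightarrow> 0"
      using tendsto_mult_right_zero[OF frobM] by simp
    show "\<forall>\<^sub>F k in sequentially. cmod (((E (h k) * F (h k)) ^\<^sub>m Suc k) $$ (i, j) - e 1 $$ (i, j))
       \<le> exp (2 * L) * (real (Suc k) * frob (M k))"
    proof (rule always_eventually, rule allI)
      fix k
      have p: "(E (h k) * F (h k)) ^\<^sub>m Suc k \<in> carrier_mat n n"
        by (rule pow_carrier_mat[OF c(4)])
      then have "cmod (((E (h k) * F (h k)) ^\<^sub>m Suc k) $$ (i, j) - e 1 $$ (i, j)) =
          cmod (((E (h k) * F (h k)) ^\<^sub>m Suc k - e 1) $$ (i, j))"
        using ij c(3)[of 1] by (subst index_minus_mat(1)) auto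
      also have "\<dots> \<le> frob ((E (h k) * F (h k)) ^\<^sub>m Suc k - e 1)"
        by (rule frob_entry[OF minus_carrier_mat[OF c(3)] ij])
      also note main[of k]
      finally show "cmod (((E (h k) * F (h k)) ^\<^sub>m Suc k) $$ (i, j) - e 1 $$ (i, j))
       \<le> exp (2 * L) * (real (Suc k) * frob (M k))" .
    qed
  qed
  then show ?thesis
    by (subst (asm) LIM_zero_iff) (simp add: E_def F_def e_def h_def)
qed

text \<open>The approximants of the Lie product formula are products of elements of
  \<open>G\<close>, and \<open>G\<close> is closed. The time \<open>t\<close> is absorbed into the
  eigenvalues, so the formula at time 1 suffices.\<close>

lemma iLieK_add:
  assumes G: "symmetric_subgroup2 m n G"
    and H: "(H1, H2) \<in> iLieK m n G" and H': "(H1', H2') \<in> iLieK m n G"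
  shows "(H1 + H1', H2 + H2') \<in> iLieK m n G"
proof -
  obtain U l V r where UV: "unitary m U" "unitary n V"
    "H1 = hdiag m U l" "H2 = hdiag n V r"
    by (rule iLieK_spectral[OF H])
  obtain U' l' V' r' where UV': "unitary m U'" "unitary n V'"
    "H1' = hdiag m U' l'" "H2' = hdiag n V' r'"
    by (rule iLieK_spectral[OF H'])
  note c = iLieK_carrier[OF H] and c' = iLieK_carrier[OF H']
  have "H1 + H1' \<in> carrier_mat m m" "ctrans (H1 + H1') = H1 + H1'"
    using c c' by (auto simp: ctrans_add[OF c(1) c'(1)])
  then obtain W w where W: "unitary m W" "H1 + H1' = hdiag m W w"
    using hermitian_spectral by metis
  have "H2 + H2' \<in> carrier_mat n n" "ctrans (H2 + H2') = H2 + H2'"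
    using c c' by (auto simp: ctrans_add[OF c(2) c'(2)])
  then obtain Z z where Z: "unitary n Z" "H2 + H2' = hdiag n Z z"
    using hermitian_spectral by metis
  have "(udiag m W (\<lambda>a. exp (complex_of_real (t * w a))), udiag n Z (\<lambda>a. exp (complex_of_real (t * z a)))) \<in> G" for t :: real
  proof (rule symmetric_subgroup2_limit[OF G])
    show "udiag m W (\<lambda>a. exp (complex_of_real (t * w a))) \<in> GL m"
      "udiag n Z (\<lambda>a. exp (complex_of_real (t * z a))) \<in> GL n"
      by (rule udiag_inverse(1)[OF W(1)], simp, rule udiag_inverse(1)[OF Z(1)], simp)
    let ?e = "\<lambda>k x. exp (inverse (of_nat (Suc k)) * complex_of_real (t * x))"
    let ?X = "\<lambda>k. (udiag m U (\<lambda>a. ?e k (l a)) * udiag m U' (\<lambda>a. ?e k (l' a))) ^\<^sub>m Suc k"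
    let ?Y = "\<lambda>k. (udiag n V (\<lambda>a. ?e k (r a)) * udiag n V' (\<lambda>a. ?e k (r' a))) ^\<^sub>m Suc k"
    have 1: "(udiag m U (\<lambda>a. ?e k (l a)), udiag n V (\<lambda>a. ?e k (r a))) \<in> G" for k
      using iLieK_exp_complex[OF G UV(1,2) H[unfolded UV(3,4)], of "inverse (of_nat (Suc k)) * complex_of_real t"]
      by (simp add: mult.assoc)
    have 2: "(udiag m U' (\<lambda>a. ?e k (l' a)), udiag n V' (\<lambda>a. ?e k (r' a))) \<in> G" for k
      using iLieK_exp_complex[OF G UV'(1,2) H'[unfolded UV'(3,4)], of "inverse (of_nat (Suc k)) * complex_of_real t"]
      by (simp add: mult.assoc)
    show "(?X k, ?Y k) \<in> G" for k
      by (rule symmetric_subgroup2_pow[OF G symmetric_subgroup2D(3)[OF G 1 2]])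
    have s1: "udiag m U (\<lambda>a. complex_of_real (t * l a)) + udiag m U' (\<lambda>a. complex_of_real (t * l' a)) =
       udiag m W (\<lambda>a. complex_of_real (t * w a))"
      using arg_cong[OF W(2), of "\<lambda>A. complex_of_real t \<cdot>\<^sub>m A"] c c'
      by (simp add: UV(3) UV'(3) udiag_smult add_smult_distrib_left_mat[of _ m m])
    have s2: "udiag n V (\<lambda>a. complex_of_real (t * r a)) + udiag n V' (\<lambda>a. complex_of_real (t * r' a)) =
       udiag n Z (\<lambda>a. complex_of_real (t * z a))"
      using arg_cong[OF Z(2), of "\<lambda>A. complex_of_real t \<cdot>\<^sub>m A"] c c'
      by (simp add: UV(4) UV'(4) udiag_smult add_smult_distrib_left_mat[of _ n n])
    show "(\<lambda>k. ?X k $$ (i, j)) \<longlonglongrightarrow> udiag m W (\<lambda>a. exp (complex_of_real (t * w a))) $$ (i, j)"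
      if "i < m" "j < m" for i j
      by (rule lie_product_formula[OF UV(1) UV'(1) W(1) s1 that])
    show "(\<lambda>k. ?Y k $$ (i, j)) \<longlonglongrightarrow> udiag n Z (\<lambda>a. exp (complex_of_real (t * z a))) $$ (i, j)"
      if "i < n" "j < n" for i j
      by (rule lie_product_formula[OF UV(2) UV'(2) Z(1) s2 that])
  qed
  then show ?thesis unfolding W(2) Z(2) iLieK_udiag_iff[OF W(1) Z(1)] by simp
qed

subsection \<open>The structure of the Lie algebra of a symmetric group containing a torus\<close>

text \<open>The relation is left arbitrary instead of an equivalence so that the empty one can
  encode the zero space, the second component of the Lie algebra in case (ii).\<close>

definition herm_pat :: "nat \<Rightarrow> (nat \<Rightarrow> nat \<Rightarrow> bool) \<Rightarrow> complex mat set" where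
  "herm_pat n R = {H \<in> carrier_mat n n. ctrans H = H \<and> (\<forall>i<n. \<forall>j<n. \<not> R i j \<longrightarrow> H $$ (i, j) = 0)}"

lemma zero_herm_pat: "0\<^sub>m n n \<in> herm_pat n R"
proof -
  have "ctrans (0\<^sub>m n n) = 0\<^sub>m n n" by (rule eq_matI) simp_all
  then show ?thesis by (simp add: herm_pat_def)
qed

lemma herm_pat_empty: "herm_pat n (\<lambda>_ _. False) = {0\<^sub>m n n}"
proof (intro equalityI subsetI)
  fix H assume "H \<in> herm_pat n (\<lambda>_ _. False)"
  then have "H \<in> carrier_mat n n" "\<And>i j. i < n \<Longrightarrow> j < n \<Longrightarrow> H $$ (i, j) = 0"
    by (simp_all add: herm_pat_def)
  then have "H = 0\<^sub>m n n" by (intro eq_matI) simp_all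
  then show "H \<in> {0\<^sub>m n n}" by simp
qed (simp add: zero_herm_pat)

definition offdiag :: "nat \<Rightarrow> complex \<Rightarrow> nat \<Rightarrow> nat \<Rightarrow> complex mat" where
  "offdiag n z i j = mat n n (\<lambda>(a, b). if a = i \<and> b = j then z else if a = j \<and> b = i then cnj z else 0)"

lemma offdiag_carrier [simp]: "offdiag n z i j \<in> carrier_mat n n"
  by (simp add: offdiag_def)

lemma offdiag_mult_index:
  assumes "M \<in> carrier_mat n n" "i \<noteq> j" "i < n" "j < n" "a < n" "b < n"
  shows "(offdiag n 1 i j * M) $$ (a, b) = (if a = i then M $$ (j, b) else if a = j then M $$ (i, b) else 0)"
proof -
  have "(offdiag n 1 i j * M) $$ (a, b) = (\<Sum>c<n. offdiag n 1 i j $$ (a, c) * M $$ (c, b))"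
    by (rule index_mult_mat_sum[OF offdiag_carrier assms(1,5,6)])
  also have "\<dots> = (\<Sum>c<n. if c = (if a = i then j else i) then (if a = i \<or> a = j then M $$ (c, b) else 0) else 0)"
    using assms(2-6) by (intro sum.cong refl) (auto simp: offdiag_def)
  also have "\<dots> = (if a = i then M $$ (j, b) else if a = j then M $$ (i, b) else 0)"
    using assms(3,4) by (simp add: sum.delta')
  finally show ?thesis .
qed

lemma phase_conj_index:
  assumes "H \<in> carrier_mat n n" "a < n" "b < n"
  shows "(mat_diag n d * H * ctrans (mat_diag n d)) $$ (a, b) = d a * H $$ (a, b) * cnj (d b)"
proof -
  have D: "ctrans (mat_diag n d) = mat_diag n (\<lambda>a. cnj (d a))"
    by (rule eq_matI) (auto simp: mat_diag_def)
  have c: "mat_diag n d * H \<in> carrier_mat n n" by (rule mult_carrier_mat[OF mat_diag_carrier assms(1)])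
  show ?thesis
    using assms(2,3) unfolding D
    by (subst mat_diag_mult_right[OF c], subst index_mat, (simp_all add: mat_diag_mult_left[OF assms(1)]))
qed

definition sign_conj :: "nat \<Rightarrow> nat set \<Rightarrow> complex mat \<Rightarrow> complex mat" where
  "sign_conj n P H = mat_diag n (\<lambda>a. if a \<in> P then - 1 else 1) * H * ctrans (mat_diag n (\<lambda>a. if a \<in> P then - 1 else 1))"

text \<open>Let \<open>s_i\<close> be -1 at entries \<open>(a, b)\<close> with exactly one index
  equal to \<open>i\<close>, and 1 elsewhere. The combination multiplies the entry by
  \<open>(1 - s_i) * (1 - s_j) / 4\<close>, which is 1 on the positions \<open>(i, j)\<close> and
  \<open>(j, i)\<close> and 0 elsewhere. Only sums and real multiples appear, the operations under
  which the Lie algebra is known to be closed.\<close>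

lemma offdiag_sign_average:
  assumes H: "H \<in> carrier_mat n n" "ctrans H = H" and ij: "i < n" "j < n" "i \<noteq> j"
  shows "offdiag n (H $$ (i, j)) i j = complex_of_real (1 / 4) \<cdot>\<^sub>m (H + complex_of_real (- 1) \<cdot>\<^sub>m sign_conj n {i} H +
      complex_of_real (- 1) \<cdot>\<^sub>m sign_conj n {j} H + sign_conj n {i, j} H)" (is "_ = ?M")
proof (rule eq_matI)
  have Kd: "dim_row (sign_conj n P H) = n" "dim_col (sign_conj n P H) = n" for P
    by (simp_all add: sign_conj_def)
  show "dim_row (offdiag n (H $$ (i, j)) i j) = dim_row ?M" "dim_col (offdiag n (H $$ (i, j)) i j) = dim_col ?M"
    by (simp_all add: offdiag_def Kd)
  fix a b assume "a < dim_row ?M" "b < dim_col ?M"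
  then have ab: "a < n" "b < n" by (simp_all add: Kd)
  have K: "sign_conj n P H $$ (a, b) = (if a \<in> P then - 1 else 1) * H $$ (a, b) * cnj (if b \<in> P then - 1 else 1)" for P
    unfolding sign_conj_def by (rule phase_conj_index[OF H(1) ab])
  have "H $$ (j, i) = ctrans H $$ (j, i)" unfolding H(2) ..
  also have "\<dots> = cnj (H $$ (i, j))" using H(1) ij by (intro ctrans_index) simp_all
  finally have cj: "H $$ (j, i) = cnj (H $$ (i, j))" .
  have "?M $$ (a, b) = (H $$ (a, b) - sign_conj n {i} H $$ (a, b) - sign_conj n {j} H $$ (a, b) + sign_conj n {i, j} H $$ (a, b)) / 4"
    using ab H(1) by (simp add: Kd)
  also have "\<dots> = offdiag n (H $$ (i, j)) i j $$ (a, b)"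
    unfolding K using ab ij cj by (auto simp: offdiag_def)
  finally show "offdiag n (H $$ (i, j)) i j $$ (a, b) = ?M $$ (a, b)" ..
qed

lemma mat_diag_unitary:
  assumes "\<And>a. a < n \<Longrightarrow> cmod (d a) = 1"
  shows "unitary n (mat_diag n d)"
proof (rule unitaryI)
  have D: "ctrans (mat_diag n d) = mat_diag n (\<lambda>a. cnj (d a))"
    by (rule eq_matI) (auto simp: mat_diag_def)
  have "cnj (d a) * d a = 1" if "a < n" for a
    using complex_norm_square[of "d a"] assms[OF that] by (simp add: mult.commute)
  then show "ctrans (mat_diag n d) * mat_diag n d = 1\<^sub>m n"
    unfolding D mat_diag_diag by (intro eq_matI) (auto simp: mat_diag_def)
qed simp

text \<open>For this \<open>S\<close> the matrix \<open>1 + i S - S^2\<close> equals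
  \<open>exp (i pi/2 S)\<close>: the eigenvalues 0, 1, -1 of \<open>S\<close> go to 1, i, -i. The
  polynomial form lets its action on rows be read off, which is a swap of the rows \<open>i\<close>
  and \<open>j\<close> with a factor of the imaginary unit.\<close>

lemma reflection_mult_index:
  fixes n i j defines "S \<equiv> offdiag n 1 i j"
  assumes M: "M \<in> carrier_mat n n" and ij: "i \<noteq> j" "i < n" "j < n" and ab: "a < n" "b < n"
  shows "((1\<^sub>m n + \<i> \<cdot>\<^sub>m S - S * S) * M) $$ (a, b) =
    (if a = i then \<i> * M $$ (j, b) else if a = j then \<i> * M $$ (i, b) else M $$ (a, b))"
proof -
  have S: "S \<in> carrier_mat n n" by (simp add: S_def)
  have SS: "S * S \<in> carrier_mat n n" and SM: "S * M \<in> carrier_mat n n"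
    by (rule mult_carrier_mat[OF S S], rule mult_carrier_mat[OF S M])
  have SSM: "S * (S * M) \<in> carrier_mat n n" by (rule mult_carrier_mat[OF S SM])
  have iS: "\<i> \<cdot>\<^sub>m S \<in> carrier_mat n n" using S by simp
  have "(1\<^sub>m n + \<i> \<cdot>\<^sub>m S - S * S) * M = M + \<i> \<cdot>\<^sub>m (S * M) - S * (S * M)"
    unfolding minus_mult_distrib_mat[OF add_carrier_mat[OF iS] SS M]
      add_mult_distrib_mat[OF one_carrier_mat iS M] mult_smult_assoc_mat[OF S M]
      left_mult_one_mat[OF M] assoc_mult_mat[OF S S M] ..
  moreover have "(M + \<i> \<cdot>\<^sub>m (S * M) - S * (S * M)) $$ (a, b) =
      M $$ (a, b) + \<i> * (S * M) $$ (a, b) - (S * (S * M)) $$ (a, b)"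
    using carrier_matD[OF SM] carrier_matD[OF SSM] carrier_matD[OF M] ab
    by (simp del: index_mult_mat)
  ultimately show ?thesis
    unfolding S_def using ij ab
    by (simp add: offdiag_mult_index[OF M] offdiag_mult_index[OF SM[unfolded S_def]])
qed

text \<open>
  Averaging over sign changes from the torus isolates the \<open>(i, j)\<close> component of a Hermitian matrix
  of the Lie algebra; conjugation by \<open>exp(\<i>\<pi>/2 (E\<^sub>i\<^sub>j + E\<^sub>j\<^sub>i))\<close>, essentially a transposition, then
  makes the set of occurring index pairs an equivalence relation.
\<close>

lemma torus_invariant_pattern:
  fixes L Gs :: "complex mat set"
  assumes herm: "\<And>H. H \<in> L \<Longrightarrow> H \<in> carrier_mat n n \<and> ctrans H = H"
    and add: "\<And>H H'. H \<in> L \<Longrightarrow> H' \<in> L \<Longrightarrow> H + H' \<in> L"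
    and scale: "\<And>H c. H \<in> L \<Longrightarrow> complex_of_real c \<cdot>\<^sub>m H \<in> L"
    and conj: "\<And>K H. unitary n K \<Longrightarrow> K \<in> Gs \<Longrightarrow> H \<in> L \<Longrightarrow> K * H * ctrans K \<in> L"
    and exp: "\<And>U (l :: nat \<Rightarrow> real) z. unitary n U \<Longrightarrow> hdiag n U l \<in> L \<Longrightarrow>
       ediag n U z l \<in> Gs"
    and log: "\<And>U (l :: nat \<Rightarrow> real). unitary n U \<Longrightarrow>
       (\<And>t::real. ediag n U (complex_of_real t) l \<in> Gs) \<Longrightarrow>
       hdiag n U l \<in> L"
    and torus: "diag_torus n \<subseteq> Gs"
  obtains R where "\<And>i. i < n \<Longrightarrow> R i i" "symp R" "transp R" "L = herm_pat n R"
    "\<And>H. H \<in> L \<Longrightarrow> \<forall>i<n. \<forall>j<n. H $$ (i, j) \<noteq> 0 \<longrightarrow> R i j"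
    "\<And>i j z. i < n \<Longrightarrow> j < n \<Longrightarrow> i \<noteq> j \<Longrightarrow> z \<noteq> 0 \<Longrightarrow> offdiag n z i j \<in> L \<Longrightarrow> R i j"
proof -
  have mat_diag_torus: "mat_diag n d \<in> diag_torus n" if "\<And>a. a < n \<Longrightarrow> d a \<noteq> 0" for d
    using that by (auto simp: diag_torus_def mat_diag_def)
  have diag: "mat_diag n (\<lambda>a. complex_of_real (x a)) \<in> L" for x :: "nat \<Rightarrow> real"
  proof -
    have "mat_diag n (\<lambda>a. exp (complex_of_real t * complex_of_real (x a))) \<in> Gs" for t
      using torus mat_diag_torus[of "\<lambda>a. exp (complex_of_real t * complex_of_real (x a))"] by auto
    then show ?thesis by (rule log[OF unitary_one, of x, unfolded udiag_one_mat])
  qed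
  have phase: "mat_diag n d * H * ctrans (mat_diag n d) \<in> L"
    if "H \<in> L" "\<And>a. cmod (d a) = 1" for H d
  proof (rule conj[OF mat_diag_unitary _ that(1)])
    have "d a \<noteq> 0" for a using that(2)[of a] by auto
    then show "mat_diag n d \<in> Gs" using torus mat_diag_torus by blast
  qed (use that in auto)
  have cjH: "H $$ (j, i) = cnj (H $$ (i, j))" if "H \<in> L" "i < n" "j < n" for H i j
  proof -
    have H: "H \<in> carrier_mat n n" "ctrans H = H" using herm[OF that(1)] by simp_all
    have "H $$ (j, i) = ctrans H $$ (j, i)" unfolding H(2) ..
    also have "\<dots> = cnj (H $$ (i, j))" using H(1) that(2,3) by (intro ctrans_index) simp_all
    finally show ?thesis .
  qed
  have component: "offdiag n (H $$ (i, j)) i j \<in> L"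
    if H: "H \<in> L" and ij: "i < n" "j < n" "i \<noteq> j" for H i j
  proof -
    have "sign_conj n P H \<in> L" for P
      unfolding sign_conj_def by (rule phase[OF H]) simp
    then show ?thesis
      unfolding offdiag_sign_average[OF conjunct1[OF herm[OF H]] conjunct2[OF herm[OF H]] ij]
      by (intro add scale H)
  qed
  \<comment> \<open>A diagonal unitary matrix with the phase of \<open>w / z\<close> in position
    \<open>i\<close> turns the coefficient, and a real scaling adjusts its modulus.\<close>
  have rotate: "offdiag n w i j \<in> L"
    if z: "offdiag n z i j \<in> L" "z \<noteq> 0" and ij: "i < n" "j < n" "i \<noteq> j" for z w i j
  proof (cases "w = 0")
    case True
    have "offdiag n w i j = complex_of_real 0 \<cdot>\<^sub>m offdiag n z i j"
      using True by (intro eq_matI) (auto simp: offdiag_def)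
    then show ?thesis using scale[OF z(1)] by metis
  next
    case False
    define d where "d a = (if a = i then (w / z) / complex_of_real (cmod (w / z)) else 1)" for a
    have "cmod (d a) = 1" for a using False z(2) by (simp add: d_def norm_divide norm_mult)
    from scale[OF phase[OF z(1) this], of "cmod (w / z)"]
    have "complex_of_real (cmod (w / z)) \<cdot>\<^sub>m (mat_diag n d * offdiag n z i j * ctrans (mat_diag n d)) \<in> L" .
    also have "complex_of_real (cmod (w / z)) \<cdot>\<^sub>m (mat_diag n d * offdiag n z i j * ctrans (mat_diag n d)) = offdiag n w i j"
    proof (rule eq_matI)
      fix a b assume "a < dim_row (offdiag n w i j)" "b < dim_col (offdiag n w i j)"
      then have ab: "a < n" "b < n" by (simp_all add: offdiag_def)
      have "(complex_of_real (cmod (w / z)) \<cdot>\<^sub>m (mat_diag n d * offdiag n z i j * ctrans (mat_diag n d))) $$ (a, b)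
         = complex_of_real (cmod (w / z)) * (d a * offdiag n z i j $$ (a, b) * cnj (d b))"
        using ab phase_conj_index[OF offdiag_carrier ab] by (subst index_smult_mat(1)) simp_all
      also have "\<dots> = offdiag n w i j $$ (a, b)"
      proof -
        have "complex_of_real (cmod (w / z)) \<noteq> 0" using False z(2) by simp
        moreover have "w = (w / z) * z" using z(2) by simp
        moreover have "complex_of_real (cmod (w / z)) * (d i * z) = w"
          using z(2) False by (simp add: d_def)
        moreover from this have "complex_of_real (cmod (w / z)) * (cnj z * cnj (d i)) = cnj w"
          by (metis complex_cnj_complex_of_real complex_cnj_mult mult.commute)
        moreover have "d j = 1" using ij by (simp add: d_def)
        ultimately show ?thesis using ab ij by (auto simp: offdiag_def)
      qed
      finally show "(complex_of_real (cmod (w / z)) \<cdot>\<^sub>m (mat_diag n d * offdiag n z i j * ctrans (mat_diag n d))) $$ (a, b)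
        = offdiag n w i j $$ (a, b)" .
    qed (simp_all add: offdiag_def)
    finally show ?thesis .
  qed
  \<comment> \<open>Equal indices are related outright, since the torus contributes all real
    diagonal matrices.\<close>
  define R where "R i j \<longleftrightarrow> i < n \<and> j < n \<and> (i = j \<or> (\<exists>H\<in>L. H $$ (i, j) \<noteq> 0))" for i j
  have R_off: "offdiag n w i j \<in> L" if "R i j" "i \<noteq> j" for i j w
    using that component rotate unfolding R_def by metis
  have R_I: "R i j" if "H \<in> L" "i < n" "j < n" "H $$ (i, j) \<noteq> 0" for H i j
    using that unfolding R_def by blast
  have sym: "symp R"
  proof (rule sympI)
    fix i j assume "R i j"
    then show "R j i" unfolding R_def using cjH by (metis complex_cnj_zero_iff)
  qed
  \<comment> \<open>\<open>S^3 = S\<close> confines the eigenvalues to 0, 1, -1, where the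
    polynomial \<open>1 + i x - x^2\<close> agrees with \<open>exp (i pi/2 x)\<close>. The
    conjugating matrix thus lies in \<open>Gs\<close>, by \<open>exp\<close> at an imaginary
    time.\<close>
  have refl_conj: "(1\<^sub>m n + \<i> \<cdot>\<^sub>m S - S * S) * H * ctrans (1\<^sub>m n + \<i> \<cdot>\<^sub>m S - S * S) \<in> L"
    if S: "S \<in> L" "S * S * S = S" and H: "H \<in> L" for S H
  proof -
    obtain U l where U: "unitary n U" and Sl: "S = hdiag n U l"
      using hermitian_spectral[of S n] herm[OF S(1)] by metis
    have l: "l a = 0 \<or> l a = 1 \<or> l a = - 1" if "a < n" for a
    proof -
      have "complex_of_real (l a) * complex_of_real (l a) * complex_of_real (l a) = complex_of_real (l a)"
        using udiag_inj[OF U _ that] S(2) unfolding Sl udiag_mult[OF U] by blast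
      then have "l a * l a * l a = l a" by (simp only: of_real_mult[symmetric] of_real_eq_iff)
      then have "l a * (l a - 1) * (l a + 1) = 0" by (simp add: algebra_simps)
      then show ?thesis by auto
    qed
    define d where "d a = exp (\<i> * of_real pi / 2 * complex_of_real (l a))" for a
    have d: "d a = 1 + \<i> * complex_of_real (l a) - complex_of_real (l a) * complex_of_real (l a)" if "a < n" for a
    proof -
      have e: "exp (\<i> * of_real pi / 2) = \<i>" using cis_pi_half by (simp add: cis_conv_exp)
      then have "exp (- (\<i> * of_real pi / 2)) = - \<i>" by (simp add: exp_minus)
      with e l[OF that] show ?thesis by (auto simp: d_def)
    qed
    have W: "1\<^sub>m n + \<i> \<cdot>\<^sub>m S - S * S = udiag n U d"
      unfolding Sl udiag_smult udiag_mult[OF U] udiag_one[OF U, symmetric] udiag_add udiag_minus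
      by (rule udiag_cong) (simp add: d)
    have "cmod (d a) = 1" for a by (simp add: d_def norm_exp_eq_Re)
    then have "cnj (d a) * d a = 1" for a using complex_norm_square[of "d a"] by (simp add: mult.commute)
    then have "unitary n (udiag n U d)"
      by (intro unitaryI) (simp_all add: udiag_ctrans udiag_mult[OF U] udiag_one[OF U])
    moreover have "udiag n U d \<in> Gs"
      unfolding d_def by (rule exp[OF U]) (use S(1) Sl in simp)
    ultimately show ?thesis unfolding W by (rule conj[OF _ _ H])
  qed
  have trans: "transp R"
  proof (rule transpI)
    fix i j k assume R: "R i j" "R j k"
    show "R i k"
    proof (cases "i = j \<or> j = k \<or> i = k")
      case True
      then show ?thesis using R by (auto simp: R_def)
    next
      case False
      then have ijk: "i < n" "j < n" "k < n" "i \<noteq> j" "j \<noteq> k" "i \<noteq> k" using R by (auto simp: R_def)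
      define S where "S = offdiag n 1 i j"
      define T where "T = offdiag n 1 j k"
      have SL: "S \<in> L" and TL: "T \<in> L" unfolding S_def T_def using R_off R ijk by blast+
      have Sc: "S \<in> carrier_mat n n" and Tc: "T \<in> carrier_mat n n" by (simp_all add: S_def T_def)
      have SS: "S * S \<in> carrier_mat n n" by (rule mult_carrier_mat[OF Sc Sc])
      have S3: "S * S * S = S"
      proof (rule eq_matI)
        fix a b assume "a < dim_row S" "b < dim_col S"
        then have ab: "a < n" "b < n" using Sc by auto
        have SM: "(S * M) $$ (c, b) = (if c = i then M $$ (j, b) else if c = j then M $$ (i, b) else 0)"
          if "M \<in> carrier_mat n n" "c < n" for M c
          unfolding S_def by (rule offdiag_mult_index[OF that(1) ijk(4,1,2) that(2) ab(2)])
        have "(S * (S * S)) $$ (a, b) = S $$ (a, b)"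
          unfolding SM[OF SS ab(1)] SM[OF Sc ijk(1)] SM[OF Sc ijk(2)]
          using ijk ab by (auto simp: S_def offdiag_def)
        then show "(S * S * S) $$ (a, b) = S $$ (a, b)" unfolding assoc_mult_mat[OF Sc Sc Sc] .
      qed (use Sc in auto)
      define W where "W = 1\<^sub>m n + \<i> \<cdot>\<^sub>m S - S * S"
      have Wc: "W \<in> carrier_mat n n" unfolding W_def by (rule minus_carrier_mat[OF SS])
      have TW: "T * ctrans W \<in> carrier_mat n n" using Tc Wc by simp
      have "W * T * ctrans W \<in> L" unfolding W_def by (rule refl_conj[OF SL S3 TL])
      \<comment> \<open>The conjugation moves the entry of \<open>T\<close> at \<open>(j, k)\<close>
        to \<open>(i, k)\<close>; row and column \<open>k\<close> lie outside the pair swapped by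
        \<open>W\<close>.\<close>
      moreover have "(W * T * ctrans W) $$ (i, k) = \<i>"
      proof -
        have "(W * T * ctrans W) $$ (i, k) = (W * (T * ctrans W)) $$ (i, k)"
          using Tc Wc by (simp add: mult_square[where n = n])
        also have "\<dots> = \<i> * (T * ctrans W) $$ (j, k)"
          unfolding W_def S_def reflection_mult_index[OF TW[unfolded W_def S_def] ijk(4,1,2,1,3)] by simp
        also have "T * ctrans W = ctrans (W * ctrans T)"
          using ctrans_mult[OF Wc ctrans_carrier[OF Tc]] by simp
        also have "ctrans (W * ctrans T) $$ (j, k) = cnj ((W * ctrans T) $$ (k, j))"
          using Wc Tc ijk by (intro ctrans_index) auto
        also have "(W * ctrans T) $$ (k, j) = ctrans T $$ (k, j)"
          using reflection_mult_index[OF ctrans_carrier[OF Tc] ijk(4,1,2,3,2)] ijk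
          unfolding W_def S_def by simp
        also have "\<dots> = 1" using ijk by (simp add: T_def offdiag_def)
        finally show ?thesis by simp
      qed
      ultimately show ?thesis using R_I[of "W * T * ctrans W" i k] ijk by simp
    qed
  qed
  have "L = herm_pat n R"
  proof
    show "L \<subseteq> herm_pat n R"
      using herm R_I unfolding herm_pat_def by blast
    show "herm_pat n R \<subseteq> L"
    proof
      fix H assume H: "H \<in> herm_pat n R"
      then have Hc: "H \<in> carrier_mat n n" "ctrans H = H"
        and H0: "\<And>i j. i < n \<Longrightarrow> j < n \<Longrightarrow> \<not> R i j \<Longrightarrow> H $$ (i, j) = 0"
        by (auto simp: herm_pat_def)
      have cj: "H $$ (b, a) = cnj (H $$ (a, b))" if "a < n" "b < n" for a b
        using arg_cong[OF Hc(2), of "\<lambda>M. M $$ (b, a)"] that Hc(1) by simp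
      \<comment> \<open>The part of \<open>H\<close> on the diagonal and on the index pairs in
        \<open>P\<close>. The induction adds one pair of off-diagonal entries at a time.\<close>
      define K where "K P = mat n n (\<lambda>(a, b). if a = b \<or> (a, b) \<in> P \<or> (b, a) \<in> P then H $$ (a, b) else 0)" for P
      have KL: "K P \<in> L" if "finite P" "P \<subseteq> {(i, j). i < j \<and> j < n}" for P
        using that
      proof (induction P rule: finite_induct)
        case empty
        have "K {} = mat_diag n (\<lambda>a. complex_of_real (Re (H $$ (a, a))))"
        proof (rule eq_matI)
          fix a b assume "a < dim_row (mat_diag n (\<lambda>a. complex_of_real (Re (H $$ (a, a)))))"
            "b < dim_col (mat_diag n (\<lambda>a. complex_of_real (Re (H $$ (a, a)))))"
          then have ab: "a < n" "b < n" by auto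
          have "H $$ (a, a) = complex_of_real (Re (H $$ (a, a)))"
            using cj[OF ab(1,1)] by (simp add: complex_eq_iff)
          then show "K {} $$ (a, b) = mat_diag n (\<lambda>a. complex_of_real (Re (H $$ (a, a)))) $$ (a, b)"
            using ab by (auto simp: K_def mat_diag_def)
        qed (simp_all add: K_def)
        then show ?case using diag by simp
      next
        case (insert p P)
        obtain i j where p: "p = (i, j)" by (cases p)
        have ij: "i < j" "j < n" "i < n" "i \<noteq> j" using insert.prems p by auto
        have KP: "K P \<in> L" using insert by simp
        have "K (insert p P) = K P + offdiag n (H $$ (i, j)) i j"
        proof (rule eq_matI)
          fix a b assume "a < dim_row (K P + offdiag n (H $$ (i, j)) i j)" "b < dim_col (K P + offdiag n (H $$ (i, j)) i j)"
          then have ab: "a < n" "b < n" by (simp_all add: offdiag_def)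
          have "(j, i) \<notin> P" "(i, j) \<notin> P" using insert.prems insert.hyps ij p by auto
          then show "K (insert p P) $$ (a, b) = (K P + offdiag n (H $$ (i, j)) i j) $$ (a, b)"
            using ab ij cj[OF ij(3,2)] by (auto simp: K_def offdiag_def p)
        qed (simp_all add: K_def offdiag_def)
        moreover have "offdiag n (H $$ (i, j)) i j \<in> L"
        proof (cases "R i j")
          case True
          then show ?thesis using R_off ij by blast
        next
          case False
          then have "H $$ (i, j) = complex_of_real 0" using H0 ij by simp
          then have "offdiag n (H $$ (i, j)) i j = complex_of_real 0 \<cdot>\<^sub>m mat_diag n (\<lambda>a. complex_of_real 0)"
            by (intro eq_matI) (auto simp: offdiag_def mat_diag_def)
          then show ?thesis using scale[OF diag[of "\<lambda>_. 0"], of 0] by simp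
        qed
        ultimately show ?case using add[OF KP] by simp
      qed
      define P where "P = {(i, j). i < j \<and> j < n}"
      have "P \<subseteq> {..<n} \<times> {..<n}" by (auto simp: P_def)
      then have "finite P" by (rule finite_subset) simp
      moreover have "K P = H"
      proof (rule eq_matI)
        fix a b assume "a < dim_row H" "b < dim_col H"
        then show "K P $$ (a, b) = H $$ (a, b)" using Hc(1) by (auto simp: K_def P_def)
      qed (use Hc in \<open>auto simp: K_def\<close>)
      ultimately show "H \<in> L" using KL[of P] by (simp add: P_def)
    qed
  qed
  moreover have "R i j" if "i < n" "j < n" "i \<noteq> j" "z \<noteq> 0" "offdiag n z i j \<in> L" for i j z
    by (rule R_I[OF that(5,1,2)]) (use that in \<open>simp add: offdiag_def\<close>)
  ultimately show ?thesis
    using sym trans R_I by (intro that[of R]) (auto simp: R_def)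
qed

lemma udiag_zero: "udiag n U (\<lambda>_. 0) = 0\<^sub>m n n"
  by (rule eq_matI) auto

text \<open>Sign conjugations from the first torus leave \<open>H2\<close> fixed, so in the second
  component the combination of \<open>offdiag_sign_average\<close> has total coefficient
  \<open>1 - 1 - 1 + 1 = 0\<close>. This decouples the two factors.\<close>

lemma iLieK_component1:
  assumes G: "symmetric_subgroup2 m n G" and T: "diag_torus m \<times> {1\<^sub>m n} \<subseteq> G"
    and H: "(H1, H2) \<in> iLieK m n G" and ij: "i < m" "j < m" "i \<noteq> j"
  shows "(offdiag m (H1 $$ (i, j)) i j, 0\<^sub>m n n) \<in> iLieK m n G"
proof -
  note Hc = iLieK_carrier[OF H]
  have K: "(sign_conj m P H1, H2) \<in> iLieK m n G" for P
  proof -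
    let ?D = "mat_diag m (\<lambda>a. if a \<in> P then - 1 else 1 :: complex)"
    have "unitary m ?D" by (rule mat_diag_unitary) simp
    moreover have "?D \<in> diag_torus m" by (auto simp: diag_torus_def mat_diag_def)
    ultimately have "(?D * H1 * ctrans ?D, 1\<^sub>m n * H2 * ctrans (1\<^sub>m n)) \<in> iLieK m n G"
      using T by (intro iLieK_conj[OF G _ unitary_one _ H]) auto
    then show ?thesis using Hc by (simp add: sign_conj_def)
  qed
  define N where "N = complex_of_real (1 / 4) \<cdot>\<^sub>m (H2 + complex_of_real (- 1) \<cdot>\<^sub>m H2 +
      complex_of_real (- 1) \<cdot>\<^sub>m H2 + H2)"
  have "(offdiag m (H1 $$ (i, j)) i j, N) \<in> iLieK m n G"
    unfolding offdiag_sign_average[OF Hc(1,3) ij] N_def by (intro iLieK_add[OF G] iLieK_scale H K)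
  moreover have "N = 0\<^sub>m n n" using Hc(2) by (intro eq_matI) (auto simp: N_def)
  ultimately show ?thesis by simp
qed

text \<open>The Lie algebra splits as a product: the off-diagonal components of \<open>H1\<close>
  can be separated from \<open>H2\<close>, so \<open>(H1, 0)\<close> is tangent, and subtracting it
  leaves \<open>(0, H2)\<close>. Each factor is then treated by
  \<open>torus_invariant_pattern\<close>. The alternative in the conclusion records whether the
  second factor carries a torus or is trivial.\<close>

theorem iLieK_pattern:
  assumes G: "symmetric_subgroup2 m n G" and T1: "diag_torus m \<times> {1\<^sub>m n} \<subseteq> G"
    and T2: "{1\<^sub>m m} \<times> diag_torus n \<subseteq> G \<or> (\<forall>(X, Y)\<in>G. Y = 1\<^sub>m n)"
  obtains R1 R2 where "\<And>i. i < m \<Longrightarrow> R1 i i" "symp R1" "transp R1" "symp R2" "transp R2"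
    "(\<forall>j<n. R2 j j) \<or> (\<forall>i j. \<not> R2 i j)" "iLieK m n G = herm_pat m R1 \<times> herm_pat n R2"
proof -
  define L1 where "L1 = {H. (H, 0\<^sub>m n n) \<in> iLieK m n G}"
  have z: "udiag k (1\<^sub>m k) (\<lambda>a. complex_of_real 0) = 0\<^sub>m k k" for k by (simp add: udiag_zero)
  have o: "udiag k (1\<^sub>m k) (\<lambda>a. exp (z * complex_of_real 0)) = 1\<^sub>m k" for k z
    by (simp add: udiag_one unitary_one)
  obtain R1 where R1: "\<And>i. i < m \<Longrightarrow> R1 i i" "symp R1" "transp R1" "L1 = herm_pat m R1"
    "\<And>i j z. i < m \<Longrightarrow> j < m \<Longrightarrow> i \<noteq> j \<Longrightarrow> z \<noteq> 0 \<Longrightarrow> offdiag m z i j \<in> L1 \<Longrightarrow> R1 i j"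
  proof (rule torus_invariant_pattern[of L1 m "{X. (X, 1\<^sub>m n) \<in> G}"])
    show "H \<in> carrier_mat m m \<and> ctrans H = H" if "H \<in> L1" for H
      using that iLieK_carrier unfolding L1_def by blast
    show "H + H' \<in> L1" if "H \<in> L1" "H' \<in> L1" for H H'
      using iLieK_add[OF G, of H "0\<^sub>m n n" H' "0\<^sub>m n n"] that by (simp add: L1_def)
    show "complex_of_real c \<cdot>\<^sub>m H \<in> L1" if "H \<in> L1" for H c
      using iLieK_scale[of H "0\<^sub>m n n" m n G c] that by (simp add: L1_def)
    show "K * H * ctrans K \<in> L1" if "unitary m K" "K \<in> {X. (X, 1\<^sub>m n) \<in> G}" "H \<in> L1" for K H
      using iLieK_conj[OF G that(1) unitary_one, of H "0\<^sub>m n n"] that by (simp add: L1_def)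
    show "ediag m U z l \<in> {X. (X, 1\<^sub>m n) \<in> G}"
      if "unitary m U" "hdiag m U l \<in> L1" for U and l :: "nat \<Rightarrow> real" and z
      using iLieK_exp_complex[OF G that(1) unitary_one, of l "\<lambda>_. 0" z] that(2)
      unfolding L1_def z o by simp
    show "hdiag m U l \<in> L1"
      if "unitary m U" "\<And>t::real. ediag m U (complex_of_real t) l \<in> {X. (X, 1\<^sub>m n) \<in> G}"
      for U and l :: "nat \<Rightarrow> real"
      using iLieK_udiag_iff[OF that(1) unitary_one, of l n "\<lambda>_. 0" G] that(2)
      unfolding L1_def z o by simp
    show "diag_torus m \<subseteq> {X. (X, 1\<^sub>m n) \<in> G}" using T1 by auto
  qed blast
  have fst: "(H1, 0\<^sub>m n n) \<in> iLieK m n G" if H: "(H1, H2) \<in> iLieK m n G" for H1 H2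
  proof -
    have "R1 i j" if "i < m" "j < m" "H1 $$ (i, j) \<noteq> 0" for i j
    proof (cases "i = j")
      case True
      then show ?thesis using R1(1) that by simp
    next
      case False
      show ?thesis
        by (rule R1(5)[OF that(1,2) False that(3)])
          (use iLieK_component1[OF G T1 H that(1,2) False] in \<open>simp add: L1_def\<close>)
    qed
    then have "H1 \<in> herm_pat m R1" using iLieK_carrier[OF H] by (auto simp: herm_pat_def)
    then show ?thesis unfolding R1(4)[symmetric] by (simp add: L1_def)
  qed
  have snd: "(0\<^sub>m m m, H2) \<in> iLieK m n G" if H: "(H1, H2) \<in> iLieK m n G" for H1 H2
  proof -
    note c = iLieK_carrier[OF H]
    have "(H1 + complex_of_real (- 1) \<cdot>\<^sub>m H1, H2 + complex_of_real (- 1) \<cdot>\<^sub>m 0\<^sub>m n n) \<in> iLieK m n G"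
      by (intro iLieK_add[OF G H] iLieK_scale fst[OF H])
    moreover have "H1 + complex_of_real (- 1) \<cdot>\<^sub>m H1 = 0\<^sub>m m m"
      using c by (intro eq_matI) auto
    moreover have "H2 + complex_of_real (- 1) \<cdot>\<^sub>m 0\<^sub>m n n = H2" using c by (intro eq_matI) auto
    ultimately show ?thesis by simp
  qed
  define L2 where "L2 = {H. (0\<^sub>m m m, H) \<in> iLieK m n G}"
  have split: "iLieK m n G = L1 \<times> L2"
  proof (intro equalityI subsetI)
    fix p assume "p \<in> iLieK m n G"
    then show "p \<in> L1 \<times> L2" using fst snd by (cases p) (auto simp: L1_def L2_def)
  next
    fix p assume "p \<in> L1 \<times> L2"
    then obtain H1 H2 where p: "p = (H1, H2)" "(H1, 0\<^sub>m n n) \<in> iLieK m n G" "(0\<^sub>m m m, H2) \<in> iLieK m n G"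
      by (auto simp: L1_def L2_def)
    then show "p \<in> iLieK m n G"
      using iLieK_add[OF G p(2,3)] iLieK_carrier[OF p(2)] iLieK_carrier[OF p(3)] by simp
  qed
  from T2 show ?thesis
  proof
    assume T2: "{1\<^sub>m m} \<times> diag_torus n \<subseteq> G"
    obtain R2 where R2: "\<And>i. i < n \<Longrightarrow> R2 i i" "symp R2" "transp R2" "L2 = herm_pat n R2"
    proof (rule torus_invariant_pattern[of L2 n "{Y. (1\<^sub>m m, Y) \<in> G}"])
      show "H \<in> carrier_mat n n \<and> ctrans H = H" if "H \<in> L2" for H
        using that iLieK_carrier unfolding L2_def by blast
      show "H + H' \<in> L2" if "H \<in> L2" "H' \<in> L2" for H H'
        using iLieK_add[OF G, of "0\<^sub>m m m" H "0\<^sub>m m m" H'] that by (simp add: L2_def)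
      show "complex_of_real c \<cdot>\<^sub>m H \<in> L2" if "H \<in> L2" for H c
        using iLieK_scale[of "0\<^sub>m m m" H m n G c] that by (simp add: L2_def)
      show "K * H * ctrans K \<in> L2" if "unitary n K" "K \<in> {Y. (1\<^sub>m m, Y) \<in> G}" "H \<in> L2" for K H
        using iLieK_conj[OF G unitary_one that(1), of "0\<^sub>m m m" H] that by (simp add: L2_def)
      show "ediag n U z l \<in> {Y. (1\<^sub>m m, Y) \<in> G}"
        if "unitary n U" "hdiag n U l \<in> L2" for U and l :: "nat \<Rightarrow> real" and z
        using iLieK_exp_complex[OF G unitary_one that(1), of "\<lambda>_. 0" l z] that(2)
        unfolding L2_def z o by simp
      show "hdiag n U l \<in> L2"
        if "unitary n U" "\<And>t::real. ediag n U (complex_of_real t) l \<in> {Y. (1\<^sub>m m, Y) \<in> G}"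
        for U and l :: "nat \<Rightarrow> real"
        using iLieK_udiag_iff[OF unitary_one that(1), of m "\<lambda>_. 0" l G] that(2)
        unfolding L2_def z o by simp
      show "diag_torus n \<subseteq> {Y. (1\<^sub>m m, Y) \<in> G}" using T2 by auto
    qed blast
    show ?thesis
      by (rule that[OF R1(1-3) R2(2,3)]) (use R2(1) split R1(4) R2(4) in auto)
  next
    assume T2: "\<forall>(X, Y)\<in>G. Y = 1\<^sub>m n"
    \<comment> \<open>The second component of every element of \<open>G\<close> is the identity,
      hence all \<open>exp (r a)\<close> are 1.\<close>
    have "H = 0\<^sub>m n n" if H: "(0\<^sub>m m m, H) \<in> iLieK m n G" for H
    proof -
      obtain U l V r where UV: "unitary m U" "unitary n V"
        "0\<^sub>m m m = hdiag m U l" "H = hdiag n V r"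
        by (rule iLieK_spectral[OF H])
      have "(ediag m U 1 l, ediag n V 1 r) \<in> G"
        using H unfolding UV(3,4) by (rule iLieK_exp_complex[OF G UV(1,2)])
      then have "ediag n V 1 r = udiag n V (\<lambda>_. 1)"
        using T2 udiag_one[OF UV(2)] by auto
      from udiag_inj[OF UV(2) this] have "complex_of_real (exp (r a)) = complex_of_real 1" if "a < n" for a
        using that by (simp add: exp_of_real)
      then have "r a = 0" if "a < n" for a using that by (simp only: of_real_eq_iff exp_eq_one_iff)
      then have "H = udiag n V (\<lambda>_. 0)" unfolding UV(4) by (intro udiag_cong) simp
      then show ?thesis by (simp add: udiag_zero)
    qed
    moreover have "(0\<^sub>m m m, 0\<^sub>m n n) \<in> iLieK m n G"
    proof -
      have "0\<^sub>m m m \<in> L1" unfolding R1(4) by (rule zero_herm_pat)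
      then show ?thesis by (simp add: L1_def)
    qed
    ultimately have "L2 = {0\<^sub>m n n}" unfolding L2_def by blast
    then have "L2 = herm_pat n (\<lambda>_ _. False)" unfolding herm_pat_empty .
    then show ?thesis
      by (intro that[of R1 "\<lambda>_ _. False"] R1(1-3)) (use split R1(4) in \<open>auto intro: sympI transpI\<close>)
  qed
qed

lemma herm_pat_fun:
  fixes l :: "nat \<Rightarrow> real" and f :: "real \<Rightarrow> real"
  assumes R: "\<And>i. i < n \<Longrightarrow> R i i" "symp R" "transp R"
    and U: "unitary n U" and H: "hdiag n U l \<in> herm_pat n R"
  shows "hdiag n U (\<lambda>a. f (l a)) \<in> herm_pat n R"
proof -
  text \<open>A Hermitian matrix respects the pattern iff it commutes with the diagonal matrix \<open>D\<close> of class labels.\<close>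
  define q where "q i = (LEAST j. R i j)" for i
  have q_eq: "q i = q j" if "R i j" for i j
  proof -
    have "R i k \<longleftrightarrow> R j k" for k using that R(2,3) by (meson sympD transpD)
    then show ?thesis by (simp add: q_def)
  qed
  have q_neq: "R i j" if "i < n" "j < n" "q i = q j" for i j
  proof -
    have "R i (q i)" "R j (q j)" unfolding q_def using R(1) that by (auto intro: LeastI)
    then show ?thesis using that(3) R(2,3) by (metis sympD transpD)
  qed
  define D where "D = mat_diag n (\<lambda>a. of_nat (q a) :: complex)"
  define HH where "HH = hdiag n U l"
  define F where "F = hdiag n U (\<lambda>a. f (l a))"
  define lm where "lm = mat_diag n (\<lambda>a. complex_of_real (l a))"
  define fm where "fm = mat_diag n (\<lambda>a. complex_of_real (f (l a)))"
  note UD = unitaryD[OF U]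
  have c: "D \<in> carrier_mat n n" "HH \<in> carrier_mat n n" "F \<in> carrier_mat n n"
    "lm \<in> carrier_mat n n" "fm \<in> carrier_mat n n"
    by (simp_all add: D_def HH_def F_def lm_def fm_def)
  note mm = mult_square[where n = n]
  have comm: "HH * D = D * HH"
  proof (rule eq_matI)
    fix i j assume "i < dim_row (D * HH)" "j < dim_col (D * HH)"
    then have ij: "i < n" "j < n" using c by auto
    have "HH $$ (i, j) * of_nat (q j) = of_nat (q i) * HH $$ (i, j)"
    proof (cases "R i j")
      case True
      then show ?thesis using q_eq by simp
    next
      case False
      then show ?thesis using H ij unfolding herm_pat_def HH_def by simp
    qed
    then show "(HH * D) $$ (i, j) = (D * HH) $$ (i, j)"
      unfolding D_def mat_diag_mult_right[OF c(2)] mat_diag_mult_left[OF c(2)] using ij by simp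
  qed (use c in auto)
  define K where "K = ctrans U * D * U"
  have K: "K \<in> carrier_mat n n" unfolding K_def using UD(1,2) c by (simp add: mm)
  have HU: "ctrans U * HH = lm * ctrans U"
  proof -
    have "ctrans U * HH = ctrans U * U * (lm * ctrans U)"
      using UD(1,2) c by (simp add: HH_def udiag_eq mm lm_def[symmetric])
    also have "\<dots> = lm * ctrans U" unfolding UD(3)
      using UD(2) c by (simp add: left_mult_one_mat[of _ n n] mm)
    finally show ?thesis .
  qed
  have HU': "HH * U = U * lm"
  proof -
    have "HH * U = U * lm * (ctrans U * U)"
      using UD(1,2) c by (simp add: HH_def udiag_eq mm lm_def[symmetric])
    also have "\<dots> = U * lm" unfolding UD(3)
      using UD(1) c by (simp add: right_mult_one_mat[of _ n n] mm)
    finally show ?thesis .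
  qed
  have lK: "lm * K = K * lm"
  proof -
    have "lm * K = (lm * ctrans U) * D * U" unfolding K_def using UD(1,2) c by (simp add: mm)
    also have "\<dots> = ctrans U * (HH * D) * U" unfolding HU[symmetric] using UD(1,2) c by (simp add: mm)
    also have "\<dots> = ctrans U * D * (HH * U)" unfolding comm using UD(1,2) c by (simp add: mm)
    also have "\<dots> = K * lm" unfolding HU' K_def using UD(1,2) c by (simp add: mm)
    finally show ?thesis .
  qed
  have fK: "fm * K = K * fm"
  proof (rule eq_matI)
    fix a b assume "a < dim_row (K * fm)" "b < dim_col (K * fm)"
    then have ab: "a < n" "b < n" using c K by auto
    have "(lm * K) $$ (a, b) = (K * lm) $$ (a, b)" using lK by simp
    then have "complex_of_real (l a) * K $$ (a, b) = K $$ (a, b) * complex_of_real (l b)"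
      unfolding lm_def mat_diag_mult_right[OF K] mat_diag_mult_left[OF K] using ab by simp
    \<comment> \<open>In the eigenbasis, commuting with the diagonal matrix of the
      \<open>l a\<close> means vanishing wherever two eigenvalues differ; this condition passes from
      \<open>l\<close> to \<open>f\<close> composed with \<open>l\<close>.\<close>
    then have "l a = l b \<or> K $$ (a, b) = 0" by (auto simp: mult.commute)
    then show "(fm * K) $$ (a, b) = (K * fm) $$ (a, b)"
      unfolding fm_def mat_diag_mult_right[OF K] mat_diag_mult_left[OF K] using ab by auto
  qed (use c K in auto)
  have DU: "ctrans U * D = K * ctrans U" "D * U = U * K"
  proof -
    have "K * ctrans U = ctrans U * D * (U * ctrans U)" unfolding K_def using UD(1,2) c by (simp add: mm)
    then show "ctrans U * D = K * ctrans U" unfolding UD(4)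
      using UD(2) c by (simp add: right_mult_one_mat[of _ n n] mm)
    have "U * K = (U * ctrans U) * (D * U)" unfolding K_def using UD(1,2) c by (simp add: mm)
    then show "D * U = U * K" unfolding UD(4)
      using UD(1) c by (simp add: left_mult_one_mat[of _ n n] mm)
  qed
  have Fe: "F = U * fm * ctrans U" using UD by (simp add: F_def udiag_eq fm_def)
  have "F * D = U * fm * (ctrans U * D)" unfolding Fe using UD(1,2) c by (simp add: mm)
  also have "\<dots> = U * (fm * K) * ctrans U" unfolding DU(1) using UD(1,2) c K by (simp add: mm)
  also have "\<dots> = (U * K) * fm * ctrans U" unfolding fK using UD(1,2) c K by (simp add: mm)
  also have "\<dots> = D * F" unfolding DU(2)[symmetric] Fe using UD(1,2) c by (simp add: mm)
  finally have FD: "F * D = D * F" .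
  have "F $$ (i, j) = 0" if ij: "i < n" "j < n" "\<not> R i j" for i j
  proof -
    have "(F * D) $$ (i, j) = (D * F) $$ (i, j)" using FD by simp
    then have "F $$ (i, j) * of_nat (q j) = of_nat (q i) * F $$ (i, j)"
      unfolding D_def mat_diag_mult_right[OF c(3)] mat_diag_mult_left[OF c(3)] using ij by simp
    moreover have "q i \<noteq> q j" using q_neq ij by blast
    ultimately show ?thesis by (auto simp: mult.commute)
  qed
  then show ?thesis by (simp add: herm_pat_def F_def[symmetric] c(3)) (simp add: F_def udiag_ctrans)
qed

section \<open>Polar decomposition within the group\<close>

lemma gram_spectral:
  assumes X: "X \<in> GL n"
  obtains U l where "unitary n U"
    "ctrans X * X = ediag n U 2 l"
proof -
  note Xc = GL_minv[OF X]
  have P: "ctrans X * X \<in> carrier_mat n n" by (rule mult_carrier_mat[OF ctrans_carrier[OF Xc(1)] Xc(1)])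
  have "ctrans (ctrans X * X) = ctrans X * X"
    using ctrans_mult[OF ctrans_carrier[OF Xc(1)] Xc(1)] by simp
  then obtain U d where U: "unitary n U" and d: "ctrans X * X = hdiag n U d"
    using hermitian_spectral[OF P] by metis
  note UD = unitaryD[OF U]
  have XU: "X * U \<in> carrier_mat n n" by (rule mult_carrier_mat[OF Xc(1) UD(1)])
  \<comment> \<open>The eigenvalue is the squared length of a column of the invertible matrix
    \<open>X * U\<close>.\<close>
  have d_pos: "d a > 0" if a: "a < n" for a
  proof -
    have "ctrans (X * U) * (X * U) = ctrans U * (ctrans X * X) * U"
      using Xc(1) UD(1) by (simp add: ctrans_mult mult_square[where n = n])
    also have "\<dots> = mat_diag n (\<lambda>a. complex_of_real (d a))" unfolding d by (rule udiag_conj_diag[OF U])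
    finally have "complex_of_real (d a) = (ctrans (X * U) * (X * U)) $$ (a, a)"
      using a by (simp add: mat_diag_def)
    also have "\<dots> = (\<Sum>c<n. ctrans (X * U) $$ (a, c) * (X * U) $$ (c, a))"
      by (rule index_mult_mat_sum[OF ctrans_carrier[OF XU] XU a a])
    also have "\<dots> = (\<Sum>c<n. complex_of_real ((cmod ((X * U) $$ (c, a)))\<^sup>2))"
    proof (intro sum.cong refl)
      fix c assume "c \<in> {..<n}"
      then have "ctrans (X * U) $$ (a, c) = cnj ((X * U) $$ (c, a))" using a XU by (intro ctrans_index) auto
      then show "ctrans (X * U) $$ (a, c) * (X * U) $$ (c, a) = complex_of_real ((cmod ((X * U) $$ (c, a)))\<^sup>2)"
        by (simp only: complex_norm_square mult.commute)
    qed
    finally have da: "d a = (\<Sum>c<n. (cmod ((X * U) $$ (c, a)))\<^sup>2)"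
      by (simp only: of_real_sum[symmetric] of_real_eq_iff)
    have "d a \<noteq> 0"
    proof
      assume "d a = 0"
      then have z: "(X * U) $$ (c, a) = 0" if "c < n" for c
        using that unfolding da by (simp add: sum_nonneg_eq_0_iff del: index_mult_mat)
      have "ctrans U * minv X * (X * U) = 1\<^sub>m n"
        by (rule inverse_pair_mult[OF UD(2,1) Xc(2,1) UD(3) Xc(4)])
      then have "1 = (ctrans U * minv X * (X * U)) $$ (a, a)" using a by simp
      also have "\<dots> = (\<Sum>c<n. (ctrans U * minv X) $$ (a, c) * (X * U) $$ (c, a))"
        by (rule index_mult_mat_sum[OF mult_carrier_mat[OF UD(2) Xc(2)] XU a a])
      also have "\<dots> = 0" using z by (intro sum.neutral) (simp del: index_mult_mat)
      finally show False by simp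
    qed
    moreover have "d a \<ge> 0" unfolding da by (intro sum_nonneg) simp
    ultimately show ?thesis by simp
  qed
  \<comment> \<open>Halving the logarithm makes \<open>exp\<close> of \<open>l\<close> the positive
    factor in the polar decomposition of \<open>X\<close>.\<close>
  have "ctrans X * X = udiag n U (\<lambda>a. exp (2 * complex_of_real (ln (d a) / 2)))"
    unfolding d
  proof (rule udiag_cong)
    fix a assume "a < n"
    then show "complex_of_real (d a) = exp (2 * complex_of_real (ln (d a) / 2))"
      using d_pos[of a] by (simp add: exp_of_real)
  qed
  then show ?thesis by (rule that[OF U])
qed

text \<open>\<open>G\<close> is closed under conjugate transposition, so it contains the Gram pair
  and all its natural powers. Equations of \<open>G\<close> that hold at natural powers hold at all
  real ones, so the logarithm of the Gram pair is tangent to \<open>G\<close>.\<close>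

lemma iLieK_polar:
  assumes G: "symmetric_subgroup2 m n G" and XY: "(X, Y) \<in> G"
  obtains U l V r where "unitary m U" "unitary n V"
    "ctrans X * X = ediag m U 2 l"
    "ctrans Y * Y = ediag n V 2 r"
    "(hdiag m U l, hdiag n V r) \<in> iLieK m n G"
proof -
  have gl: "X \<in> GL m" "Y \<in> GL n" using symmetric_subgroup2D(1)[OF G XY] by auto
  obtain U l where U: "unitary m U" "ctrans X * X = ediag m U 2 l"
    by (rule gram_spectral[OF gl(1)])
  obtain V r where V: "unitary n V" "ctrans Y * Y = ediag n V 2 r"
    by (rule gram_spectral[OF gl(2)])
  have P: "(ctrans X * X, ctrans Y * Y) \<in> G"
    using symmetric_subgroup2D(3)[OF G symmetric_subgroup2D(5)[OF G XY] XY] .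
  have all: "(udiag m U (\<lambda>a. exp (z * complex_of_real (2 * l a))),
        udiag n V (\<lambda>a. exp (z * complex_of_real (2 * r a)))) \<in> G" for z
  proof (rule symmetric_subgroup2_exp[OF G U(1) V(1)])
    fix k :: nat
    show "(udiag m U (\<lambda>a. exp (of_nat k * complex_of_real (2 * l a))),
        udiag n V (\<lambda>a. exp (of_nat k * complex_of_real (2 * r a)))) \<in> G"
      using symmetric_subgroup2_pow[OF G P, of k]
      unfolding U(2) V(2) udiag_pow[OF U(1)] udiag_pow[OF V(1)] exp_of_nat_mult[symmetric] by simp
  qed
  have "(ediag m U (complex_of_real t) l,
        ediag n V (complex_of_real t) r) \<in> G" for t :: real
    using all[of "complex_of_real (t / 2)"] by simp
  then have "(hdiag m U l, hdiag n V r) \<in> iLieK m n G"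
    unfolding iLieK_udiag_iff[OF U(1) V(1)] by blast
  then show ?thesis by (rule that[OF U(1) V(1) U(2) V(2)])
qed

section \<open>Embedding of case (ii)\<close>

lemma polyfun_rename: "p \<in> polyfun \<Longrightarrow> (\<lambda>x. p (\<lambda>v. x (f v))) \<in> polyfun"
  by (induction p rule: polyfun.induct) (auto intro: polyfun.intros)

text \<open>The defining equations are those of \<open>G\<close> in the variables of the first
  block, flagged by \<open>False\<close>, together with linear equations that fix the second block
  to the identity.\<close>

lemma symmetric_subgroup2_embed1:
  assumes "symmetric_subgroup1 m G"
  shows "symmetric_subgroup2 m n (embed1 n G)"
proof -
  have G: "G \<subseteq> GL m" "1\<^sub>m m \<in> G" "\<forall>X\<in>G. \<forall>Y\<in>G. X * Y \<in> G" "\<forall>X\<in>G. minv X \<in> G"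
    "zariski_closed_in mat_coords (GL m) G" "\<forall>X\<in>G. ctrans X \<in> G"
    using assms by (auto simp: symmetric_subgroup1_def)
  obtain P where P: "P \<subseteq> polyfun" "G = {x \<in> GL m. \<forall>p\<in>P. p (mat_coords x) = 0}"
    using G(5) unfolding zariski_closed_in_def by blast
  define Q :: "((bool \<times> nat \<times> nat \<Rightarrow> complex) \<Rightarrow> complex) set" where
    "Q = (\<lambda>p x. p (\<lambda>v. x (False, v))) ` P \<union>
         (\<lambda>(i, j) x. x (True, i, j) + (if i = j then - 1 else 0)) ` ({..<n} \<times> {..<n})"
  have "Q \<subseteq> polyfun"
  proof
    fix p assume "p \<in> Q"
    then consider p' where "p' \<in> P" "p = (\<lambda>x. p' (\<lambda>v. x (False, v)))"
      | i j where "p = (\<lambda>x. x (True, i, j) + (if i = j then - 1 else 0))"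
      by (auto simp: Q_def)
    then show "p \<in> polyfun"
    proof cases
      case 1
      then show ?thesis using P(1) polyfun_rename[of p' "\<lambda>v. (False, v)"] by auto
    next
      case 2
      show ?thesis unfolding 2 by (intro polyfun.intros)
    qed
  qed
  moreover have "embed1 n G = {x \<in> GL2 m n. \<forall>p\<in>Q. p (pair_coords x) = 0}"
  proof (intro equalityI subsetI)
    fix x assume "x \<in> embed1 n G"
    then obtain X where X: "x = (X, 1\<^sub>m n)" "X \<in> G" by (auto simp: embed1_def)
    have "(\<lambda>v. pair_coords x (False, v)) = mat_coords X" by (simp add: X pair_coords_def)
    moreover have "pair_coords x (True, i, j) + (if i = j then - 1 else 0) = 0" if "i < n" "j < n" for i j
      using that by (simp add: X pair_coords_def mat_coords_def)
    ultimately show "x \<in> {x \<in> GL2 m n. \<forall>p\<in>Q. p (pair_coords x) = 0}"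
      using X G(1) P(2) GL_one by (auto simp: Q_def GL2_def)
  next
    fix x assume "x \<in> {x \<in> GL2 m n. \<forall>p\<in>Q. p (pair_coords x) = 0}"
    then obtain X Y where x: "x = (X, Y)" "X \<in> GL m" "Y \<in> GL n"
      and Q0: "\<And>p. p \<in> Q \<Longrightarrow> p (pair_coords (X, Y)) = 0"
      by (auto simp: GL2_def)
    have Yc: "Y \<in> carrier_mat n n" using GL_minv(1)[OF x(3)] .
    have "Y = 1\<^sub>m n"
    proof (rule eq_matI)
      fix i j assume "i < dim_row (1\<^sub>m n)" "j < dim_col (1\<^sub>m n)"
      then have ij: "i < n" "j < n" by auto
      then have "(\<lambda>x. x (True, i, j) + (if i = j then - 1 else 0)) \<in> Q"
        unfolding Q_def by (intro UnI2 image_eqI[where x = "(i, j)"]) auto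
      from Q0[OF this] show "Y $$ (i, j) = 1\<^sub>m n $$ (i, j)"
        using ij Yc by (auto simp: pair_coords_def mat_coords_def split: if_splits)
    qed (use Yc in auto)
    moreover have "p (mat_coords X) = 0" if "p \<in> P" for p
      using Q0[of "\<lambda>x. p (\<lambda>v. x (False, v))"] that by (auto simp: Q_def pair_coords_def)
    ultimately show "x \<in> embed1 n G" using x P(2) by (auto simp: embed1_def)
  qed
  ultimately have "zariski_closed_in pair_coords (GL2 m n) (embed1 n G)"
    unfolding zariski_closed_in_def by blast
  moreover have "embed1 n G \<subseteq> GL2 m n" using G(1) GL_one by (auto simp: embed1_def GL2_def)
  moreover have "(1\<^sub>m m, 1\<^sub>m n) \<in> embed1 n G" using G(2) by (auto simp: embed1_def)
  moreover have "\<forall>(X, Y)\<in>embed1 n G. \<forall>(X', Y')\<in>embed1 n G. (X * X', Y * Y') \<in> embed1 n G"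
    using G(3) by (auto simp: embed1_def)
  moreover have "\<forall>(X, Y)\<in>embed1 n G. (minv X, minv Y) \<in> embed1 n G"
    using G(4) by (auto simp: embed1_def)
  moreover have "\<forall>(X, Y)\<in>embed1 n G. (ctrans X, ctrans Y) \<in> embed1 n G"
    using G(6) by (auto simp: embed1_def)
  ultimately show ?thesis unfolding symmetric_subgroup2_def by (intro conjI)
qed

subsection \<open>The inner product on pairs\<close>

definition pnorm :: "complex mat \<times> complex mat \<Rightarrow> real" where
  "pnorm P = sqrt (fsq (fst P) + fsq (snd P))"

lemma mtrace_gram:
  assumes "A \<in> carrier_mat n n" "B \<in> carrier_mat n n"
  shows "mtrace (ctrans A * B) = (\<Sum>i<n. \<Sum>j<n. cnj (A $$ (i, j)) * B $$ (i, j))"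
proof -
  have "mtrace (ctrans A * B) = (\<Sum>j<n. \<Sum>i<n. cnj (A $$ (i, j)) * B $$ (i, j))"
    unfolding mtrace_def using assms
    by (simp add: index_mult_mat_sum[OF ctrans_carrier[OF assms(1)] assms(2)] del: index_mult_mat(1))
  also have "\<dots> = (\<Sum>i<n. \<Sum>j<n. cnj (A $$ (i, j)) * B $$ (i, j))" by (rule sum.swap)
  finally show ?thesis .
qed

lemma mtrace_commute:
  assumes "A \<in> carrier_mat m n" "B \<in> carrier_mat n m"
  shows "mtrace (A * B) = mtrace (B * A)"
proof -
  have "mtrace (A * B) = (\<Sum>i<m. \<Sum>j<n. A $$ (i, j) * B $$ (j, i))"
    unfolding mtrace_def using assms by (simp add: index_mult_mat_sum[OF assms] del: index_mult_mat(1))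
  also have "\<dots> = (\<Sum>j<n. \<Sum>i<m. B $$ (j, i) * A $$ (i, j))"
    by (subst sum.swap) (simp add: mult.commute)
  also have "\<dots> = mtrace (B * A)"
    unfolding mtrace_def using assms by (simp add: index_mult_mat_sum[OF assms(2,1)] del: index_mult_mat(1))
  finally show ?thesis .
qed

lemma pair_inner_self: "pair_inner P P = fsq (fst P) + fsq (snd P)"
  by (simp add: pair_inner_def fsq_trace[symmetric])

lemma mtrace_frob_le:
  assumes "A \<in> carrier_mat n n" "B \<in> carrier_mat n n"
  shows "\<bar>Re (mtrace (ctrans A * B))\<bar> \<le> frob A * frob B"
proof -
  have "\<bar>Re (mtrace (ctrans A * B))\<bar> \<le> cmod (mtrace (ctrans A * B))" by (rule abs_Re_le_cmod)
  also have "\<dots> \<le> (\<Sum>i<n. \<Sum>j<n. cmod (A $$ (i, j)) * cmod (B $$ (i, j)))"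
    unfolding mtrace_gram[OF assms] by (intro sum_norm_le) (simp add: norm_mult)
  also have "\<dots> = (\<Sum>p\<in>{..<n} \<times> {..<n}. \<bar>cmod (A $$ p)\<bar> * \<bar>cmod (B $$ p)\<bar>)"
    by (simp add: sum.cartesian_product case_prod_unfold)
  also have "\<dots> \<le> frob A * frob B"
    unfolding frob_L2_set[OF assms(1)] frob_L2_set[OF assms(2)] by (rule L2_set_mult_ineq)
  finally show ?thesis .
qed

lemma pair_inner_le:
  assumes "P \<in> carrier_mat m m \<times> carrier_mat n n" "Q \<in> carrier_mat m m \<times> carrier_mat n n"
  shows "\<bar>pair_inner P Q\<bar> \<le> pnorm P * pnorm Q"
proof -
  have c: "fst P \<in> carrier_mat m m" "snd P \<in> carrier_mat n n"
    "fst Q \<in> carrier_mat m m" "snd Q \<in> carrier_mat n n" using assms by auto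
  have "\<bar>pair_inner P Q\<bar> \<le> frob (fst P) * frob (fst Q) + frob (snd P) * frob (snd Q)"
    using mtrace_frob_le[OF c(1,3)] mtrace_frob_le[OF c(2,4)] by (simp add: pair_inner_def)
  also have "\<dots> = (\<Sum>b\<in>{True, False}. \<bar>if b then frob (fst P) else frob (snd P)\<bar> * \<bar>if b then frob (fst Q) else frob (snd Q)\<bar>)"
    by simp
  also have "\<dots> \<le> L2_set (\<lambda>b. if b then frob (fst P) else frob (snd P)) {True, False} *
      L2_set (\<lambda>b. if b then frob (fst Q) else frob (snd Q)) {True, False}"
    by (rule L2_set_mult_ineq)
  also have "\<dots> = pnorm P * pnorm Q"
    by (simp add: L2_set_def pnorm_def frob_sq)
  finally show ?thesis .
qed

lemma pair_inner_minus_left: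
  assumes "A1 \<in> carrier_mat m m" "A2 \<in> carrier_mat n n" "B1 \<in> carrier_mat m m" "B2 \<in> carrier_mat n n"
    "C1 \<in> carrier_mat m m" "C2 \<in> carrier_mat n n"
  shows "pair_inner (A1 - B1, A2 - B2) (C1, C2) = pair_inner (A1, A2) (C1, C2) - pair_inner (B1, B2) (C1, C2)"
proof -
  have *: "mtrace (ctrans (A - B) * C) = mtrace (ctrans A * C) - mtrace (ctrans B * C)"
    if "A \<in> carrier_mat k k" "B \<in> carrier_mat k k" "C \<in> carrier_mat k k" for A B C :: "complex mat" and k
  proof -
    have d: "A - B \<in> carrier_mat k k" by (rule minus_carrier_mat[OF that(2)])
    show ?thesis
      unfolding mtrace_gram[OF d that(3)] mtrace_gram[OF that(1,3)] mtrace_gram[OF that(2,3)]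
        sum_subtractf[symmetric]
      using that by (intro sum.cong refl) (simp add: algebra_simps)
  qed
  show ?thesis
    unfolding pair_inner_def using *[of A1 m B1 C1] *[of A2 n B2 C2] assms by simp
qed

text \<open>For symmetric \<open>R\<close>, the orthogonal projection of Hermitian matrices onto
  \<open>herm_pat n R\<close>.\<close>

definition pattern_proj :: "nat \<Rightarrow> (nat \<Rightarrow> nat \<Rightarrow> bool) \<Rightarrow> complex mat \<Rightarrow> complex mat" where
  "pattern_proj n R A = mat n n (\<lambda>(i, j). if R i j then A $$ (i, j) else 0)"

lemma pattern_proj_carrier [simp]: "pattern_proj n R A \<in> carrier_mat n n"
  by (simp add: pattern_proj_def)

lemma pattern_proj_herm_pat:
  assumes "symp R" "A \<in> carrier_mat n n" "ctrans A = A"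
  shows "pattern_proj n R A \<in> herm_pat n R"
proof -
  have "ctrans (pattern_proj n R A) = pattern_proj n R A"
  proof (rule eq_matI)
    fix i j assume "i < dim_row (pattern_proj n R A)" "j < dim_col (pattern_proj n R A)"
    then have ij: "i < n" "j < n" by (simp_all add: pattern_proj_def)
    have "A $$ (i, j) = ctrans A $$ (i, j)" unfolding assms(3) ..
    also have "\<dots> = cnj (A $$ (j, i))" using ij assms(2) by (intro ctrans_index) auto
    finally have "A $$ (i, j) = cnj (A $$ (j, i))" .
    then show "ctrans (pattern_proj n R A) $$ (i, j) = pattern_proj n R A $$ (i, j)"
      using ij sympD[OF assms(1)] by (auto simp: pattern_proj_def)
  qed (simp_all add: pattern_proj_def)
  then show ?thesis by (simp add: herm_pat_def) (simp add: pattern_proj_def)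
qed

lemma pattern_proj_inner:
  assumes "A \<in> carrier_mat n n" "H \<in> herm_pat n R"
  shows "mtrace (ctrans (pattern_proj n R A) * H) = mtrace (ctrans A * H)"
proof -
  have H: "H \<in> carrier_mat n n" "\<And>i j. i < n \<Longrightarrow> j < n \<Longrightarrow> \<not> R i j \<Longrightarrow> H $$ (i, j) = 0"
    using assms(2) by (auto simp: herm_pat_def)
  show ?thesis
    unfolding mtrace_gram[OF pattern_proj_carrier H(1)] mtrace_gram[OF assms(1) H(1)]
    by (intro sum.cong refl) (use H(2) in \<open>auto simp: pattern_proj_def\<close>)
qed

lemma fsq_udiag:
  assumes "unitary n U"
  shows "fsq (udiag n U d) = (\<Sum>i<n. (cmod (d i))\<^sup>2)"
proof -
  have "complex_of_real (fsq (udiag n U d)) = mtrace (udiag n U (\<lambda>a. complex_of_real ((cmod (d a))\<^sup>2)))"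
    unfolding fsq_trace udiag_ctrans udiag_mult[OF assms]
    by (simp only: complex_norm_square mult.commute)
  also have "\<dots> = mtrace (mat_diag n (\<lambda>a. complex_of_real ((cmod (d a))\<^sup>2)))"
  proof -
    note U = unitaryD[OF assms]
    let ?M = "mat_diag n (\<lambda>a. complex_of_real ((cmod (d a))\<^sup>2))"
    have "mtrace (U * ?M * ctrans U) = mtrace (ctrans U * (U * ?M))"
      by (rule mtrace_commute[OF mult_carrier_mat[OF U(1) mat_diag_carrier] U(2)])
    also have "ctrans U * (U * ?M) = (ctrans U * U) * ?M"
      using U(1,2) by (simp add: mult_square[where n = n])
    also have "\<dots> = ?M" unfolding U(3) by (simp add: left_mult_one_mat[of _ n n])
    finally show ?thesis by (simp add: udiag_eq[OF U(1)])
  qed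
  also have "\<dots> = complex_of_real (\<Sum>i<n. (cmod (d i))\<^sup>2)"
    by (simp add: mtrace_def mat_diag_def)
  finally show ?thesis by (simp only: of_real_eq_iff)
qed

subsection \<open>The gradient of the logarithmic condition number\<close>

text \<open>The diagonal entries of \<open>ctrans U * B * ctrans B * U\<close> are squared row norms
  of \<open>ctrans U * B\<close>, which any unitary \<open>V\<close> on the right preserves.
  Inserting \<open>V\<close> lets the left and the right factor share the same weights.\<close>

lemma mtrace_gram_udiag:
  assumes U: "unitary m U" and V: "unitary n V" and B: "B \<in> carrier_mat m n"
  shows "mtrace (B * ctrans B * udiag m U d) =
    (\<Sum>i<m. \<Sum>j<n. complex_of_real ((cmod ((ctrans U * B * V) $$ (i, j)))\<^sup>2) * d i)"
proof -
  note UD = unitaryD[OF U] and VD = unitaryD[OF V]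
  have UB: "ctrans U * B \<in> carrier_mat m n" by (rule mult_carrier_mat[OF UD(2) B])
  define C where "C = ctrans U * B * V"
  have C: "C \<in> carrier_mat m n" unfolding C_def by (rule mult_carrier_mat[OF UB VD(1)])
  have cC: "ctrans C = ctrans V * ctrans B * U"
    unfolding C_def ctrans_mult[OF UB VD(1)] ctrans_mult[OF UD(2) B]
    using UD(1) VD(2) B by (simp add: mult_rect[where m = m and n = n])
  have cB: "ctrans B \<in> carrier_mat n m" using B by simp
  have BB: "B * ctrans B \<in> carrier_mat m m" by (rule mult_carrier_mat[OF B cB])
  have CC: "C * ctrans C = ctrans U * (B * ctrans B) * U"
  proof -
    have "C * ctrans C = ctrans U * B * (V * ctrans V) * ctrans B * U"
      unfolding cC unfolding C_def using UD(1,2) VD(1,2) B cB UB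
      by (simp add: mult_rect[where m = m and n = n] mult_square[where n = m])
    also have "\<dots> = ctrans U * B * ctrans B * U" unfolding VD(4) using UB by (simp add: right_mult_one_mat[of _ m n])
    also have "\<dots> = ctrans U * (B * ctrans B) * U"
      using UD(2) B cB by (simp add: mult_rect[where m = m and n = n])
    finally show ?thesis .
  qed
  have "mtrace (B * ctrans B * udiag m U d) = mtrace (B * ctrans B * U * mat_diag m d * ctrans U)"
    using UD(1,2) BB by (simp add: udiag_eq mult_square[where n = m])
  also have "\<dots> = mtrace (ctrans U * (B * ctrans B * U * mat_diag m d))"
    using UD(1,2) BB by (intro mtrace_commute[of _ m m]) (simp_all add: mult_square[where n = m])
  also have "ctrans U * (B * ctrans B * U * mat_diag m d) = C * ctrans C * mat_diag m d"
    unfolding CC using UD(1,2) BB by (simp add: mult_square[where n = m])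
  also have "mtrace \<dots> = (\<Sum>i<m. (C * ctrans C) $$ (i, i) * d i)"
    using mult_carrier_mat[OF C ctrans_carrier[OF C]]
    unfolding mat_diag_mult_right[OF mult_carrier_mat[OF C ctrans_carrier[OF C]]]
    by (simp add: mtrace_def del: index_mult_mat(1))
  also have "\<dots> = (\<Sum>i<m. \<Sum>j<n. complex_of_real ((cmod (C $$ (i, j)))\<^sup>2) * d i)"
  proof (intro sum.cong refl)
    fix i assume i: "i \<in> {..<m}"
    then have "(C * ctrans C) $$ (i, i) = (\<Sum>j<n. C $$ (i, j) * ctrans C $$ (j, i))"
      by (intro index_mult_mat_sum[OF C ctrans_carrier[OF C]]) auto
    also have "\<dots> = (\<Sum>j<n. complex_of_real ((cmod (C $$ (i, j)))\<^sup>2))"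
      using i C by (intro sum.cong refl) (simp only: complex_norm_square, simp)
    finally show "(C * ctrans C) $$ (i, i) * d i = (\<Sum>j<n. complex_of_real ((cmod (C $$ (i, j)))\<^sup>2) * d i)"
      by (simp add: sum_distrib_right)
  qed
  finally show ?thesis by (simp add: C_def)
qed

text \<open>The moment map of the left factor; the right factor is obtained by exchanging the roles of \<open>B\<close> and \<open>B'\<close>.\<close>

definition moment :: "complex mat \<Rightarrow> complex mat \<Rightarrow> complex mat" where
  "moment B B' = complex_of_real (1 / fsq B) \<cdot>\<^sub>m (B * ctrans B) - complex_of_real (1 / fsq B') \<cdot>\<^sub>m (ctrans B' * B')"

lemma moment_carrier:
  assumes "B \<in> carrier_mat m n" "B' \<in> carrier_mat n m"
  shows "moment B B' \<in> carrier_mat m m" "ctrans (moment B B') = moment B B'"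
proof -
  have c: "B * ctrans B \<in> carrier_mat m m" "ctrans B' * B' \<in> carrier_mat m m"
    using mult_carrier_mat[OF assms(1) ctrans_carrier[OF assms(1)]]
      mult_carrier_mat[OF ctrans_carrier[OF assms(2)] assms(2)] by auto
  show M: "moment B B' \<in> carrier_mat m m"
    unfolding moment_def by (rule minus_carrier_mat[OF smult_carrier_mat[OF c(2)]])
  have h: "ctrans (B * ctrans B) = B * ctrans B" "ctrans (ctrans B' * B') = ctrans B' * B'"
    using ctrans_mult[OF assms(1) ctrans_carrier[OF assms(1)]]
      ctrans_mult[OF ctrans_carrier[OF assms(2)] assms(2)] by auto
  have s: "ctrans (complex_of_real x \<cdot>\<^sub>m A) = complex_of_real x \<cdot>\<^sub>m ctrans A" for x A
    by (rule eq_matI) auto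
  show "ctrans (moment B B') = moment B B'"
    unfolding moment_def ctrans_minus[OF smult_carrier_mat[OF c(1)] smult_carrier_mat[OF c(2)]] s h ..
qed

lemma moment_trace:
  fixes l :: "nat \<Rightarrow> real"
  assumes U: "unitary m U" and V: "unitary n V" and B: "B \<in> carrier_mat m n" and B': "B' \<in> carrier_mat n m"
  shows "Re (mtrace (ctrans (moment B B') * hdiag m U l)) =
    (\<Sum>i<m. \<Sum>j<n. ((cmod ((ctrans U * B * V) $$ (i, j)))\<^sup>2 / fsq B -
        (cmod ((ctrans V * B' * U) $$ (j, i)))\<^sup>2 / fsq B') * l i)"
proof -
  note UD = unitaryD[OF U] and VD = unitaryD[OF V]
  let ?H = "hdiag m U l"
  have c: "B * ctrans B \<in> carrier_mat m m" "ctrans B' * B' \<in> carrier_mat m m"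
    using mult_carrier_mat[OF B ctrans_carrier[OF B]]
      mult_carrier_mat[OF ctrans_carrier[OF B'] B'] by auto
  have lin: "mtrace ((complex_of_real x \<cdot>\<^sub>m M - complex_of_real y \<cdot>\<^sub>m N) * ?H) =
      x * mtrace (M * ?H) - y * mtrace (N * ?H)"
    if "M \<in> carrier_mat m m" "N \<in> carrier_mat m m" for x y :: real and M N
  proof -
    have p: "M * ?H \<in> carrier_mat m m" "N * ?H \<in> carrier_mat m m"
      using mult_carrier_mat[OF that(1) udiag_carrier] mult_carrier_mat[OF that(2) udiag_carrier] by auto
    have "(complex_of_real x \<cdot>\<^sub>m M - complex_of_real y \<cdot>\<^sub>m N) * ?H =
        complex_of_real x \<cdot>\<^sub>m (M * ?H) - complex_of_real y \<cdot>\<^sub>m (N * ?H)"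
      unfolding minus_mult_distrib_mat[OF smult_carrier_mat[OF that(1)] smult_carrier_mat[OF that(2)] udiag_carrier]
        mult_smult_assoc_mat[OF that(1) udiag_carrier] mult_smult_assoc_mat[OF that(2) udiag_carrier] ..
    then show ?thesis
      using p that by (simp add: mtrace_def sum_subtractf sum_distrib_left del: index_mult_mat(1))
  qed
  have "mtrace (ctrans (moment B B') * ?H) =
      (1 / fsq B) * mtrace (B * ctrans B * ?H) - (1 / fsq B') * mtrace (ctrans B' * B' * ?H)"
    unfolding moment_carrier(2)[OF B B'] unfolding moment_def by (rule lin[OF c])
  moreover have "mtrace (ctrans B' * B' * ?H) =
      (\<Sum>i<m. \<Sum>j<n. complex_of_real ((cmod ((ctrans V * B' * U) $$ (j, i)))\<^sup>2) * complex_of_real (l i))"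
  proof -
    have VB: "ctrans V * B' \<in> carrier_mat n m" by (rule mult_carrier_mat[OF VD(2) B'])
    have VBU: "ctrans V * B' * U \<in> carrier_mat n m" by (rule mult_carrier_mat[OF VB UD(1)])
    have "ctrans U * ctrans B' * V = ctrans (ctrans V * B' * U)"
      unfolding ctrans_mult[OF VB UD(1)] ctrans_mult[OF VD(2) B']
      using UD(2) VD(1) ctrans_carrier[OF B'] by (simp add: mult_rect[where m = m and n = n])
    then have "cmod ((ctrans U * ctrans B' * V) $$ (i, j)) = cmod ((ctrans V * B' * U) $$ (j, i))"
      if "i < m" "j < n" for i j
      using that carrier_matD[OF VBU] by (simp del: index_mult_mat)
    then show ?thesis
      using mtrace_gram_udiag[OF U V ctrans_carrier[OF B']] by simp
  qed
  ultimately have "mtrace (ctrans (moment B B') * ?H) = complex_of_real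
     ((1 / fsq B) * (\<Sum>i<m. \<Sum>j<n. (cmod ((ctrans U * B * V) $$ (i, j)))\<^sup>2 * l i) -
      (1 / fsq B') * (\<Sum>i<m. \<Sum>j<n. (cmod ((ctrans V * B' * U) $$ (j, i)))\<^sup>2 * l i))"
    unfolding mtrace_gram_udiag[OF U V B] by simp
  then show ?thesis
    by (simp add: sum_distrib_left sum_subtractf left_diff_distrib)
qed

text \<open>The moment of the right factor carries the opposite sign, so the eigenvalues enter only
  through the differences \<open>l i - r j\<close>.\<close>

lemma moment_pair_inner:
  fixes l r :: "nat \<Rightarrow> real"
  assumes U: "unitary m U" and V: "unitary n V" and B: "B \<in> carrier_mat m n" and B': "B' \<in> carrier_mat n m"
  shows "pair_inner (moment B B', moment B' B)
      (hdiag m U l, hdiag n V r) =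
    (\<Sum>i<m. \<Sum>j<n. ((cmod ((ctrans U * B * V) $$ (i, j)))\<^sup>2 / fsq B -
        (cmod ((ctrans V * B' * U) $$ (j, i)))\<^sup>2 / fsq B') * (l i - r j))"
proof -
  have "Re (mtrace (ctrans (moment B' B) * hdiag n V r)) =
    (\<Sum>i<m. \<Sum>j<n. ((cmod ((ctrans V * B' * U) $$ (j, i)))\<^sup>2 / fsq B' -
        (cmod ((ctrans U * B * V) $$ (i, j)))\<^sup>2 / fsq B) * r j)"
    unfolding moment_trace[OF V U B' B] by (rule sum.swap)
  then show ?thesis
    unfolding pair_inner_def fst_conv snd_conv plus_complex.sel moment_trace[OF U V B B', of l]
    by (simp only: sum.distrib[symmetric]) (intro sum.cong refl, simp add: ring_distribs)
qed

text \<open>When \<open>a\<close> is a probability distribution, this is the moment generating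
  function of the gap \<open>l i - r j\<close>.\<close>

definition gap_sum :: "nat \<Rightarrow> nat \<Rightarrow> (nat \<Rightarrow> nat \<Rightarrow> real) \<Rightarrow> (nat \<Rightarrow> real) \<Rightarrow> (nat \<Rightarrow> real) \<Rightarrow> real \<Rightarrow> real" where
  "gap_sum m n a l r t = (\<Sum>i<m. \<Sum>j<n. a i j * exp (t * (l i - r j)))"

lemma gap_sum_zero: "gap_sum m n a l r 0 = (\<Sum>i<m. \<Sum>j<n. a i j)"
  by (simp add: gap_sum_def)

lemma gap_sum_pos:
  assumes "\<And>i j. 0 \<le> a i j" "(\<Sum>i<m. \<Sum>j<n. a i j) > 0"
  shows "gap_sum m n a l r t > 0"
proof -
  have "gap_sum m n a l r t \<ge> 0" unfolding gap_sum_def using assms(1) by (intro sum_nonneg) simp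
  moreover have "gap_sum m n a l r t \<noteq> 0"
  proof
    assume "gap_sum m n a l r t = 0"
    then have "\<forall>i<m. \<forall>j<n. a i j = 0"
      using assms(1) by (simp add: gap_sum_def sum_nonneg_eq_0_iff sum_nonneg)
    then have "(\<Sum>i<m. \<Sum>j<n. a i j) = 0" by simp
    then show False using assms(2) by simp
  qed
  ultimately show ?thesis by simp
qed

lemma fsq_udiag_exp:
  fixes l r :: "nat \<Rightarrow> real"
  assumes "unitary m U" "unitary n V" "B \<in> carrier_mat m n"
  shows "fsq (ediag m U (complex_of_real t) l * B *
              udiag n V (\<lambda>a. inverse (exp (complex_of_real t * complex_of_real (r a))))) =
    gap_sum m n (\<lambda>i j. (cmod ((ctrans U * B * V) $$ (i, j)))\<^sup>2) l r (2 * t)"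
proof -
  have "(exp (t * x) * inverse (exp (t * y)))\<^sup>2 = exp (2 * t * (x - y))" for x y :: real
    by (simp add: exp_double[symmetric] exp_minus[symmetric] exp_add[symmetric] algebra_simps)
  then have *: "(cmod (exp (complex_of_real t * complex_of_real x)) *
      cmod (inverse (exp (complex_of_real t * complex_of_real y))))\<^sup>2 = exp (2 * t * (x - y))" for x y
    by (simp add: norm_inverse norm_exp_eq_Re)
  show ?thesis
    unfolding fsq_udiag_both[OF assms] gap_sum_def * by (simp only: mult.commute)
qed

lemma fsq_sum_entries:
  assumes "unitary m U" "unitary n V" "B \<in> carrier_mat m n"
  shows "(\<Sum>i<m. \<Sum>j<n. (cmod ((ctrans U * B * V) $$ (i, j)))\<^sup>2) = fsq B"
proof -
  have UB: "ctrans U * B \<in> carrier_mat m n"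
    by (rule mult_carrier_mat[OF unitaryD(2)[OF assms(1)] assms(3)])
  have UBV: "ctrans U * B * V \<in> carrier_mat m n"
    by (rule mult_carrier_mat[OF UB unitaryD(1)[OF assms(2)]])
  have "fsq (ctrans U * B * V) = fsq B"
    unfolding fsq_unitary_right[OF assms(2) UB] by (rule fsq_unitary_left[OF unitary_ctrans[OF assms(1)] assms(3)])
  then show ?thesis using UBV by (simp add: fsq_def del: index_mult_mat)
qed

lemma action_translate:
  assumes E: "E \<in> GL m" and F: "F \<in> GL n" and X: "X \<in> GL m" and Y: "Y \<in> GL n" and A: "A \<in> carrier_mat m n"
  shows "E * X * A * minv (F * Y) = E * (X * A * minv Y) * minv F"
  unfolding GL_mult(2)[OF F Y]
  using GL_minv(1,2)[OF E] GL_minv(1,2)[OF F] GL_minv(1,2)[OF X] GL_minv(1,2)[OF Y] A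
  by (simp add: mult_rect[where m = m and n = n] mult_square[where n = n])

text \<open>The group acts inversely on the second factor, whence the opposite signs of the times;
  the factor 2 comes from squaring the norm.\<close>

lemma kappa_tilde_curve:
  fixes l r :: "nat \<Rightarrow> real"
  assumes X: "X \<in> GL m" and Y: "Y \<in> GL n" and A: "A \<in> carrier_mat m n"
    and U: "unitary m U" and V: "unitary n V"
  defines "B \<equiv> X * A * minv Y" and "B' \<equiv> Y * pinv A * minv X"
  shows "kappa_tilde A (ediag m U (complex_of_real t) l * X,
                        ediag n V (complex_of_real t) r * Y) =
    sqrt (gap_sum m n (\<lambda>i j. (cmod ((ctrans U * B * V) $$ (i, j)))\<^sup>2) l r (2 * t)) *
    sqrt (gap_sum m n (\<lambda>i j. (cmod ((ctrans V * B' * U) $$ (j, i)))\<^sup>2) l r (- 2 * t))"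
proof -
  let ?E = "ediag m U (complex_of_real t) l"
  let ?F = "ediag n V (complex_of_real t) r"
  note Xc = GL_minv[OF X] and Yc = GL_minv[OF Y] and P = pinv(1)[OF A]
  have E: "?E \<in> GL m" "minv ?E = udiag m U (\<lambda>a. inverse (exp (complex_of_real t * complex_of_real (l a))))"
    using udiag_inverse[OF U] by auto
  have F: "?F \<in> GL n" "minv ?F = udiag n V (\<lambda>a. inverse (exp (complex_of_real t * complex_of_real (r a))))"
    using udiag_inverse[OF V] by auto
  have XA: "X * A \<in> carrier_mat m n" by (rule mult_carrier_mat[OF Xc(1) A])
  have B: "B \<in> carrier_mat m n" unfolding B_def by (rule mult_carrier_mat[OF XA Yc(2)])
  have YP: "Y * pinv A \<in> carrier_mat n m" by (rule mult_carrier_mat[OF Yc(1) P])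
  have B': "B' \<in> carrier_mat n m" unfolding B'_def by (rule mult_carrier_mat[OF YP Xc(2)])
  have 1: "?E * X * A * minv (?F * Y) = ?E * B * minv ?F"
    unfolding B_def by (rule action_translate[OF E(1) F(1) X Y A])
  have 2: "?F * Y * pinv A * minv (?E * X) = ?F * B' * minv ?E"
    unfolding B'_def by (rule action_translate[OF F(1) E(1) Y X P])
  have 3: "gap_sum n m (\<lambda>i j. (cmod ((ctrans V * B' * U) $$ (i, j)))\<^sup>2) r l (2 * t) =
      gap_sum m n (\<lambda>i j. (cmod ((ctrans V * B' * U) $$ (j, i)))\<^sup>2) l r (- 2 * t)"
    unfolding gap_sum_def by (subst sum.swap) (simp add: algebra_simps)
  show ?thesis
    unfolding kappa_tilde_def fst_conv snd_conv 1 2 E(2) F(2) frob_eq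
      fsq_udiag_exp[OF U V B] fsq_udiag_exp[OF V U B'] 3 ..
qed

lemma gap_sum_ln_deriv:
  assumes "gap_sum m n a l r 0 > 0"
  shows "((\<lambda>t. ln (gap_sum m n a l r (c * t))) has_real_derivative
     c * (\<Sum>i<m. \<Sum>j<n. a i j / gap_sum m n a l r 0 * (l i - r j))) (at 0)"
proof -
  have "((\<lambda>t. gap_sum m n a l r (c * t)) has_real_derivative
     (\<Sum>i<m. \<Sum>j<n. a i j * (c * (l i - r j)))) (at 0)"
    unfolding gap_sum_def by (auto intro!: derivative_eq_intros sum.cong)
  from DERIV_chain'[OF this DERIV_ln_divide[of "gap_sum m n a l r (c * 0)"]] assms
  have "((\<lambda>t. ln (gap_sum m n a l r (c * t))) has_real_derivative
     1 / gap_sum m n a l r 0 * (\<Sum>i<m. \<Sum>j<n. a i j * (c * (l i - r j)))) (at 0)" by simp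
  also have "1 / gap_sum m n a l r 0 * (\<Sum>i<m. \<Sum>j<n. a i j * (c * (l i - r j))) =
     c * (\<Sum>i<m. \<Sum>j<n. a i j / gap_sum m n a l r 0 * (l i - r j))"
    unfolding sum_distrib_left by (intro sum.cong refl) (simp add: field_simps)
  finally show ?thesis .
qed

text \<open>\<open>B'\<close> is in general not the pseudoinverse of \<open>B\<close>, but the
  identity \<open>B * B' * B = B\<close> survives the scaling. Submultiplicativity then gives
  \<open>frob B * frob B' \<ge> 1\<close>, so the infimum is bounded away from 0 and all logarithms
  are meaningful.\<close>

lemma kappa_factors:
  assumes X: "X \<in> GL m" and Y: "Y \<in> GL n" and A: "A \<in> carrier_mat m n" "A \<noteq> 0\<^sub>m m n"
  defines "B \<equiv> X * A * minv Y" and "B' \<equiv> Y * pinv A * minv X"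
  shows "B \<in> carrier_mat m n" "B' \<in> carrier_mat n m" "fsq B > 0" "fsq B' > 0" "1 \<le> frob B * frob B'"
proof -
  note Xc = GL_minv[OF X] and Yc = GL_minv[OF Y] and P = pinv[OF A(1)]
  have XA: "X * A \<in> carrier_mat m n" by (rule mult_carrier_mat[OF Xc(1) A(1)])
  show B: "B \<in> carrier_mat m n" unfolding B_def by (rule mult_carrier_mat[OF XA Yc(2)])
  have YP: "Y * pinv A \<in> carrier_mat n m" by (rule mult_carrier_mat[OF Yc(1) P(1)])
  show B': "B' \<in> carrier_mat n m" unfolding B'_def by (rule mult_carrier_mat[OF YP Xc(2)])
  note mm = mult_rect[where m = m and n = n] mult_square[where n = m] mult_square[where n = n]
  have "minv X * B * Y = (minv X * X) * A * (minv Y * Y)"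
    unfolding B_def using Xc(1,2) Yc(1,2) A(1) by (simp add: mm)
  then have BA: "minv X * B * Y = A" unfolding Xc(4) Yc(4)
    using A(1) by (simp add: left_mult_one_mat[of _ m n] right_mult_one_mat[of _ m n])
  have "B \<noteq> 0\<^sub>m m n"
  proof
    assume "B = 0\<^sub>m m n"
    then have "minv X * B * Y = 0\<^sub>m m n" using Xc(2) Yc(1) by simp
    then show False using BA A(2) by simp
  qed
  then show fB: "fsq B > 0" by (rule fsq_pos[OF B])
  have "B * B' * B = X * A * (minv Y * Y) * pinv A * (minv X * X) * A * minv Y"
    unfolding B_def B'_def using Xc(1,2) Yc(1,2) A(1) P(1) by (simp add: mm)
  also have "\<dots> = X * A * pinv A * A * minv Y"
    unfolding Xc(4) Yc(4) using Xc(1,2) Yc(1,2) A(1) P(1) XA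
    by (simp add: right_mult_one_mat[of _ m n] right_mult_one_mat[of _ m m] mult_rect[where m = m and n = n])
  also have "\<dots> = X * (A * pinv A * A) * minv Y"
    using Xc(1,2) Yc(1,2) A(1) P(1) by (simp add: mm)
  also have "\<dots> = B" unfolding P(2) B_def ..
  finally have BBB: "B * B' * B = B" .
  have BB: "B * B' \<in> carrier_mat m m" by (rule mult_carrier_mat[OF B B'])
  have "frob B \<le> frob (B * B') * frob B" using frob_mult[OF BB B] unfolding BBB .
  also have "\<dots> \<le> frob B * frob B' * frob B" by (rule mult_right_mono[OF frob_mult[OF B B']]) simp
  finally have "1 * frob B \<le> (frob B * frob B') * frob B" by simp
  moreover have fpos: "frob B > 0" using fB by (simp add: frob_eq)
  ultimately show ge: "1 \<le> frob B * frob B'" by (simp only: mult_le_cancel_right_pos)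
  show "fsq B' > 0"
  proof (rule ccontr)
    assume "\<not> 0 < fsq B'"
    then have "fsq B' = 0" using fsq_nonneg[of B'] by linarith
    then show False using ge by (simp add: frob_eq)
  qed
qed

lemma kappa_tilde_eq:
  "kappa_tilde A (X, Y) = sqrt (fsq (X * A * minv Y)) * sqrt (fsq (Y * pinv A * minv X))"
  by (simp add: kappa_tilde_def frob_eq)

lemma kappa_tilde_ge_1:
  assumes "X \<in> GL m" "Y \<in> GL n" "A \<in> carrier_mat m n" "A \<noteq> 0\<^sub>m m n"
  shows "1 \<le> kappa_tilde A (X, Y)"
  using kappa_factors(5)[OF assms] by (simp add: kappa_tilde_def)

lemma kappa_tilde_unitary:
  assumes X: "X \<in> GL m" and Y: "Y \<in> GL n" and A: "A \<in> carrier_mat m n" "A \<noteq> 0\<^sub>m m n"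
    and U: "unitary m U" and V: "unitary n V"
  shows "kappa_tilde A (U * X, V * Y) = kappa_tilde A (X, Y)"
proof -
  note P = pinv(1)[OF A(1)] and UD = unitaryD[OF U] and VD = unitaryD[OF V]
  have gl: "U \<in> GL m" "V \<in> GL n" using GL_I UD VD by blast+
  have inv: "minv U = ctrans U" "minv V = ctrans V"
    using minv_eqI[OF UD(1,2,4,3)] minv_eqI[OF VD(1,2,4,3)] by auto
  define B where "B = X * A * minv Y"
  define B' where "B' = Y * pinv A * minv X"
  have B: "B \<in> carrier_mat m n" and B': "B' \<in> carrier_mat n m"
    unfolding B_def B'_def by (rule kappa_factors[OF X Y A])+
  have 1: "U * X * A * minv (V * Y) = U * B * ctrans V"
    unfolding B_def inv(2)[symmetric] by (rule action_translate[OF gl X Y A(1)])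
  have 2: "V * Y * pinv A * minv (U * X) = V * B' * ctrans U"
    unfolding B'_def inv(1)[symmetric] by (rule action_translate[OF gl(2,1) Y X P])
  have 3: "fsq (U * B * ctrans V) = fsq B"
    unfolding fsq_unitary_right[OF unitary_ctrans[OF V] mult_carrier_mat[OF UD(1) B]] by (rule fsq_unitary_left[OF U B])
  have 4: "fsq (V * B' * ctrans U) = fsq B'"
    unfolding fsq_unitary_right[OF unitary_ctrans[OF U] mult_carrier_mat[OF VD(1) B']] by (rule fsq_unitary_left[OF V B'])
  show ?thesis unfolding kappa_tilde_eq 1 2 3 4 unfolding B_def B'_def ..
qed

text \<open>A closed form of \<open>gradient\<close>: the two moment maps, projected to the tangent
  directions permitted by the patterns.\<close>

definition grad :: "nat \<Rightarrow> nat \<Rightarrow> (nat \<Rightarrow> nat \<Rightarrow> bool) \<Rightarrow> (nat \<Rightarrow> nat \<Rightarrow> bool) \<Rightarrow> complex mat \<Rightarrow>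
    complex mat \<times> complex mat \<Rightarrow> complex mat \<times> complex mat" where
  "grad m n R1 R2 A XY = (let B = fst XY * A * minv (snd XY); B' = snd XY * pinv A * minv (fst XY)
     in (pattern_proj m R1 (moment B B'), pattern_proj n R2 (moment B' B)))"

text \<open>\<open>wt U V B\<close> is the distribution of weights of \<open>B\<close> in the eigenbases \<open>U\<close> and \<open>V\<close>.\<close>

definition wt :: "complex mat \<Rightarrow> complex mat \<Rightarrow> complex mat \<Rightarrow> nat \<Rightarrow> nat \<Rightarrow> real" where
  "wt U V B i j = (cmod ((ctrans U * B * V) $$ (i, j)))\<^sup>2 / fsq B"

lemma wt_nonneg: "0 \<le> wt U V B i j"
  by (simp add: wt_def)

lemma wt_sum:
  assumes "unitary m U" "unitary n V" "B \<in> carrier_mat m n" "fsq B > 0"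
  shows "(\<Sum>i<m. \<Sum>j<n. wt U V B i j) = 1"
  unfolding wt_def sum_divide_distrib[symmetric] fsq_sum_entries[OF assms(1-3)] using assms(4) by simp

definition scaled :: "complex mat \<Rightarrow> complex mat \<Rightarrow> complex mat \<Rightarrow> complex mat" where
  "scaled A X Y = X * A * minv Y"

context
  fixes m n :: nat and X Y A :: "complex mat" and R1 R2 :: "nat \<Rightarrow> nat \<Rightarrow> bool"
  assumes X: "X \<in> GL m" and Y: "Y \<in> GL n" and A: "A \<in> carrier_mat m n" "A \<noteq> 0\<^sub>m m n"
    and sym: "symp R1" "symp R2"
begin

abbreviation (input) "Bm \<equiv> scaled A X Y"
abbreviation (input) "Bm' \<equiv> scaled (pinv A) Y X"

lemma scaled_factors: "Bm \<in> carrier_mat m n" "Bm' \<in> carrier_mat n m" "fsq Bm > 0" "fsq Bm' > 0"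
  unfolding scaled_def using kappa_factors[OF X Y A] by auto

lemma grad_eq: "grad m n R1 R2 A (X, Y) = (pattern_proj m R1 (moment Bm Bm'), pattern_proj n R2 (moment Bm' Bm))"
  by (simp add: grad_def scaled_def Let_def)

lemma grad_herm_pat: "grad m n R1 R2 A (X, Y) \<in> herm_pat m R1 \<times> herm_pat n R2"
  unfolding grad_eq
  using pattern_proj_herm_pat[OF sym(1) moment_carrier[OF scaled_factors(1,2)]] pattern_proj_herm_pat[OF sym(2) moment_carrier[OF scaled_factors(2,1)]]
  by simp

text \<open>The projection is invisible to directions that respect the pattern. What remains is the
  mean gap under the weights of the first factor minus the mean gap under those of the
  second.\<close>

lemma grad_inner:
  fixes l r :: "nat \<Rightarrow> real"
  assumes U: "unitary m U" and V: "unitary n V"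
    and H1: "hdiag m U l \<in> herm_pat m R1"
    and H2: "hdiag n V r \<in> herm_pat n R2"
  shows "pair_inner (grad m n R1 R2 A (X, Y)) (hdiag m U l, hdiag n V r) =
    (\<Sum>i<m. \<Sum>j<n. (wt U V Bm i j - wt V U Bm' j i) * (l i - r j))"
proof -
  have "pair_inner (grad m n R1 R2 A (X, Y)) (hdiag m U l, hdiag n V r) =
    pair_inner (moment Bm Bm', moment Bm' Bm) (hdiag m U l, hdiag n V r)"
    unfolding grad_eq pair_inner_def fst_conv snd_conv
      pattern_proj_inner[OF moment_carrier(1)[OF scaled_factors(1,2)] H1] pattern_proj_inner[OF moment_carrier(1)[OF scaled_factors(2,1)] H2] ..
  also have "\<dots> = (\<Sum>i<m. \<Sum>j<n. (wt U V Bm i j - wt V U Bm' j i) * (l i - r j))"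
    unfolding moment_pair_inner[OF U V scaled_factors(1,2)] wt_def ..
  finally show ?thesis .
qed

lemma kappa_tilde_curve_wt:
  fixes l r :: "nat \<Rightarrow> real"
  assumes U: "unitary m U" and V: "unitary n V"
  shows "kappa_tilde A (ediag m U (complex_of_real t) l * X,
                        ediag n V (complex_of_real t) r * Y) =
    kappa_tilde A (X, Y) * sqrt (gap_sum m n (wt U V Bm) l r (2 * t) * gap_sum m n (\<lambda>i j. wt V U Bm' j i) l r (- 2 * t))"
proof -
  have "gap_sum m n (\<lambda>i j. (cmod ((ctrans U * Bm * V) $$ (i, j)))\<^sup>2) l r s = fsq Bm * gap_sum m n (wt U V Bm) l r s" for s
    using scaled_factors(3) by (simp add: gap_sum_def wt_def sum_distrib_left del: index_mult_mat)
  moreover have "gap_sum m n (\<lambda>i j. (cmod ((ctrans V * Bm' * U) $$ (j, i)))\<^sup>2) l r s =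
      fsq Bm' * gap_sum m n (\<lambda>i j. wt V U Bm' j i) l r s" for s
    using scaled_factors(4) by (simp add: gap_sum_def wt_def sum_distrib_left del: index_mult_mat)
  ultimately show ?thesis
    unfolding kappa_tilde_curve[OF X Y A(1) U V]
    unfolding kappa_tilde_eq scaled_def[symmetric]
    by (simp add: real_sqrt_mult mult_ac)
qed

lemma wt_total:
  assumes U: "unitary m U" and V: "unitary n V"
  shows "(\<Sum>i<m. \<Sum>j<n. wt U V Bm i j) = 1" "(\<Sum>i<m. \<Sum>j<n. wt V U Bm' j i) = 1"
proof -
  show "(\<Sum>i<m. \<Sum>j<n. wt U V Bm i j) = 1" by (rule wt_sum[OF U V scaled_factors(1,3)])
  show "(\<Sum>i<m. \<Sum>j<n. wt V U Bm' j i) = 1"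
    by (subst sum.swap) (rule wt_sum[OF V U scaled_factors(2,4)])
qed

text \<open>Half the sum of two cumulant generating functions of the gap, at opposite times. First
  and second order bounds for the cost therefore reduce to bounds for means of exponentials.\<close>

lemma costC_curve:
  fixes l r :: "nat \<Rightarrow> real"
  assumes U: "unitary m U" and V: "unitary n V"
  shows "costC A (ediag m U (complex_of_real t) l * X,
                  ediag n V (complex_of_real t) r * Y) =
    costC A (X, Y) + (ln (gap_sum m n (wt U V Bm) l r (2 * t)) + ln (gap_sum m n (\<lambda>i j. wt V U Bm' j i) l r (- 2 * t))) / 2"
proof -
  have pos: "gap_sum m n (wt U V Bm) l r s > 0" "gap_sum m n (\<lambda>i j. wt V U Bm' j i) l r s > 0" for s
    by (rule gap_sum_pos; simp add: wt_nonneg wt_total[OF U V])+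
  have k: "kappa_tilde A (X, Y) > 0" using kappa_tilde_ge_1[OF X Y A] by linarith
  have "ln (x * sqrt (a * b)) = ln x + (ln a + ln b) / 2" if "x > 0" "a > 0" "b > 0" for x a b :: real
    using that by (simp add: real_sqrt_mult ln_mult ln_sqrt)
  from this[OF k pos] show ?thesis unfolding costC_def kappa_tilde_curve_wt[OF U V] .
qed

lemma costC_deriv:
  assumes H: "(H1, H2) \<in> herm_pat m R1 \<times> herm_pat n R2"
  shows "((\<lambda>t::real. costC A (mexp (of_real t \<cdot>\<^sub>m H1) * X, mexp (of_real t \<cdot>\<^sub>m H2) * Y)) has_real_derivative
    pair_inner (grad m n R1 R2 A (X, Y)) (H1, H2)) (at 0)"
proof -
  have c: "H1 \<in> carrier_mat m m" "ctrans H1 = H1" "H2 \<in> carrier_mat n n" "ctrans H2 = H2"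
    using H by (auto simp: herm_pat_def)
  obtain U l where U: "unitary m U" "H1 = hdiag m U l"
    using hermitian_spectral[OF c(1,2)] by metis
  obtain V r where V: "unitary n V" "H2 = hdiag n V r"
    using hermitian_spectral[OF c(3,4)] by metis
  let ?q = "wt U V Bm" and ?q' = "\<lambda>i j. wt V U Bm' j i"
  have one: "gap_sum m n ?q l r 0 = 1" "gap_sum m n ?q' l r 0 = 1"
    unfolding gap_sum_zero by (rule wt_total[OF U(1) V(1)])+
  have "((\<lambda>t. costC A (X, Y) + (ln (gap_sum m n ?q l r (2 * t)) + ln (gap_sum m n ?q' l r (- 2 * t))) / 2)
    has_real_derivative
      0 + (2 * (\<Sum>i<m. \<Sum>j<n. ?q i j / gap_sum m n ?q l r 0 * (l i - r j)) +
       - 2 * (\<Sum>i<m. \<Sum>j<n. ?q' i j / gap_sum m n ?q' l r 0 * (l i - r j))) / 2) (at 0)"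
    by (intro DERIV_add DERIV_const DERIV_cdivide gap_sum_ln_deriv) (simp_all add: one)
  also have "0 + (2 * (\<Sum>i<m. \<Sum>j<n. ?q i j / gap_sum m n ?q l r 0 * (l i - r j)) +
       - 2 * (\<Sum>i<m. \<Sum>j<n. ?q' i j / gap_sum m n ?q' l r 0 * (l i - r j))) / 2 =
       (\<Sum>i<m. \<Sum>j<n. (?q i j - ?q' i j) * (l i - r j))"
    unfolding one by (simp add: left_diff_distrib sum_subtractf)
  also have "\<dots> = pair_inner (grad m n R1 R2 A (X, Y)) (H1, H2)"
    using grad_inner[OF U(1) V(1), of l r] H unfolding U(2) V(2) by simp
  finally show ?thesis
    unfolding U(2) V(2) mexp_smult_udiag[OF U(1)] mexp_smult_udiag[OF V(1)] costC_curve[OF U(1) V(1)] .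
qed

text \<open>Existence is \<open>costC_deriv\<close>. For uniqueness, two candidates have the same
  pairing with their own difference, which lies in the space of directions, so the difference has
  norm 0.\<close>

lemma gradient_eq_grad:
  assumes L: "iLieK m n G = herm_pat m R1 \<times> herm_pat n R2"
  shows "gradient m n G (costC A) (X, Y) = grad m n R1 R2 A (X, Y)"
  unfolding gradient_def fst_conv snd_conv L
proof (rule the_equality, intro conjI ballI)
  let ?g = "grad m n R1 R2 A (X, Y)"
  show g: "?g \<in> herm_pat m R1 \<times> herm_pat n R2" by (rule grad_herm_pat)
  show "((\<lambda>t. costC A (mexp (complex_of_real t \<cdot>\<^sub>m fst H') * X, mexp (complex_of_real t \<cdot>\<^sub>m snd H') * Y))
     has_real_derivative pair_inner ?g H') (at 0)" if "H' \<in> herm_pat m R1 \<times> herm_pat n R2" for H'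
    using costC_deriv[of "fst H'" "snd H'"] that by (simp add: mem_Times_iff)
  fix H assume H: "H \<in> herm_pat m R1 \<times> herm_pat n R2 \<and>
    (\<forall>H'\<in>herm_pat m R1 \<times> herm_pat n R2.
      ((\<lambda>t. costC A (mexp (complex_of_real t \<cdot>\<^sub>m fst H') * X, mexp (complex_of_real t \<cdot>\<^sub>m snd H') * Y))
     has_real_derivative pair_inner H H') (at 0))"
  obtain H1 H2 g1 g2 where p: "H = (H1, H2)" "?g = (g1, g2)" by (metis surj_pair)
  have c: "H1 \<in> herm_pat m R1" "H2 \<in> herm_pat n R2" "g1 \<in> herm_pat m R1" "g2 \<in> herm_pat n R2"
    using H g p by auto
  have minus: "P - Q \<in> herm_pat k R" if "P \<in> herm_pat k R" "Q \<in> herm_pat k R" for P Q k R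
    using that unfolding herm_pat_def by (auto simp: ctrans_minus[of _ k k])
  have D: "(H1 - g1, H2 - g2) \<in> herm_pat m R1 \<times> herm_pat n R2" using minus c by simp
  have "pair_inner H (H1 - g1, H2 - g2) = pair_inner ?g (H1 - g1, H2 - g2)"
    using bspec[OF conjunct2[OF H] D, unfolded fst_conv snd_conv] costC_deriv[OF D] by (rule DERIV_unique)
  moreover have cc: "H1 \<in> carrier_mat m m" "H2 \<in> carrier_mat n n" "g1 \<in> carrier_mat m m" "g2 \<in> carrier_mat n n"
    using c by (auto simp: herm_pat_def)
  ultimately have "pair_inner (H1 - g1, H2 - g2) (H1 - g1, H2 - g2) = 0"
    unfolding p pair_inner_minus_left[OF cc minus_carrier_mat[OF cc(3)] minus_carrier_mat[OF cc(4)]] by simp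
  then have z: "fsq (H1 - g1) = 0" "fsq (H2 - g2) = 0"
    using fsq_nonneg[of "H1 - g1"] fsq_nonneg[of "H2 - g2"] unfolding pair_inner_self fst_conv snd_conv by linarith+
  have eqI: "P = Q" if "P \<in> carrier_mat k k" "Q \<in> carrier_mat k k" "fsq (P - Q) = 0" for P Q k
  proof (rule eq_matI)
    have "P - Q = 0\<^sub>m k k" by (rule fsq_eq_0[OF minus_carrier_mat[OF that(2)] that(3)])
    moreover fix i j assume "i < dim_row Q" "j < dim_col Q"
    ultimately show "P $$ (i, j) = Q $$ (i, j)"
      using that(1,2) by (metis carrier_matD eq_iff_diff_eq_0 index_minus_mat(1) index_zero_mat(1))
  qed (use that in auto)
  show "H = ?g" unfolding p using eqI[OF cc(1,3) z(1)] eqI[OF cc(2,4) z(2)] by simp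
qed

end

subsection \<open>Sufficient decrease\<close>

text \<open>The second-order term contributes 1/2 and the Lagrange remainder at most
  \<open>e/6\<close>, with \<open>e\<close> below 2.72; the sum is about 0.953. That 23/24 is
  smaller than 1 is what leaves a positive decrease for the step size 1/8.\<close>

lemma exp_le_quadratic:
  fixes y :: real
  assumes "\<bar>y\<bar> \<le> 1"
  shows "exp y \<le> 1 + y + 23 / 24 * y\<^sup>2"
proof -
  obtain t where t: "\<bar>t\<bar> \<le> \<bar>y\<bar>" "exp y = (\<Sum>k<3. y ^ k / fact k) + exp t / fact 3 * y ^ 3"
    using Maclaurin_exp_le[of y 3] by blast
  have e: "exp y = 1 + y + y\<^sup>2 / 2 + exp t / 6 * y ^ 3"
    unfolding t(2) by (simp add: eval_nat_numeral)
  have "exp t \<le> exp 1" using t(1) assms by simp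
  then have et: "exp t \<le> 272 / 100" using e_less_272 by linarith
  have "y ^ 3 \<le> y\<^sup>2"
  proof -
    have "y\<^sup>2 * y \<le> y\<^sup>2 * 1" using assms by (intro mult_left_mono) auto
    then show ?thesis by (simp add: eval_nat_numeral)
  qed
  then have "exp t / 6 * y ^ 3 \<le> exp t / 6 * y\<^sup>2" by (intro mult_left_mono) auto
  also have "\<dots> \<le> (272 / 100) / 6 * y\<^sup>2" using et by (intro mult_right_mono divide_right_mono) auto
  finally have "exp y \<le> 1 + y + (1 / 2 + 272 / 600) * y\<^sup>2" unfolding e by (simp add: algebra_simps)
  also have "\<dots> \<le> 1 + y + 23 / 24 * y\<^sup>2" by (intro add_left_mono mult_right_mono) auto
  finally show ?thesis .
qed

text \<open>\<open>ln x \<le> x - 1\<close>, followed by the quadratic bound under the mean. The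
  condition on \<open>s\<close> keeps all exponents in [-1, 1].\<close>

lemma ln_gap_sum_le:
  assumes q: "\<And>i j. 0 \<le> q i j" "(\<Sum>i<m. \<Sum>j<n. q i j) = 1"
    and b: "\<And>i j. i < m \<Longrightarrow> j < n \<Longrightarrow> (l i - r j)\<^sup>2 \<le> K" and s: "s\<^sup>2 * K \<le> 1"
  shows "ln (gap_sum m n q l r s) \<le> s * (\<Sum>i<m. \<Sum>j<n. q i j * (l i - r j)) + 23 / 24 * (s\<^sup>2 * K)"
proof -
  have "gap_sum m n q l r s > 0" by (rule gap_sum_pos) (use q in simp_all)
  then have "ln (gap_sum m n q l r s) \<le> gap_sum m n q l r s - 1" by (rule ln_le_minus_one)
  also have "gap_sum m n q l r s \<le> (\<Sum>i<m. \<Sum>j<n. q i j * (1 + s * (l i - r j) + 23 / 24 * (s\<^sup>2 * K)))"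
    unfolding gap_sum_def
  proof (intro sum_mono mult_left_mono q(1))
    fix i j assume ij: "i \<in> {..<m}" "j \<in> {..<n}"
    have sq: "(s * (l i - r j))\<^sup>2 \<le> s\<^sup>2 * K"
      unfolding power_mult_distrib using b ij by (intro mult_left_mono) auto
    then have "(s * (l i - r j))\<^sup>2 \<le> 1" using s by linarith
    then have "\<bar>s * (l i - r j)\<bar> \<le> 1" by (simp add: abs_square_le_1)
    from exp_le_quadratic[OF this] sq
    show "exp (s * (l i - r j)) \<le> 1 + s * (l i - r j) + 23 / 24 * (s\<^sup>2 * K)" by linarith
  qed
  also have "\<dots> = (\<Sum>i<m. \<Sum>j<n. q i j) + s * (\<Sum>i<m. \<Sum>j<n. q i j * (l i - r j)) + 23 / 24 * (s\<^sup>2 * K) * (\<Sum>i<m. \<Sum>j<n. q i j)"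
  proof -
    have "q i j * (1 + s * (l i - r j) + 23 / 24 * (s\<^sup>2 * K)) =
        q i j + s * (q i j * (l i - r j)) + 23 / 24 * (s\<^sup>2 * K) * q i j" for i j
      by (simp add: algebra_simps)
    then show ?thesis by (simp only: sum.distrib sum_distrib_left)
  qed
  finally show ?thesis unfolding q(2) by simp
qed

lemma abs_mean_le:
  assumes q: "\<And>i j. 0 \<le> q i j" "(\<Sum>i<m. \<Sum>j<n. q i j) = (1::real)"
    and b: "\<And>i j. i < m \<Longrightarrow> j < n \<Longrightarrow> \<bar>w i j\<bar> \<le> K"
  shows "\<bar>\<Sum>i<m. \<Sum>j<n. q i j * w i j\<bar> \<le> K"
proof -
  have "\<bar>\<Sum>i<m. \<Sum>j<n. q i j * w i j\<bar> \<le> (\<Sum>i<m. \<Sum>j<n. \<bar>q i j * w i j\<bar>)"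
    by (rule order_trans[OF sum_abs]) (intro sum_mono sum_abs)
  also have "\<dots> \<le> (\<Sum>i<m. \<Sum>j<n. q i j * K)"
    using q(1) b by (intro sum_mono) (auto simp: abs_mult intro!: mult_left_mono)
  also have "\<dots> = K" using q(2) by (simp add: sum_distrib_right[symmetric])
  finally show ?thesis .
qed

text \<open>With \<open>N\<close> the squared norm of the gradient, the linear term gains
  \<open>N/8\<close>, and the quadratic terms lose at most \<open>23/24\<close> of that. The
  difference is \<open>N/192\<close>.\<close>

lemma costC_decrease:
  assumes X: "X \<in> GL m" and Y: "Y \<in> GL n" and A: "A \<in> carrier_mat m n" "A \<noteq> 0\<^sub>m m n"
    and sym: "symp R1" "symp R2"
  defines "g \<equiv> grad m n R1 R2 A (X, Y)"
  shows "costC A (mexp (of_real (- (1 / 8)) \<cdot>\<^sub>m fst g) * X, mexp (of_real (- (1 / 8)) \<cdot>\<^sub>m snd g) * Y)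
    \<le> costC A (X, Y) - (pnorm g)\<^sup>2 / 192"
proof -
  have gp: "g \<in> herm_pat m R1 \<times> herm_pat n R2" unfolding g_def by (rule grad_herm_pat[OF X Y A sym])
  have c: "fst g \<in> carrier_mat m m" "ctrans (fst g) = fst g" "snd g \<in> carrier_mat n n" "ctrans (snd g) = snd g"
    using gp by (auto simp: herm_pat_def)
  obtain U l where U: "unitary m U" "fst g = hdiag m U l"
    using hermitian_spectral[OF c(1,2)] by metis
  obtain V r where V: "unitary n V" "snd g = hdiag n V r"
    using hermitian_spectral[OF c(3,4)] by metis
  have g: "g = (hdiag m U l, hdiag n V r)"
    using U(2) V(2) by (simp add: prod_eq_iff)
  define q where "q = wt U V (X * A * minv Y)"
  define q' where "q' = (\<lambda>i j. wt V U (Y * pinv A * minv X) j i)"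
  have q0: "\<And>i j. 0 \<le> q i j" "\<And>i j. 0 \<le> q' i j" by (simp_all add: q_def q'_def wt_nonneg)
  have q1: "(\<Sum>i<m. \<Sum>j<n. q i j) = 1" "(\<Sum>i<m. \<Sum>j<n. q' i j) = 1"
    unfolding q_def q'_def using wt_total[OF X Y A sym U(1) V(1)]
    unfolding scaled_def by auto
  define N where "N = (pnorm g)\<^sup>2"
  have N0: "N \<ge> 0" by (simp add: N_def)
  have N: "N = (\<Sum>i<m. (l i)\<^sup>2) + (\<Sum>j<n. (r j)\<^sup>2)"
    unfolding N_def pnorm_def U(2) V(2) fsq_udiag[OF U(1)] fsq_udiag[OF V(1)]
    by (simp add: sum_nonneg)
  have w2: "(l i - r j)\<^sup>2 \<le> 2 * N" if "i < m" "j < n" for i j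
  proof -
    have "(l i)\<^sup>2 \<le> (\<Sum>i<m. (l i)\<^sup>2)"
      by (rule member_le_sum) (use that in auto)
    moreover have "(r j)\<^sup>2 \<le> (\<Sum>j<n. (r j)\<^sup>2)"
      by (rule member_le_sum) (use that in auto)
    ultimately have "2 * (l i)\<^sup>2 + 2 * (r j)\<^sup>2 \<le> 2 * N" unfolding N by simp
    moreover have "(l i - r j)\<^sup>2 \<le> 2 * (l i)\<^sup>2 + 2 * (r j)\<^sup>2"
      using zero_le_power2[of "l i + r j"] by (simp add: power2_eq_square algebra_simps)
    ultimately show ?thesis by (rule order_trans[rotated])
  qed
  define M where "M = (\<Sum>i<m. \<Sum>j<n. q i j * (l i - r j))"
  define M' where "M' = (\<Sum>i<m. \<Sum>j<n. q' i j * (l i - r j))"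
  have NM: "N = M - M'"
  proof -
    have "N = pair_inner g g" unfolding N_def pnorm_def pair_inner_self by simp
    also have "\<dots> = (\<Sum>i<m. \<Sum>j<n. (q i j - q' i j) * (l i - r j))"
      using grad_inner[OF X Y A sym U(1) V(1), of l r] gp
      unfolding g_def[symmetric] scaled_def q_def[symmetric]
      unfolding g q'_def by simp
    also have "\<dots> = M - M'" by (simp add: M_def M'_def left_diff_distrib sum_subtractf)
    finally show ?thesis .
  qed
  \<comment> \<open>\<open>N\<close> is a difference of two means of gaps, each of modulus at most
    \<open>sqrt (2 * N)\<close>, so \<open>N \<le> 2 * sqrt (2 * N)\<close>. Hence
    \<open>(1/4)^2 * (2 * N) \<le> 1\<close>, as the quadratic bound requires.\<close>
  have N8: "N \<le> 8"
  proof -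
    have w: "\<bar>l i - r j\<bar> \<le> sqrt (2 * N)" if "i < m" "j < n" for i j
      using real_sqrt_le_mono[OF w2[OF that]] by simp
    have "\<bar>M\<bar> \<le> sqrt (2 * N)" "\<bar>M'\<bar> \<le> sqrt (2 * N)"
      unfolding M_def M'_def by (rule abs_mean_le[OF q0(1) q1(1) w], assumption+, rule abs_mean_le[OF q0(2) q1(2) w])
    then have "N \<le> 2 * sqrt (2 * N)" unfolding NM by linarith
    then have "N\<^sup>2 \<le> (2 * sqrt (2 * N))\<^sup>2" using N0 by (rule power_mono)
    also have "\<dots> = 8 * N" using N0 by (simp add: power_mult_distrib)
    finally have "N * N \<le> 8 * N" by (simp add: power2_eq_square)
    then show ?thesis using N0 by (cases "N = 0") (auto simp: mult_le_cancel_right)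
  qed
  have sq: "(- 1 / 4)\<^sup>2 = (1 / 16 :: real)" "(1 / 4)\<^sup>2 = (1 / 16 :: real)"
    by (simp_all add: power2_eq_square)
  have b1: "ln (gap_sum m n q l r (- 1 / 4)) \<le> (- 1 / 4) * M + 23 / 24 * ((- 1 / 4)\<^sup>2 * (2 * N))"
    unfolding M_def by (rule ln_gap_sum_le[OF q0(1) q1(1) w2]) (use N8 in \<open>simp_all add: power2_eq_square\<close>)
  have b2: "ln (gap_sum m n q' l r (1 / 4)) \<le> (1 / 4) * M' + 23 / 24 * ((1 / 4)\<^sup>2 * (2 * N))"
    unfolding M'_def by (rule ln_gap_sum_le[OF q0(2) q1(2) w2]) (use N8 in \<open>simp_all add: power2_eq_square\<close>)
  have e: "costC A (mexp (of_real (- (1 / 8)) \<cdot>\<^sub>m fst g) * X, mexp (of_real (- (1 / 8)) \<cdot>\<^sub>m snd g) * Y) =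
     costC A (X, Y) + (ln (gap_sum m n q l r (- 1 / 4)) + ln (gap_sum m n q' l r (1 / 4))) / 2"
    unfolding U(2) V(2) mexp_smult_udiag[OF U(1)] mexp_smult_udiag[OF V(1)]
      costC_curve[OF X Y A sym U(1) V(1), unfolded scaled_def, folded q_def]
    by (simp add: q'_def)
  show ?thesis
    unfolding N_def[symmetric] e using b1[unfolded sq] b2[unfolded sq] NM by argo
qed

subsection \<open>The gradient bounds the optimality gap\<close>

text \<open>Points are added in increasing order, and each raises the potential by at most 1 however
  far it lies to the right. Monotonicity is carried along because the induction step needs
  it.\<close>

lemma exp_gap_potential:
  fixes S :: "real set"
  assumes "finite S"
  shows "\<exists>p. (\<forall>a\<in>S. 0 \<le> p a \<and> p a \<le> real (card S)) \<and> (\<forall>a\<in>S. \<forall>b\<in>S. a \<le> b \<longrightarrow> p a \<le> p b) \<and>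
    (\<forall>a\<in>S. \<forall>b\<in>S. 1 + p a - p b \<le> exp (2 * (a - b)))"
  using assms
proof (induction S rule: finite_linorder_max_induct)
  case empty
  show ?case by simp
next
  case (insert b S)
  obtain p where p: "\<And>a. a \<in> S \<Longrightarrow> 0 \<le> p a" "\<And>a. a \<in> S \<Longrightarrow> p a \<le> real (card S)"
    "\<And>a a'. a \<in> S \<Longrightarrow> a' \<in> S \<Longrightarrow> a \<le> a' \<Longrightarrow> p a \<le> p a'"
    "\<And>a a'. a \<in> S \<Longrightarrow> a' \<in> S \<Longrightarrow> 1 + p a - p a' \<le> exp (2 * (a - a'))"
    using insert.IH by blast
  have b: "b \<notin> S" using insert.hyps by auto
  show ?case
  proof (cases "S = {}")
    case True
    then show ?thesis by (intro exI[of _ "\<lambda>_. 0"]) simp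
  next
    case False
    define c where "c = Max S"
    have c: "c \<in> S" "\<And>a. a \<in> S \<Longrightarrow> a \<le> c" "c < b"
      using insert.hyps False by (simp_all add: c_def)
    \<comment> \<open>The smallest increment that the inequality for the pair \<open>(c, b)\<close>
      permits.\<close>
    define u where "u = 1 - exp (2 * (c - b))"
    have u: "0 \<le> u" "u \<le> 1" using c(3) by (simp_all add: u_def)
    define p' where "p' a = (if a = b then p c + u else p a)" for a
    have p'S: "p' a = p a" if "a \<in> S" for a using that b by (auto simp: p'_def)
    have p'b: "p' b = p c + u" by (simp add: p'_def)
    \<comment> \<open>\<open>E + 1/E \<ge> 2\<close> says precisely that
      \<open>1 + u \<le> E\<close>. Since \<open>E \<ge> 1\<close> and
      \<open>p c - p a \<ge> 0\<close>, the factor \<open>E\<close> also absorbs the earlier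
      increments, and the exponentials multiply.\<close>
    have up: "1 + (p c + u) - p a \<le> exp (2 * (b - a))" if a: "a \<in> S" for a
    proof -
      define E where "E = exp (2 * (b - c))"
      have E1: "1 \<le> E" using c(3) by (simp add: E_def)
      have "u = 1 - 1 / E" unfolding u_def E_def by (simp add: exp_minus[symmetric] divide_inverse)
      moreover have "2 \<le> E + 1 / E"
      proof -
        have "0 \<le> (E - 1)\<^sup>2 / E" using E1 by simp
        also have "(E - 1)\<^sup>2 / E = E + 1 / E - 2" using E1 by (simp add: power2_eq_square field_simps)
        finally show ?thesis by argo
      qed
      ultimately have Eu: "1 + u \<le> E" by argo
      have z: "0 \<le> p c - p a" using p(3)[OF a c(1) c(2)[OF a]] by simp
      have "1 + (p c + u) - p a = (1 + u) + (p c - p a)" by simp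
      also have "\<dots> \<le> E + E * (p c - p a)"
        using Eu mult_right_mono[OF E1 z] by argo
      also have "\<dots> = E * (1 + p c - p a)" by (simp add: algebra_simps)
      also have "\<dots> \<le> E * exp (2 * (c - a))" using p(4)[OF c(1) a] E1 by (intro mult_left_mono) auto
      also have "\<dots> = exp (2 * (b - a))" by (simp add: E_def exp_add[symmetric] algebra_simps)
      finally show ?thesis .
    qed
    \<comment> \<open>Moving the right end from \<open>c\<close> to \<open>b\<close> multiplies the
      exponential by \<open>1 - u\<close>; as the exponential is at most 1, it drops by no more than
      \<open>u\<close>.\<close>
    have down: "1 + p a - (p c + u) \<le> exp (2 * (a - b))" if a: "a \<in> S" for a
    proof -
      have "exp (2 * (a - c)) \<le> 1" using c(2)[OF a] by simp
      then have "u * exp (2 * (a - c)) \<le> u" using u(1) by (rule mult_left_le)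
      moreover have "exp (2 * (a - b)) = (1 - u) * exp (2 * (a - c))"
        by (simp add: u_def exp_add[symmetric] algebra_simps)
      then have "exp (2 * (a - b)) = exp (2 * (a - c)) - u * exp (2 * (a - c))" by (simp add: algebra_simps)
      ultimately show ?thesis using p(4)[OF a c(1)] by argo
    qed
    show ?thesis
    proof (intro exI[of _ p'] conjI ballI impI)
      fix a assume a: "a \<in> insert b S"
      show "0 \<le> p' a" using a p(1) p'S p'b u c(1) by (cases "a = b") auto
      have "real (card (insert b S)) = real (card S) + 1" using insert.hyps b by simp
      then show "p' a \<le> real (card (insert b S))"
        using a p(2)[of a] p(2)[OF c(1)] p'S[of a] p'b u by (cases "a = b") auto
      fix a' assume a': "a' \<in> insert b S"
      show "1 + p' a - p' a' \<le> exp (2 * (a - a'))"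
        using a a' up down p(4) p'S p'b by (cases "a = b"; cases "a' = b") auto
      assume aa: "a \<le> a'"
      show "p' a \<le> p' a'"
      proof (cases "a = b")
        case True
        then have "a' = b" using aa a' insert.hyps(2) by force
        then show ?thesis using True by simp
      next
        case False
        then have aS: "a \<in> S" using a by simp
        show ?thesis
        proof (cases "a' = b")
          case True
          then show ?thesis using p(3)[OF aS c(1) c(2)[OF aS]] p'S[OF aS] p'b u(1) by simp
        next
          case False
          then have "a' \<in> S" using a' by simp
          then show ?thesis using p(3)[OF aS _ aa] p'S aS by simp
        qed
      qed
    qed
  qed
qed

text \<open>
  The shift by \<open>c\<close> equalises the two factors, so that their geometric mean is their arithmetic
  mean; the latter is bounded below by replacing \<open>exp\<close> by the bounded potential \<open>p\<close>, whose
  contribution is a first-order (gradient) term.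
\<close>

lemma gap_duality:
  fixes q q' :: "nat \<Rightarrow> nat \<Rightarrow> real" and l r :: "nat \<Rightarrow> real"
  assumes q: "\<And>i j. 0 \<le> q i j" "(\<Sum>i<m. \<Sum>j<n. q i j) = 1"
    and q': "\<And>i j. 0 \<le> q' i j" "(\<Sum>i<m. \<Sum>j<n. q' i j) = 1"
    and \<nu>: "0 \<le> \<nu>"
    and first_order: "\<And>f g :: real \<Rightarrow> real. g 0 = 0 \<Longrightarrow>
      - (\<nu> * sqrt ((\<Sum>i<m. (f (l i))\<^sup>2) + (\<Sum>j<n. (g (r j))\<^sup>2))) \<le>
      (\<Sum>i<m. \<Sum>j<n. (q i j - q' i j) * (f (l i) - g (r j)))"
  shows "1 - real (m + n + 1) * sqrt (real (m + n)) / 2 * \<nu> \<le>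
    sqrt (gap_sum m n q l r 2 * gap_sum m n q' l r (- 2))"
proof -
  define P where "P = gap_sum m n q l r 2"
  define Q where "Q = gap_sum m n q' l r (- 2)"
  have pos: "P > 0" "Q > 0"
    unfolding P_def Q_def by (rule gap_sum_pos; use q q' in simp)+
  define c where "c = ln (Q / P) / 4"
  have ec: "exp (4 * c) = Q / P" using pos by (simp add: c_def)
  have bal: "exp (2 * c) * P = sqrt (P * Q)" "exp (- (2 * c)) * Q = sqrt (P * Q)"
  proof -
    have "(exp (2 * c) * P)\<^sup>2 = exp (4 * c) * P\<^sup>2"
      by (simp add: power_mult_distrib exp_double[symmetric])
    also have "\<dots> = P * Q" using pos by (simp add: ec power2_eq_square)
    finally have "sqrt (P * Q) = \<bar>exp (2 * c) * P\<bar>" by (metis real_sqrt_abs)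
    then show 1: "exp (2 * c) * P = sqrt (P * Q)" using pos by simp
    have "(exp (- (2 * c)) * Q) * (exp (2 * c) * P) = P * Q" by (simp add: exp_minus)
    also have "\<dots> = sqrt (P * Q) * sqrt (P * Q)" using pos by simp
    finally have "(exp (- (2 * c)) * Q) * sqrt (P * Q) = sqrt (P * Q) * sqrt (P * Q)" unfolding 1 .
    moreover have "sqrt (P * Q) \<noteq> 0" using pos by simp
    ultimately show "exp (- (2 * c)) * Q = sqrt (P * Q)" by (metis mult_right_cancel)
  qed
  \<comment> \<open>Adding 0 allows the potential to be normalised there, which gives
    \<open>g 0 = 0\<close>: in case (ii) all \<open>r j\<close> are 0 and the second direction must
    vanish. This is the origin of the \<open>+ 1\<close> in \<open>m + n + 1\<close>. For the same
    reason the shift \<open>c\<close> is put on the left eigenvalues.\<close>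
  define S where "S = insert 0 ((\<lambda>i. l i + c) ` {..<m} \<union> r ` {..<n})"
  have S: "finite S" "0 \<in> S" "\<And>i. i < m \<Longrightarrow> l i + c \<in> S" "\<And>j. j < n \<Longrightarrow> r j \<in> S"
    by (auto simp: S_def)
  have "card S \<le> Suc (card ((\<lambda>i. l i + c) ` {..<m} \<union> r ` {..<n}))"
    unfolding S_def by (rule card_insert_le_m1) simp_all
  also have "\<dots> \<le> Suc (card ((\<lambda>i. l i + c) ` {..<m}) + card (r ` {..<n}))"
    by (simp add: card_Un_le)
  also have "\<dots> \<le> m + n + 1"
    using card_image_le[of "{..<m}" "\<lambda>i. l i + c"] card_image_le[of "{..<n}" r] by simp
  finally have cardS: "real (card S) \<le> real (m + n + 1)" by simp
  obtain p where p: "\<And>a. a \<in> S \<Longrightarrow> 0 \<le> p a \<and> p a \<le> real (card S)"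
    "\<And>a b. a \<in> S \<Longrightarrow> b \<in> S \<Longrightarrow> 1 + p a - p b \<le> exp (2 * (a - b))"
    using exp_gap_potential[OF S(1)] by blast
  define f where "f x = p (x + c) - p 0" for x
  define g where "g x = p x - p 0" for x
  have up: "1 + f (l i) - g (r j) \<le> exp (2 * (l i + c - r j))"
    and down: "1 + g (r j) - f (l i) \<le> exp (2 * (r j - (l i + c)))" if "i < m" "j < n" for i j
    unfolding f_def g_def using p(2)[OF S(3)[OF that(1)] S(4)[OF that(2)]]
      p(2)[OF S(4)[OF that(2)] S(3)[OF that(1)]] by argo+
  have abs_le: "(p a - p 0)\<^sup>2 \<le> (real (m + n + 1))\<^sup>2" if "a \<in> S" for a
  proof -
    have "\<bar>p a - p 0\<bar> \<le> real (m + n + 1)" using p(1)[OF that] p(1)[OF S(2)] cardS by argo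
    then show ?thesis by (simp add: abs_le_square_iff[symmetric])
  qed
  have "(\<Sum>i<m. (f (l i))\<^sup>2) + (\<Sum>j<n. (g (r j))\<^sup>2) \<le>
      (\<Sum>i<m. (real (m + n + 1))\<^sup>2) + (\<Sum>j<n. (real (m + n + 1))\<^sup>2)"
    unfolding f_def g_def by (intro add_mono sum_mono abs_le S(3,4)) auto
  also have "\<dots> = (real (m + n + 1))\<^sup>2 * real (m + n)" by (simp add: algebra_simps)
  finally have "sqrt ((\<Sum>i<m. (f (l i))\<^sup>2) + (\<Sum>j<n. (g (r j))\<^sup>2)) \<le> sqrt ((real (m + n + 1))\<^sup>2 * real (m + n))"
    by (rule real_sqrt_le_mono)
  also have "\<dots> = real (m + n + 1) * sqrt (real (m + n))" by (simp add: real_sqrt_mult)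
  finally have "\<nu> * sqrt ((\<Sum>i<m. (f (l i))\<^sup>2) + (\<Sum>j<n. (g (r j))\<^sup>2)) \<le>
      \<nu> * (real (m + n + 1) * sqrt (real (m + n)))"
    by (rule mult_left_mono[OF _ \<nu>])
  then have lower: "- (\<nu> * (real (m + n + 1) * sqrt (real (m + n)))) \<le>
      (\<Sum>i<m. \<Sum>j<n. (q i j - q' i j) * (f (l i) - g (r j)))"
    using first_order[of g f] by (simp add: g_def)
  \<comment> \<open>Both weight families have total mass 1, so inserting the constant 1 into each
    mean is compensated by \<open>- 2\<close>.\<close>
  have "(\<Sum>i<m. \<Sum>j<n. (q i j - q' i j) * (f (l i) - g (r j))) =
      (\<Sum>i<m. \<Sum>j<n. q i j * (1 + f (l i) - g (r j))) + (\<Sum>i<m. \<Sum>j<n. q' i j * (1 + g (r j) - f (l i))) - 2"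
  proof -
    have "(q i j - q' i j) * (f (l i) - g (r j)) =
      q i j * (1 + f (l i) - g (r j)) + q' i j * (1 + g (r j) - f (l i)) - (q i j + q' i j)" for i j
      by (simp add: algebra_simps)
    then show ?thesis using q(2) q'(2) by (simp add: sum.distrib sum_subtractf)
  qed
  also have "(\<Sum>i<m. \<Sum>j<n. q i j * (1 + f (l i) - g (r j))) \<le> (\<Sum>i<m. \<Sum>j<n. q i j * exp (2 * (l i + c - r j)))"
    by (intro sum_mono mult_left_mono q(1) up) auto
  also have "(\<Sum>i<m. \<Sum>j<n. q i j * exp (2 * (l i + c - r j))) = exp (2 * c) * P"
    unfolding P_def gap_sum_def sum_distrib_left
    by (intro sum.cong refl) (simp add: exp_add[symmetric] algebra_simps)
  also have "(\<Sum>i<m. \<Sum>j<n. q' i j * (1 + g (r j) - f (l i))) \<le> (\<Sum>i<m. \<Sum>j<n. q' i j * exp (2 * (r j - (l i + c))))"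
    by (intro sum_mono mult_left_mono q'(1) down) auto
  also have "(\<Sum>i<m. \<Sum>j<n. q' i j * exp (2 * (r j - (l i + c)))) = exp (- (2 * c)) * Q"
    unfolding Q_def gap_sum_def sum_distrib_left
    by (intro sum.cong refl) (simp add: exp_add[symmetric] algebra_simps)
  finally have "(\<Sum>i<m. \<Sum>j<n. (q i j - q' i j) * (f (l i) - g (r j))) \<le> 2 * sqrt (P * Q) - 2"
    unfolding bal by simp
  with lower show ?thesis unfolding P_def[symmetric] Q_def[symmetric] by (simp add: mult_ac)
qed

lemma GL_polar_unitary:
  fixes l :: "nat \<Rightarrow> real"
  assumes X: "X \<in> GL n" and U: "unitary n U"
    and XX: "ctrans X * X = ediag n U 2 l"
  obtains W where "unitary n W" "X = W * udiag n U (\<lambda>a. exp (complex_of_real (l a)))"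
proof -
  note Xc = GL_minv(1)[OF X]
  define F where "F = udiag n U (\<lambda>a. exp (complex_of_real (l a)))"
  define F' where "F' = udiag n U (\<lambda>a. exp (- complex_of_real (l a)))"
  have c: "F \<in> carrier_mat n n" "F' \<in> carrier_mat n n" by (simp_all add: F_def F'_def)
  have FF: "F' * F = 1\<^sub>m n" unfolding F_def F'_def udiag_mult[OF U] by (simp add: exp_add[symmetric] udiag_one[OF U])
  have cF: "ctrans F' = F'" by (simp add: F'_def udiag_ctrans exp_cnj)
  have W: "unitary n (X * F')"
  proof (rule unitaryI)
    show "X * F' \<in> carrier_mat n n" by (rule mult_carrier_mat[OF Xc c(2)])
    have "ctrans (X * F') * (X * F') = F' * (ctrans X * X) * F'"
      using Xc c cF by (simp add: ctrans_mult mult_square[where n = n])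
    also have "\<dots> = udiag n U (\<lambda>_. 1)"
      unfolding XX F'_def udiag_mult[OF U] by (rule udiag_cong) (simp add: exp_add[symmetric])
    finally show "ctrans (X * F') * (X * F') = 1\<^sub>m n" by (simp add: udiag_one[OF U])
  qed
  have "X * F' * F = X * (F' * F)" using Xc c by (simp add: mult_square[where n = n])
  then have "X = X * F' * F" unfolding FF using Xc by simp
  then show ?thesis using that[OF W] unfolding F_def by blast
qed

text \<open>Polar decomposition writes \<open>K1\<close> and \<open>K2\<close> as unitary matrices,
  which preserve the cost, times exponentials of a tangent pair. \<open>gap_duality\<close> bounds
  the ratio of the costs, with Cauchy-Schwarz supplying its first-order hypothesis. The bound is
  free of \<open>K1\<close> and \<open>K2\<close>, so it carries over to the infimum; it is
  multiplicative because the left factor may be negative.\<close>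

theorem optimality_gap:
  assumes G: "symmetric_subgroup2 m n G"
    and R1: "\<And>i. i < m \<Longrightarrow> R1 i i" "symp R1" "transp R1"
    and R2: "symp R2" "transp R2" "(\<forall>j<n. R2 j j) \<or> (\<forall>i j. \<not> R2 i j)"
    and L: "iLieK m n G = herm_pat m R1 \<times> herm_pat n R2"
    and X: "X \<in> GL m" and Y: "Y \<in> GL n" and A: "A \<in> carrier_mat m n" "A \<noteq> 0\<^sub>m m n"
    and K: "(K1, K2) \<in> G"
  shows "(1 - real (m + n + 1) * sqrt (real (m + n)) / 2 * pnorm (grad m n R1 R2 A (X, Y))) * kappa_tilde A (X, Y)
    \<le> kappa_tilde A (K1 * X, K2 * Y)"
proof -
  have gl: "K1 \<in> GL m" "K2 \<in> GL n" using symmetric_subgroup2D(1)[OF G K] by auto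
  obtain U l V r where UV: "unitary m U" "unitary n V"
    "ctrans K1 * K1 = ediag m U 2 l"
    "ctrans K2 * K2 = ediag n V 2 r"
    and H: "(hdiag m U l, hdiag n V r) \<in> iLieK m n G"
    by (rule iLieK_polar[OF G K])
  define F1 where "F1 = udiag m U (\<lambda>a. exp (complex_of_real (l a)))"
  define F2 where "F2 = udiag n V (\<lambda>a. exp (complex_of_real (r a)))"
  have Fgl: "F1 \<in> GL m" "F2 \<in> GL n"
    unfolding F1_def F2_def by (rule udiag_inverse(1)[OF UV(1)], simp, rule udiag_inverse(1)[OF UV(2)], simp)
  obtain W1 where W1: "unitary m W1" "K1 = W1 * F1"
    unfolding F1_def by (rule GL_polar_unitary[OF gl(1) UV(1,3)])
  obtain W2 where W2: "unitary n W2" "K2 = W2 * F2"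
    unfolding F2_def by (rule GL_polar_unitary[OF gl(2) UV(2,4)])
  let ?g = "grad m n R1 R2 A (X, Y)"
  define q where "q = wt U V (X * A * minv Y)"
  define q' where "q' = (\<lambda>i j. wt V U (Y * pinv A * minv X) j i)"
  have q0: "\<And>i j. 0 \<le> q i j" "\<And>i j. 0 \<le> q' i j" by (simp_all add: q_def q'_def wt_nonneg)
  have q1: "(\<Sum>i<m. \<Sum>j<n. q i j) = 1" "(\<Sum>i<m. \<Sum>j<n. q' i j) = 1"
    unfolding q_def q'_def using wt_total[OF X Y A R1(2) R2(1) UV(1,2)]
    unfolding scaled_def by auto
  have first_order: "- (pnorm ?g * sqrt ((\<Sum>i<m. (f (l i))\<^sup>2) + (\<Sum>j<n. (h (r j))\<^sup>2))) \<le>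
      (\<Sum>i<m. \<Sum>j<n. (q i j - q' i j) * (f (l i) - h (r j)))" if h: "h 0 = 0" for f h :: "real \<Rightarrow> real"
  proof -
    let ?H1 = "hdiag m U (\<lambda>a. f (l a))"
    let ?H2 = "hdiag n V (\<lambda>a. h (r a))"
    have H1: "?H1 \<in> herm_pat m R1"
      by (rule herm_pat_fun[OF R1 UV(1)]) (use H L in auto)
    have H2: "?H2 \<in> herm_pat n R2"
      using R2(3)
    proof
      assume refl: "\<forall>j<n. R2 j j"
      show ?thesis by (rule herm_pat_fun[OF _ R2(1,2) UV(2)]) (use H L refl in auto)
    next
      assume "\<forall>i j. \<not> R2 i j"
      then have R2e: "R2 = (\<lambda>_ _. False)" by auto
      have "hdiag n V r = udiag n V (\<lambda>_. 0)"
        using H unfolding L R2e herm_pat_empty udiag_zero by simp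
      from udiag_inj[OF UV(2) this] have "r a = 0" if "a < n" for a using that by simp
      then have "?H2 = udiag n V (\<lambda>_. 0)" using h by (intro udiag_cong) simp
      then show ?thesis by (simp add: udiag_zero zero_herm_pat)
    qed
    have "pair_inner ?g (?H1, ?H2) = (\<Sum>i<m. \<Sum>j<n. (q i j - q' i j) * (f (l i) - h (r j)))"
      unfolding grad_inner[OF X Y A R1(2) R2(1) UV(1,2) H1 H2] q_def q'_def
      unfolding scaled_def ..
    moreover have "\<bar>pair_inner ?g (?H1, ?H2)\<bar> \<le> pnorm ?g * pnorm (?H1, ?H2)"
    proof (rule pair_inner_le)
      show "?g \<in> carrier_mat m m \<times> carrier_mat n n"
        using grad_herm_pat[OF X Y A R1(2) R2(1)] by (auto simp: herm_pat_def)
    qed simp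
    moreover have "pnorm (?H1, ?H2) = sqrt ((\<Sum>i<m. (f (l i))\<^sup>2) + (\<Sum>j<n. (h (r j))\<^sup>2))"
      by (simp add: pnorm_def fsq_udiag[OF UV(1)] fsq_udiag[OF UV(2)])
    ultimately show ?thesis by simp
  qed
  have "pnorm ?g \<ge> 0" by (simp add: pnorm_def)
  from gap_duality[OF q0(1) q1(1) q0(2) q1(2) this first_order]
  have "1 - real (m + n + 1) * sqrt (real (m + n)) / 2 * pnorm ?g \<le>
    sqrt (gap_sum m n q l r 2 * gap_sum m n q' l r (- 2))" .
  moreover have kpos: "0 \<le> kappa_tilde A (X, Y)" using kappa_tilde_ge_1[OF X Y A] by simp
  ultimately have "(1 - real (m + n + 1) * sqrt (real (m + n)) / 2 * pnorm ?g) * kappa_tilde A (X, Y) \<le>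
    kappa_tilde A (X, Y) * sqrt (gap_sum m n q l r 2 * gap_sum m n q' l r (- 2))"
    by (subst mult.commute) (rule mult_left_mono)
  also have "\<dots> = kappa_tilde A (F1 * X, F2 * Y)"
    using kappa_tilde_curve_wt[OF X Y A R1(2) R2(1) UV(1,2), of 1 l r]
    unfolding scaled_def
    by (simp add: F1_def F2_def q_def q'_def)
  also have "\<dots> = kappa_tilde A (W1 * (F1 * X), W2 * (F2 * Y))"
    by (rule kappa_tilde_unitary[symmetric, OF GL_mult(1)[OF Fgl(1) X] GL_mult(1)[OF Fgl(2) Y] A W1(1) W2(1)])
  also have "W1 * (F1 * X) = K1 * X"
    unfolding W1(2) using unitaryD(1)[OF W1(1)] GL_minv(1)[OF Fgl(1)] GL_minv(1)[OF X]
    by (simp add: mult_square[where n = m])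
  also have "W2 * (F2 * Y) = K2 * Y"
    unfolding W2(2) using unitaryD(1)[OF W2(1)] GL_minv(1)[OF Fgl(2)] GL_minv(1)[OF Y]
    by (simp add: mult_square[where n = n])
  finally show ?thesis .
qed

subsection \<open>Convergence of the gradient descent\<close>

text \<open>Serves to conclude that a full-rank matrix with positive dimensions is nonzero.\<close>

lemma (in vec_space) rank_zero_mat: "rank (0\<^sub>m n nc) = 0"
proof -
  have cols: "set (cols (0\<^sub>m n nc :: 'a mat)) \<subseteq> {0\<^sub>v n}" by (auto simp: cols_def)
  have "maximal {} (\<lambda>T. T \<subseteq> set (cols (0\<^sub>m n nc :: 'a mat)) \<and> lin_indpt T)"
    unfolding maximal_def
  proof (intro conjI allI impI)
    show "lin_indpt {}" by (simp add: lin_dep_def)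
    fix B assume B: "{} \<subseteq> B \<and> B \<subseteq> set (cols (0\<^sub>m n nc :: 'a mat)) \<and> lin_indpt B"
    then have "B \<subseteq> {0\<^sub>v n}" using cols by blast
    moreover have "0\<^sub>v n \<notin> B"
      using vs_zero_lin_dep[of B] B \<open>B \<subseteq> {0\<^sub>v n}\<close> by auto
    ultimately show "B = {}" by auto
  qed simp
  from rank_card_indpt[OF zero_carrier_mat this] show ?thesis by simp
qed

text \<open>\<open>T2\<close> covers both cases at once: a torus in the second factor, or a trivial
  second factor.\<close>

theorem gradient_descent_convergence:
  fixes \<epsilon> :: real
  assumes m: "0 < m" and G: "symmetric_subgroup2 m n G" and T1: "diag_torus m \<times> {1\<^sub>m n} \<subseteq> G"
    and T2: "{1\<^sub>m m} \<times> diag_torus n \<subseteq> G \<or> (\<forall>(X, Y)\<in>G. Y = 1\<^sub>m n)"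
    and A: "A \<in> carrier_mat m n" "A \<noteq> 0\<^sub>m m n" and \<epsilon>: "0 < \<epsilon>" "\<epsilon> < 1 / 2"
    and T: "real T \<ge> 3456 * real (max (m ^ 3) (n ^ 3)) * ln (kappaF A / kappa_star G A) / \<epsilon>\<^sup>2"
  shows "ln (kappa_tilde A (gd_seq m n G A (1 / 8) T)) - ln (kappa_star G A) < \<epsilon>"
proof -
  obtain R1 R2 where R1: "\<And>i. i < m \<Longrightarrow> R1 i i" "symp R1" "transp R1"
    and R2: "symp R2" "transp R2" "(\<forall>j<n. R2 j j) \<or> (\<forall>i j. \<not> R2 i j)"
    and L: "iLieK m n G = herm_pat m R1 \<times> herm_pat n R2"
  proof (rule iLieK_pattern[OF G T1 T2])
    fix R1 R2
    assume "\<And>i. i < m \<Longrightarrow> R1 i i" "symp R1" "transp R1" "symp R2" "transp R2"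
      "(\<forall>j<n. R2 j j) \<or> (\<forall>i j. \<not> R2 i j)" "iLieK m n G = herm_pat m R1 \<times> herm_pat n R2"
    then show thesis by (rule that)
  qed
  define z where "z k = gd_seq m n G A (1 / 8) k" for k
  define g where "g k = grad m n R1 R2 A (z k)" for k
  define N where "N = real (m + n + 1) * sqrt (real (m + n))"
  have GLG: "fst x \<in> GL m" "snd x \<in> GL n" if "x \<in> G" for x
    using symmetric_subgroup2D(1)[OF G, of "fst x" "snd x"] that by auto
  have gradient: "gradient m n G (costC A) x = grad m n R1 R2 A x" "grad m n R1 R2 A x \<in> iLieK m n G" if "x \<in> G" for x
    using gradient_eq_grad[OF GLG[OF that] A R1(2) R2(1) L] grad_herm_pat[OF GLG[OF that] A R1(2) R2(1)] L by simp_all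
  \<comment> \<open>Membership and the gradient formula depend on each other: the formula is
    available at points of \<open>G\<close>, and the exponential of a tangent gradient keeps the
    next iterate there.\<close>
  have zG: "z k \<in> G" for k
  proof (induction k)
    case 0
    then show ?case using symmetric_subgroup2D(2)[OF G] by (simp add: z_def)
  next
    case (Suc k)
    have "(fst (g k), snd (g k)) \<in> LieG m n G" using gradient(2)[OF Suc] unfolding g_def iLieK_def by auto
    then have "(mexp (of_real (- (1 / 8)) \<cdot>\<^sub>m fst (g k)), mexp (of_real (- (1 / 8)) \<cdot>\<^sub>m snd (g k))) \<in> G"
      unfolding LieG_def by blast
    from symmetric_subgroup2D(3)[OF G this, of "fst (z k)" "snd (z k)"] Suc
    show ?case using gradient(1)[OF Suc] by (simp add: z_def g_def Let_def)
  qed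
  have zS: "z (Suc k) = (mexp (of_real (- (1 / 8)) \<cdot>\<^sub>m fst (g k)) * fst (z k), mexp (of_real (- (1 / 8)) \<cdot>\<^sub>m snd (g k)) * snd (z k))" for k
    using gradient(1)[OF zG[of k]] by (simp add: z_def g_def Let_def)
  have ge1: "1 \<le> kappa_tilde A x" if "x \<in> G" for x
    using kappa_tilde_ge_1[OF GLG[OF that] A] by simp
  have bdd: "bdd_below (kappa_tilde A ` G)" using ge1 by (intro bdd_belowI2[of _ 1]) auto
  have ne: "kappa_tilde A ` G \<noteq> {}" using zG by blast
  define \<kappa> where "\<kappa> = kappa_star G A"
  have \<kappa>1: "1 \<le> \<kappa>" unfolding \<kappa>_def kappa_star_def by (rule cInf_greatest[OF ne]) (use ge1 in auto)
  have \<kappa>_le: "\<kappa> \<le> kappa_tilde A x" if "x \<in> G" for x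
    unfolding \<kappa>_def kappa_star_def by (rule cInf_lower[OF _ bdd]) (use that in auto)
  \<comment> \<open>Every point of \<open>G\<close> is a translate of the current iterate by an
    element of \<open>G\<close>, so the uniform lower bound holds against the infimum.\<close>
  have gap: "(1 - N / 2 * pnorm (g k)) * kappa_tilde A (z k) \<le> \<kappa>" for k
    unfolding \<kappa>_def kappa_star_def
  proof (rule cInf_greatest[OF ne])
    fix y assume "y \<in> kappa_tilde A ` G"
    then obtain X Y where XY: "(X, Y) \<in> G" "y = kappa_tilde A (X, Y)" by auto
    obtain X0 Y0 where z0: "z k = (X0, Y0)" by (cases "z k")
    have z0G: "(X0, Y0) \<in> G" using zG[of k] z0 by simp
    have gl: "X0 \<in> GL m" "Y0 \<in> GL n" "X \<in> GL m" "Y \<in> GL n"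
      using symmetric_subgroup2D(1)[OF G] XY(1) z0G by auto
    have K: "(X * minv X0, Y * minv Y0) \<in> G"
      by (rule symmetric_subgroup2D(3)[OF G XY(1) symmetric_subgroup2D(4)[OF G z0G]])
    have X: "X * minv X0 * X0 = X"
      using GL_minv[OF gl(1)] GL_minv[OF gl(3)] by (simp add: mult_square[where n = m])
    have Y: "Y * minv Y0 * Y0 = Y"
      using GL_minv[OF gl(2)] GL_minv[OF gl(4)] by (simp add: mult_square[where n = n])
    show "(1 - N / 2 * pnorm (g k)) * kappa_tilde A (z k) \<le> y"
      using optimality_gap[OF G R1 R2 L gl(1,2) A K] unfolding X Y XY(2) N_def g_def z0 .
  qed
  define \<Delta> where "\<Delta> k = ln (kappa_tilde A (z k)) - ln \<kappa>" for k
  have dec: "\<Delta> (Suc k) \<le> \<Delta> k - (pnorm (g k))\<^sup>2 / 192" for k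
    using costC_decrease[OF GLG[OF zG[of k]] A R1(2) R2(1)]
    unfolding \<Delta>_def zS costC_def g_def prod.collapse by simp
  have \<Delta>0: "\<Delta> 0 = ln (kappaF A / \<kappa>)" "0 \<le> \<Delta> 0"
  proof -
    have "kappa_tilde A (z 0) = kappaF A"
      using A(1) pinv(1)[OF A(1)] by (simp add: z_def kappa_tilde_def kappaF_def)
    then show "\<Delta> 0 = ln (kappaF A / \<kappa>)" using ge1[OF zG[of 0]] \<kappa>1 by (simp add: \<Delta>_def ln_div)
    show "0 \<le> \<Delta> 0" using \<kappa>_le[OF zG[of 0]] \<kappa>1 by (simp add: \<Delta>_def)
  qed
  have N0: "N > 0" using m by (simp add: N_def)
  \<comment> \<open>\<open>m + n + 1 \<le> 3 M\<close> and \<open>m + n \<le> 2 M\<close> for the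
    larger dimension \<open>M\<close>, whence \<open>18 = 3^2 * 2\<close>.\<close>
  have N2: "N\<^sup>2 \<le> 18 * real (max (m ^ 3) (n ^ 3))"
  proof -
    define M where "M = max m n"
    have M: "m \<le> M" "n \<le> M" "1 \<le> M" using m by (auto simp: M_def)
    have "max (m ^ 3) (n ^ 3) = M ^ 3" unfolding M_def by (simp add: max_def power_mono_iff)
    moreover have "N\<^sup>2 = real ((m + n + 1)\<^sup>2 * (m + n))" by (simp add: N_def power_mult_distrib)
    moreover have "(m + n + 1)\<^sup>2 * (m + n) \<le> (3 * M)\<^sup>2 * (2 * M)"
      by (intro mult_le_mono power_mono) (use M in auto)
    moreover have "(3 * M)\<^sup>2 * (2 * M) = 18 * M ^ 3" by (simp add: power2_eq_square power3_eq_cube)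
    ultimately show ?thesis by (metis of_nat_le_iff of_nat_mult of_nat_numeral)
  qed
  \<comment> \<open>A gap of at least \<epsilon> makes the cost ratio at most
    \<open>exp (- \<epsilon>) \<le> 1 - \<epsilon>/2\<close>, so \<open>gap\<close> forces a
    gradient of norm at least \<open>\<epsilon> / N\<close>.\<close>
  have step: "\<Delta> (Suc k) \<le> \<Delta> k - \<epsilon>\<^sup>2 / (192 * N\<^sup>2)" if large: "\<epsilon> \<le> \<Delta> k" for k
  proof -
    have kpos: "0 < kappa_tilde A (z k)" using ge1[OF zG[of k]] by simp
    have "1 - N / 2 * pnorm (g k) \<le> \<kappa> / kappa_tilde A (z k)"
      using gap[of k] kpos by (simp add: pos_le_divide_eq)
    also have "\<kappa> / kappa_tilde A (z k) = exp (- \<Delta> k)"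
      using kpos \<kappa>1 by (simp add: \<Delta>_def exp_diff)
    also have "\<dots> \<le> exp (- \<epsilon>)" using large by simp
    also have "\<dots> \<le> 1 - \<epsilon> / 2"
    proof -
      have "1 \<le> (1 - \<epsilon> / 2) * (1 + \<epsilon>)"
      proof -
        have "0 \<le> \<epsilon> / 2 * (1 - \<epsilon>)" using \<epsilon> by simp
        then show ?thesis by (simp add: algebra_simps)
      qed
      also have "\<dots> \<le> (1 - \<epsilon> / 2) * exp \<epsilon>" using \<epsilon> by (intro mult_left_mono exp_ge_add_one_self) auto
      finally have "exp (- \<epsilon>) * 1 \<le> exp (- \<epsilon>) * ((1 - \<epsilon> / 2) * exp \<epsilon>)" by (rule mult_left_mono) simp
      also have "\<dots> = (1 - \<epsilon> / 2) * (exp (- \<epsilon>) * exp \<epsilon>)" by (simp only: mult_ac)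
      also have "exp (- \<epsilon>) * exp \<epsilon> = 1" by (simp add: exp_minus)
      finally show ?thesis by simp
    qed
    finally have "\<epsilon> \<le> N * pnorm (g k)" by argo
    then have "\<epsilon> / N \<le> pnorm (g k)" using N0 by (simp add: pos_divide_le_eq mult.commute)
    then have "(\<epsilon> / N)\<^sup>2 \<le> (pnorm (g k))\<^sup>2" using \<epsilon> N0 by (intro power_mono) auto
    then have "\<epsilon>\<^sup>2 / (192 * N\<^sup>2) \<le> (pnorm (g k))\<^sup>2 / 192" by (simp add: power_divide)
    then show ?thesis using dec[of k] by argo
  qed
  have antimono: "\<Delta> (Suc k) \<le> \<Delta> k" for k
    using dec[of k] zero_le_power2[of "pnorm (g k)"] by argo
  \<comment> \<open>The gap is nonincreasing, so a gap of at least \<epsilon> at time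
    \<open>T\<close> means that every earlier step made the full progress. By the choice of
    \<open>T\<close> these steps use up the initial gap, which contradicts positivity.\<close>
  have "\<Delta> T < \<epsilon>"
  proof (rule ccontr)
    assume "\<not> \<Delta> T < \<epsilon>"
    then have big: "\<epsilon> \<le> \<Delta> k" if "k \<le> T" for k
      using lift_Suc_antimono_le[of \<Delta>, OF antimono that] by argo
    have "\<Delta> k \<le> \<Delta> 0 - real k * (\<epsilon>\<^sup>2 / (192 * N\<^sup>2))" if "k \<le> T" for k
      using that
    proof (induction k)
      case 0
      then show ?case by simp
    next
      case (Suc k)
      then have "\<Delta> k \<le> \<Delta> 0 - real k * (\<epsilon>\<^sup>2 / (192 * N\<^sup>2))" by simp
      moreover have "\<Delta> (Suc k) \<le> \<Delta> k - \<epsilon>\<^sup>2 / (192 * N\<^sup>2)" by (rule step[OF big]) (use Suc.prems in simp)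
      moreover have "real (Suc k) * (\<epsilon>\<^sup>2 / (192 * N\<^sup>2)) = real k * (\<epsilon>\<^sup>2 / (192 * N\<^sup>2)) + \<epsilon>\<^sup>2 / (192 * N\<^sup>2)"
        by (simp only: of_nat_Suc distrib_right mult_1 add.commute)
      ultimately show ?case by argo
    qed
    from this[of T] have "\<Delta> T \<le> \<Delta> 0 - real T * (\<epsilon>\<^sup>2 / (192 * N\<^sup>2))" by simp
    moreover have "\<Delta> 0 \<le> real T * (\<epsilon>\<^sup>2 / (192 * N\<^sup>2))"
    proof -
      have "\<Delta> 0 * (192 * N\<^sup>2) \<le> \<Delta> 0 * (192 * (18 * real (max (m ^ 3) (n ^ 3))))"
        by (intro mult_left_mono N2 \<Delta>0(2)) simp
      also have "\<dots> \<le> real T * \<epsilon>\<^sup>2"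
        using T \<epsilon> unfolding \<kappa>_def[symmetric] \<Delta>0(1)[symmetric] by (simp add: pos_divide_le_eq mult_ac)
      finally show ?thesis using N0 by (simp add: pos_le_divide_eq)
    qed
    ultimately have "\<Delta> T \<le> 0" by argo
    then show False using big[of T] \<epsilon>(1) by simp
  qed
  then show ?thesis by (simp add: \<Delta>_def z_def \<kappa>_def)
qed

theorem mainTheorem4:
  "\<exists>c>0::real.
    (\<forall>(m::nat) (n::nat) G A (\<epsilon>::real) (T::nat).
       0 < m \<longrightarrow> 0 < n \<longrightarrow>
       symmetric_subgroup2 m n G \<longrightarrow> diag_torus m \<times> diag_torus n \<subseteq> G \<longrightarrow>
       A \<in> carrier_mat m n \<longrightarrow> vec_space.rank m A = min m n \<longrightarrow>
       0 < \<epsilon> \<longrightarrow> \<epsilon> < 1/2 \<longrightarrow>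
       real T \<ge> c * real (max (m^3) (n^3)) * ln (kappaF A / kappa_star G A) / \<epsilon>^2 \<longrightarrow>
       ln (kappa_tilde A (gd_seq m n G A (1/8) T)) - ln (kappa_star G A) < \<epsilon>)
  \<and>
    (\<forall>(m::nat) (n::nat) G A (\<epsilon>::real) (T::nat).
       0 < m \<longrightarrow> 0 < n \<longrightarrow>
       symmetric_subgroup1 m G \<longrightarrow> diag_torus m \<subseteq> G \<longrightarrow>
       A \<in> carrier_mat m n \<longrightarrow> vec_space.rank m A = min m n \<longrightarrow>
       0 < \<epsilon> \<longrightarrow> \<epsilon> < 1/2 \<longrightarrow>
       real T \<ge> c * real (max (m^3) (n^3)) * ln (kappaF A / kappa_star (embed1 n G) A) / \<epsilon>^2 \<longrightarrow>
       ln (kappa_tilde A (gd_seq m n (embed1 n G) A (1/8) T)) - ln (kappa_star (embed1 n G) A) < \<epsilon>)"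
proof -
  have nz: "A \<noteq> 0\<^sub>m m n" if "0 < m" "0 < n" "vec_space.rank m A = min m n" for m n and A :: "complex mat"
    using that vec_space.rank_zero_mat[where ?'a = complex, of m n] by auto
  have one: "1\<^sub>m k \<in> diag_torus k" for k by (auto simp: diag_torus_def)
  show ?thesis
  \<comment> \<open>\<open>3456 = 192 * 18\<close>, from the decrease per step and the bound on
    \<open>N^2\<close>.\<close>
  proof (intro exI[of _ "3456::real"] conjI allI impI)
    fix m n G A T and \<epsilon> :: real
    assume mn: "0 < m" "0 < n" and G: "symmetric_subgroup2 m n G" "diag_torus m \<times> diag_torus n \<subseteq> G"
      and A: "A \<in> carrier_mat m n" "vec_space.rank m A = min m n" and \<epsilon>: "0 < \<epsilon>" "\<epsilon> < 1/2"
      and T: "real T \<ge> 3456 * real (max (m^3) (n^3)) * ln (kappaF A / kappa_star G A) / \<epsilon>^2"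
    show "ln (kappa_tilde A (gd_seq m n G A (1/8) T)) - ln (kappa_star G A) < \<epsilon>"
      by (rule gradient_descent_convergence[OF mn(1) G(1) _ _ A(1) nz[OF mn A(2)] \<epsilon> T])
        (use G(2) one in blast)+
  next
    fix m n G A T and \<epsilon> :: real
    assume mn: "0 < m" "0 < n" and G: "symmetric_subgroup1 m G" "diag_torus m \<subseteq> G"
      and A: "A \<in> carrier_mat m n" "vec_space.rank m A = min m n" and \<epsilon>: "0 < \<epsilon>" "\<epsilon> < 1/2"
      and T: "real T \<ge> 3456 * real (max (m^3) (n^3)) * ln (kappaF A / kappa_star (embed1 n G) A) / \<epsilon>^2"
    show "ln (kappa_tilde A (gd_seq m n (embed1 n G) A (1/8) T)) - ln (kappa_star (embed1 n G) A) < \<epsilon>"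
      by (rule gradient_descent_convergence[OF mn(1) symmetric_subgroup2_embed1[OF G(1)] _ _ A(1) nz[OF mn A(2)] \<epsilon> T])
        (use G(2) in \<open>auto simp: embed1_def\<close>)
  qed simp
qed

end
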